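(* Let $\Omega,\beta,\mu,\mu_0,\Gamma_\pm,\Gamma_0$ be as in the context, and assume that the surface measures of the outflow boundary $\Gamma_+$ and of the characteristic boundary $\Gamma_0$ are both $0$. There exists a constant $C>0$ (depending only on $\Omega,\beta,\mu$, hence independent of $u$ and $\epsilon$) such that the following holds. Let $f\in L^2(\Omega)$ and suppose that the solution $u$ of $\beta\cdot\nabla u+\mu u=f$ in $\Omega$, $u=0$ on $\Gamma_-$, belongs to $H^2(\Omega)\cap H_{\beta,-}(\Omega)$. Then for all $\epsilon>0$, $$\|u-u_\epsilon\|_{L^2(\Omega)}\le C\|u\|_{H^2(\Omega)}\,\epsilon$$ and $$\|\nabla(u-u_\epsilon)\|_{L^2(\Omega)}\le C\|u\|_{H^2(\Omega)}\,\epsilon^{1/2},$$ where $u_\epsilon\in H^1_{\Gamma_-}(\Omega)$ is the solution of the regularized problem described in the context.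
   Context: $\Omega\subset\mathbb{R}^d$ is a bounded domain with Lipschitz boundary $\partial\Omega$ and outward unit normal $n$ (defined a.e. on $\partial\Omega$ with respect to surface measure). $\beta\in W^{1,\infty}(\Omega)^d$ is identified with a Lipschitz function on $\overline{\Omega}$, $\mu\in L^\infty(\Omega)$, and it is assumed that $\mu_0:=\operatorname{ess\,inf}_{x\in\Omega}\left(\mu(x)-\frac12\operatorname{div}\beta(x)\right)>0$. Put $\Gamma_+=\{x\in\partial\Omega:\beta(x)\cdot n(x)>0\}$, $\Gamma_-=\{x\in\partial\Omega:\beta(x)\cdot n(x)<0\}$, $\Gamma_0=\{x\in\partial\Omega:\beta(x)\cdot n(x)=0\}$. A boundary condition on a set of surface measure $0$ is ignored. $H^1_{\Gamma_-}(\Omega)=\{v\in H^1(\Omega): v|_{\Gamma_-}=0\}$. $H_{\beta,-}(\Omega)=\{v\in L^2(\Omega):\beta\cdot\nabla v\in L^2(\Omega),\ v|_{\Gamma_-}=0\}$; for $v\in H^1(\Omega)$ the trace is the usual Sobolev trace. Regularized problem: for $\epsilon>0$, $-\epsilon\Delta u_\epsilon+\beta\cdot\nabla u_\epsilon+\mu u_\epsilon=f$ in $\Omega$, $u_\epsilon=0$ on $\Gamma_-$, $\partial u_\epsilon/\partial n=0$ on $\Gamma_+\cup\Gamma_0$; its solution is the unique $u_\epsilon\in H^1_{\Gamma_-}(\Omega)$ with $\epsilon\int_\Omega\nabla u_\epsilon\cdot\nabla v\,dx+\int_\Omega(\beta\cdot\nabla u_\epsilon+\mu u_\epsilon)v\,dx=\int_\Omega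 fv\,dx$ for all $v\in H^1_{\Gamma_-}(\Omega)$. *)

theory Defs
  imports "HOL-Analysis.Analysis" "HOL-Probability.Essential_Supremum"
begin

section \<open>Hausdorff measure\<close>

text \<open>
  The gauge of a set of diameter \<open>t\<close> is \<open>\<omega>\<^sub>s (t/2)\<^sup>s\<close>, where \<open>\<omega>\<^sub>s\<close> is the volume of the
  \<open>s\<close>-dimensional unit ball; with this normalisation the measure is the usual surface area on
  \<open>s\<close>-dimensional surfaces, and counting measure for \<open>s = 0\<close>. The empty set is treated separately
  because \<open>0 ^ 0 = 1\<close>. Boundedness is required of covering sets because \<open>diameter\<close> is only
  meaningful for bounded sets.
\<close>

definition hausdorff_gauge :: "nat \<Rightarrow> 'a::metric_space set \<Rightarrow> ennreal" where
  "hausdorff_gauge s C =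
     (if C = {} then 0 else ennreal (unit_ball_vol (real s) * (diameter C / 2) ^ s))"

definition fine_covers :: "real \<Rightarrow> 'a::metric_space set \<Rightarrow> (nat \<Rightarrow> 'a set) set" where
  "fine_covers \<delta> A = {C. A \<subseteq> (\<Union>i. C i) \<and> (\<forall>i. bounded (C i) \<and> diameter (C i) \<le> \<delta>)}"

definition hausdorff_content :: "nat \<Rightarrow> real \<Rightarrow> 'a::metric_space set \<Rightarrow> ennreal" where
  "hausdorff_content s \<delta> A = (INF C\<in>fine_covers \<delta> A. \<Sum>i. hausdorff_gauge s (C i))"

definition hausdorff_outer :: "nat \<Rightarrow> 'a::metric_space set \<Rightarrow> ennreal" where
  "hausdorff_outer s A = (SUP \<delta>\<in>{0<..}. hausdorff_content s \<delta> A)"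

definition hausdorff_measure :: "nat \<Rightarrow> 'a::metric_space measure" where
  "hausdorff_measure s = measure_of UNIV (sets borel) (hausdorff_outer s)"

text \<open>
  The remainder of this section shows that the Hausdorff outer measure is countably additive on
  Borel sets (Caratheodory's criterion for metric outer measures), so that the measure just
  defined agrees with it there: lemma \<open>emeasure_hausdorff_measure\<close>.
\<close>

lemma hausdorff_gauge_mono:
  assumes "A \<subseteq> B" "bounded B"
  shows "hausdorff_gauge s A \<le> hausdorff_gauge s B"
proof (cases "A = {}")
  case False
  then have "B \<noteq> {}" using assms by auto
  moreover have "diameter A \<le> diameter B" "0 \<le> diameter A"
    using assms by (auto intro: diameter_subset diameter_ge_0 bounded_subset)
  ultimately show ?thesis using False
    by (auto simp: hausdorff_gauge_def intro!: ennreal_leI mult_left_mono power_mono)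
qed (simp add: hausdorff_gauge_def)

lemma hausdorff_content_mono: "A \<subseteq> B \<Longrightarrow> hausdorff_content s \<delta> A \<le> hausdorff_content s \<delta> B"
  unfolding hausdorff_content_def fine_covers_def by (rule INF_superset_mono) auto

lemma hausdorff_content_antimono:
  "\<delta> \<le> \<delta>' \<Longrightarrow> hausdorff_content s \<delta>' A \<le> hausdorff_content s \<delta> A"
  unfolding hausdorff_content_def fine_covers_def
  by (rule INF_superset_mono) (auto intro: order_trans)

lemma hausdorff_content_empty:
  assumes "\<delta> > 0"
  shows "hausdorff_content s \<delta> ({} :: 'a::metric_space set) = 0"
proof -
  have "(\<lambda>_. {}) \<in> fine_covers \<delta> ({} :: 'a set)" using assms by (simp add: fine_covers_def)
  then have "hausdorff_content s \<delta> ({} :: 'a set) \<le> (\<Sum>i::nat. hausdorff_gauge s ({} :: 'a set))"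
    unfolding hausdorff_content_def by (rule INF_lower2) simp
  then show ?thesis by (simp add: hausdorff_gauge_def)
qed

lemma hausdorff_content_UN:
  fixes A :: "nat \<Rightarrow> 'a::metric_space set"
  shows "hausdorff_content s \<delta> (\<Union>i. A i) \<le> (\<Sum>i. hausdorff_content s \<delta> (A i))"
proof (rule ennreal_le_epsilon)
  fix e :: real assume e: "0 < e" and fin: "(\<Sum>i. hausdorff_content s \<delta> (A i)) < top"
  have "\<exists>C. C \<in> fine_covers \<delta> (A n) \<and>
    (\<Sum>i. hausdorff_gauge s (C i)) < hausdorff_content s \<delta> (A n) + ennreal (e * (1/2)^Suc n)" for n
  proof -
    have "hausdorff_content s \<delta> (A n) < top"
      using fin by (auto simp add: less_top dest!: ennreal_suminf_lessD)
    then have "hausdorff_content s \<delta> (A n) <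
        hausdorff_content s \<delta> (A n) + ennreal (e * (1/2)^Suc n)"
      using e by (simp add: ennreal_add_left_cancel_less less_top)
    then show ?thesis
      unfolding hausdorff_content_def[of _ _ "A n"] INF_less_iff by auto
  qed
  then obtain C where C: "\<And>n. C n \<in> fine_covers \<delta> (A n)"
    and Cle: "\<And>n. (\<Sum>i. hausdorff_gauge s (C n i)) <
      hausdorff_content s \<delta> (A n) + ennreal (e * (1/2)^Suc n)"
    by metis
  define D where "D k = (case prod_decode k of (n, i) \<Rightarrow> C n i)" for k
  have "D \<in> fine_covers \<delta> (\<Union>i. A i)"
  proof -
    have "(\<Union>i. A i) \<subseteq> (\<Union>k. D k)"
    proof
      fix x assume "x \<in> (\<Union>i. A i)"
      then obtain n where "x \<in> A n" by auto
      then obtain i where "x \<in> C n i" using C[of n] by (auto simp: fine_covers_def)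
      then have "x \<in> D (prod_encode (n, i))" by (simp add: D_def)
      then show "x \<in> (\<Union>k. D k)" by blast
    qed
    then show ?thesis
      using C by (auto simp: fine_covers_def D_def split: prod.split)
  qed
  then have "hausdorff_content s \<delta> (\<Union>i. A i) \<le> (\<Sum>k. hausdorff_gauge s (D k))"
    unfolding hausdorff_content_def by (rule INF_lower)
  also have "\<dots> = (\<Sum>k. (\<lambda>(n, i). hausdorff_gauge s (C n i)) (prod_decode k))"
    by (rule arg_cong[where f=suminf]) (auto simp: D_def split: prod.split)
  also have "\<dots> = (\<Sum>n. \<Sum>i. hausdorff_gauge s (C n i))"
    by (rule suminf_ennreal_2dimen) simp
  also have "\<dots> \<le> (\<Sum>n. hausdorff_content s \<delta> (A n) + ennreal (e * (1/2)^Suc n))"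
    using Cle by (intro suminf_le) (auto intro: less_imp_le)
  also have "\<dots> = (\<Sum>n. hausdorff_content s \<delta> (A n)) + (\<Sum>n. ennreal e * ennreal ((1/2) ^ Suc n))"
    using \<open>0 < e\<close> by (subst suminf_add[symmetric])
       (auto simp del: ennreal_suminf_cmult simp add: ennreal_mult[symmetric])
  also have "\<dots> = (\<Sum>n. hausdorff_content s \<delta> (A n)) + e"
    unfolding ennreal_suminf_cmult
    by (subst suminf_ennreal_eq[OF zero_le_power power_half_series]) auto
  finally show "hausdorff_content s \<delta> (\<Union>i. A i) \<le> (\<Sum>n. hausdorff_content s \<delta> (A n)) + e" .
qed

lemma hausdorff_content_le_outer: "\<delta> > 0 \<Longrightarrow> hausdorff_content s \<delta> A \<le> hausdorff_outer s A"
  unfolding hausdorff_outer_def by (rule SUP_upper) auto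

lemma hausdorff_outer_mono: "A \<subseteq> B \<Longrightarrow> hausdorff_outer s A \<le> hausdorff_outer s B"
  unfolding hausdorff_outer_def by (intro SUP_mono) (auto intro: hausdorff_content_mono)

lemma hausdorff_outer_empty: "hausdorff_outer s {} = 0"
proof -
  have "hausdorff_outer s {} \<le> 0"
    unfolding hausdorff_outer_def by (rule SUP_least) (simp add: hausdorff_content_empty)
  then show ?thesis by simp
qed

lemma hausdorff_outer_UN:
  fixes A :: "nat \<Rightarrow> 'a::metric_space set"
  shows "hausdorff_outer s (\<Union>i. A i) \<le> (\<Sum>i. hausdorff_outer s (A i))"
  unfolding hausdorff_outer_def[of _ "\<Union>i. A i"]
proof (rule SUP_least)
  fix \<delta> :: real assume "\<delta> \<in> {0<..}"
  then have "(\<Sum>i. hausdorff_content s \<delta> (A i)) \<le> (\<Sum>i. hausdorff_outer s (A i))"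
    by (intro suminf_le) (auto intro: hausdorff_content_le_outer)
  then show "hausdorff_content s \<delta> (\<Union>i. A i) \<le> (\<Sum>i. hausdorff_outer s (A i))"
    using hausdorff_content_UN order_trans by blast
qed

lemma hausdorff_outer_Un: "hausdorff_outer s (A \<union> B) \<le> hausdorff_outer s A + hausdorff_outer s B"
proof -
  have "hausdorff_outer s (\<Union>i. binaryset A B i) \<le> (\<Sum>i. hausdorff_outer s (binaryset A B i))"
    by (rule hausdorff_outer_UN)
  then show ?thesis
    by (simp add: UN_binaryset_eq suminf_binaryset_eq hausdorff_outer_empty)
qed

lemma outer_measure_space_hausdorff_outer: "outer_measure_space UNIV (hausdorff_outer s)"
  by (auto simp: outer_measure_space_def positive_def increasing_def countably_subadditive_def
      hausdorff_outer_empty hausdorff_outer_mono hausdorff_outer_UN)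

lemma hausdorff_content_separated:
  assumes sep: "\<And>a b. a \<in> A \<Longrightarrow> b \<in> B \<Longrightarrow> d \<le> dist a b" and "\<delta> < d"
  shows "hausdorff_content s \<delta> A + hausdorff_content s \<delta> B \<le> hausdorff_content s \<delta> (A \<union> B)"
  unfolding hausdorff_content_def[of _ _ "A \<union> B"]
proof (rule INF_greatest)
  fix C assume C: "C \<in> fine_covers \<delta> (A \<union> B)"
  have bd: "bounded (C i)" "diameter (C i) \<le> \<delta>" for i using C by (auto simp: fine_covers_def)
  have sub: "diameter (C i \<inter> X) \<le> \<delta>" "bounded (C i \<inter> X)" for i X
    using diameter_subset[of "C i \<inter> X" "C i"] bd[of i] by (auto intro: bounded_subset)
  have split: "hausdorff_gauge s (C i \<inter> A) + hausdorff_gauge s (C i \<inter> B) \<le> hausdorff_gauge s (C i)"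
    for i
  proof -
    have "C i \<inter> A = {} \<or> C i \<inter> B = {}"
    proof (rule ccontr)
      assume "\<not> ?thesis"
      then obtain a b where ab: "a \<in> C i" "a \<in> A" "b \<in> C i" "b \<in> B" by auto
      then have "dist a b \<le> \<delta>"
        using diameter_bounded_bound[OF bd(1)] bd(2) order_trans by blast
      then show False using sep[OF ab(2,4)] \<open>\<delta> < d\<close> by simp
    qed
    then show ?thesis
      using hausdorff_gauge_mono[OF _ bd(1), of "C i \<inter> A" i s]
        hausdorff_gauge_mono[OF _ bd(1), of "C i \<inter> B" i s]
      by (auto simp: hausdorff_gauge_def[of s "{}"])
  qed
  have "(\<lambda>i. C i \<inter> A) \<in> fine_covers \<delta> A" "(\<lambda>i. C i \<inter> B) \<in> fine_covers \<delta> B"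
    using C sub by (auto simp: fine_covers_def)
  then have "hausdorff_content s \<delta> A + hausdorff_content s \<delta> B \<le>
      (\<Sum>i. hausdorff_gauge s (C i \<inter> A)) + (\<Sum>i. hausdorff_gauge s (C i \<inter> B))"
    unfolding hausdorff_content_def by (intro add_mono INF_lower2[OF _ order_refl])
  also have "\<dots> = (\<Sum>i. hausdorff_gauge s (C i \<inter> A) + hausdorff_gauge s (C i \<inter> B))"
    by (rule suminf_add) auto
  also have "\<dots> \<le> (\<Sum>i. hausdorff_gauge s (C i))"
    using split by (intro suminf_le) auto
  finally show "hausdorff_content s \<delta> A + hausdorff_content s \<delta> B \<le> (\<Sum>i. hausdorff_gauge s (C i))" .
qed

lemma hausdorff_outer_separated:
  assumes sep: "\<And>a b. a \<in> A \<Longrightarrow> b \<in> B \<Longrightarrow> d \<le> dist a b" and "0 < d"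
  shows "hausdorff_outer s A + hausdorff_outer s B \<le> hausdorff_outer s (A \<union> B)"
proof -
  have "(SUP \<delta>\<in>{0<..}. hausdorff_content s \<delta> A + hausdorff_content s \<delta> B) =
      hausdorff_outer s A + hausdorff_outer s B"
    unfolding hausdorff_outer_def
  proof (rule SUP_add_directed_ennreal)
    fix i j :: real assume "i \<in> {0<..}" "j \<in> {0<..}"
    then show "\<exists>k\<in>{0<..}. hausdorff_content s i A + hausdorff_content s j B
        \<le> hausdorff_content s k A + hausdorff_content s k B"
      by (intro bexI[of _ "min i j"] add_mono hausdorff_content_antimono) auto
  qed
  moreover have "(SUP \<delta>\<in>{0<..}. hausdorff_content s \<delta> A + hausdorff_content s \<delta> B) \<le>
      hausdorff_outer s (A \<union> B)"
  proof (rule SUP_least)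
    fix \<delta> :: real assume "\<delta> \<in> {0<..}"
    define \<eta> where "\<eta> = min \<delta> (d / 2)"
    have \<eta>: "0 < \<eta>" "\<eta> < d" "\<eta> \<le> \<delta>" using \<open>\<delta> \<in> {0<..}\<close> \<open>0 < d\<close> by (auto simp: \<eta>_def)
    have "hausdorff_content s \<delta> A + hausdorff_content s \<delta> B
        \<le> hausdorff_content s \<eta> A + hausdorff_content s \<eta> B"
      using \<eta> by (intro add_mono hausdorff_content_antimono)
    also have "\<dots> \<le> hausdorff_content s \<eta> (A \<union> B)"
      using \<eta> by (intro hausdorff_content_separated[OF sep])
    also have "\<dots> \<le> hausdorff_outer s (A \<union> B)"
      using \<eta> by (intro hausdorff_content_le_outer)
    finally show "hausdorff_content s \<delta> A + hausdorff_content s \<delta> B \<le> hausdorff_outer s (A \<union> B)" .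
  qed
  ultimately show ?thesis by simp
qed

lemma hausdorff_outer_closed_split:
  fixes A F :: "'a::metric_space set"
  assumes F: "closed F" "F \<noteq> {}" and fin: "hausdorff_outer s A < top"
  shows "hausdorff_outer s (A \<inter> F) + hausdorff_outer s (A - F) \<le> hausdorff_outer s A"
proof -
  let ?H = "hausdorff_outer s :: 'a set \<Rightarrow> ennreal"
  define r :: "nat \<Rightarrow> real" where "r n = 1 / real (Suc n)" for n
  define B where "B n = {x \<in> A. r n \<le> infdist x F}" for n
  define R where "R n = B (Suc n) - B n" for n
  have r_pos: "0 < r n" for n by (simp add: r_def)
  have r_mono: "r n \<le> r m" if "m \<le> n" for m n using that by (simp add: r_def frac_le)
  have r_less: "r (Suc n) < r n" for n by (simp add: r_def frac_less2)
  have R_sub: "R n \<subseteq> A" for n by (auto simp: R_def B_def)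
  have infdist_lip: "infdist x F \<le> infdist y F + dist x y" for x y
    by (rule infdist_triangle)
  text \<open>Rings of equal parity are pairwise at a positive distance, so their measures sum up.\<close>
  have ring_sep: "r (Suc i) - r (Suc (Suc i)) \<le> dist a b"
    if "a \<in> B (Suc i)" "b \<in> R j" "Suc (Suc i) \<le> j" for a b i j
  proof -
    have "r (Suc i) \<le> infdist a F" using that by (auto simp: B_def)
    moreover have "infdist b F < r j" using that by (auto simp: R_def B_def)
    moreover have "r j \<le> r (Suc (Suc i))" using that by (intro r_mono)
    ultimately show ?thesis using infdist_lip[of a b] by linarith
  qed
  have parity: "(\<Sum>k<m. ?H (R (2 * k + p))) \<le> ?H (\<Union>k<m. R (2 * k + p))" for m p
  proof (induction m)
    case (Suc m)
    have "?H (\<Union>k<m. R (2 * k + p)) + ?H (R (2 * m + p)) \<le>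
        ?H ((\<Union>k<m. R (2 * k + p)) \<union> R (2 * m + p))"
    proof (cases m)
      case (Suc l)
      have B_mono: "B i \<subseteq> B j" if "i \<le> j" for i j
        using r_mono[OF that] by (auto simp: B_def)
      have sub: "(\<Union>k<m. R (2 * k + p)) \<subseteq> B (Suc (2 * l + p))"
      proof (rule UN_least)
        fix k assume "k \<in> {..<m}"
        then have "Suc (2 * k + p) \<le> Suc (2 * l + p)" using Suc by auto
        then have "B (Suc (2 * k + p)) \<subseteq> B (Suc (2 * l + p))" by (rule B_mono)
        then show "R (2 * k + p) \<subseteq> B (Suc (2 * l + p))" by (auto simp: R_def)
      qed
      show ?thesis
      proof (rule hausdorff_outer_separated)
        show "0 < r (Suc (2 * l + p)) - r (Suc (Suc (2 * l + p)))"
          using r_less by simp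
        show "r (Suc (2 * l + p)) - r (Suc (Suc (2 * l + p))) \<le> dist a b"
          if "a \<in> (\<Union>k<m. R (2 * k + p))" "b \<in> R (2 * m + p)" for a b
          using that(1) sub by (intro ring_sep[OF _ that(2)]) (auto simp: Suc)
      qed
    qed (simp add: hausdorff_outer_empty)
    also have "(\<Union>k<m. R (2 * k + p)) \<union> R (2 * m + p) = (\<Union>k<Suc m. R (2 * k + p))"
      by (auto simp: lessThan_Suc)
    finally have le: "?H (\<Union>k<m. R (2 * k + p)) + ?H (R (2 * m + p)) \<le> ?H (\<Union>k<Suc m. R (2 * k + p))" .
    have "(\<Sum>k<Suc m. ?H (R (2 * k + p))) \<le> ?H (\<Union>k<m. R (2 * k + p)) + ?H (R (2 * m + p))"
      using Suc.IH by (simp add: add_right_mono)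
    then show ?case using le by (rule order_trans)
  qed (simp add: hausdorff_outer_empty)
  have parity_A: "(\<Sum>k. ?H (R (2 * k + p))) \<le> ?H A" for p
  proof (rule suminf_le_const)
    show "sum (\<lambda>k. ?H (R (2 * k + p))) {..<m} \<le> ?H A" for m
      using parity[where m=m and p=p] hausdorff_outer_mono[of "\<Union>k<m. R (2 * k + p)" A s] R_sub
      by (meson UN_least order_trans)
  qed simp
  have "(\<Sum>k. ?H (R k)) \<le> ?H A + ?H A"
  proof (rule suminf_le_const)
    fix m
    have "sum (\<lambda>k. ?H (R k)) {..<m} \<le> sum (\<lambda>k. ?H (R k)) {..<2 * m}"
      by (rule sum_mono2) auto
    also have "\<dots> = (\<Sum>k<m. ?H (R (2 * k + 0))) + (\<Sum>k<m. ?H (R (2 * k + 1)))"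
      by (induction m) (auto simp: algebra_simps)
    also have "\<dots> \<le> ?H A + ?H A"
      by (intro add_mono order_trans[OF sum_le_suminf parity_A]) auto
    finally show "sum (\<lambda>k. ?H (R k)) {..<m} \<le> ?H A + ?H A" .
  qed simp
  then have sum_fin: "(\<Sum>k. ?H (R k)) < top"
    using fin by (metis ennreal_add_less_top order_le_less_trans)
  have tail: "(\<lambda>n. \<Sum>k. ?H (R (k + n))) \<longlonglongrightarrow> 0"
  proof -
    let ?S = "\<Sum>k. ?H (R k)"
    have "(\<Sum>k. ?H (R (k + n))) = ?S - (\<Sum>k<n. ?H (R k))" for n
    proof -
      have "(\<Sum>k<n. ?H (R k)) < top"
        using sum_fin by (rule le_less_trans[OF sum_le_suminf, rotated -1]) auto
      then show ?thesis
        using suminf_offset[of "\<lambda>k. ?H (R k)" n] by (simp add: less_top)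
    qed
    moreover have "(\<lambda>n. ?S - (\<Sum>k<n. ?H (R k))) \<longlonglongrightarrow> ?S - ?S"
      using sum_fin by (intro tendsto_diff_ennreal tendsto_const summable_LIMSEQ) auto
    ultimately show ?thesis using sum_fin by (simp add: less_top)
  qed
  have main: "?H (A \<inter> F) + ?H (A - F) \<le> ?H A + (\<Sum>k. ?H (R (k + n)))" for n
  proof -
    have "A - F \<subseteq> B n \<union> (\<Union>k. R (k + n))"
    proof
      fix x assume x: "x \<in> A - F"
      then have pos: "0 < infdist x F"
        using F by (metis DiffD2 in_closed_iff_infdist_zero infdist_nonneg less_eq_real_def)
      obtain m where "inverse (real (Suc m)) < infdist x F" using reals_Archimedean[OF pos] by auto
      then have ex: "x \<in> B m" using x by (auto simp: B_def r_def inverse_eq_divide)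
      define l where "l = (LEAST m. x \<in> B m)"
      have l: "x \<in> B l" "\<And>j. j < l \<Longrightarrow> x \<notin> B j"
        using ex unfolding l_def by (auto intro: LeastI dest: not_less_Least)
      show "x \<in> B n \<union> (\<Union>k. R (k + n))"
      proof (cases "l \<le> n")
        case True
        then show ?thesis using l(1) r_mono[OF True] by (auto simp: B_def)
      next
        case False
        then obtain k where k: "l = Suc (k + n)" by (metis add.commute less_imp_Suc_add not_le)
        then have "x \<in> R (k + n)" using l by (auto simp: R_def)
        then show ?thesis by blast
      qed
    qed
    then have "?H (A - F) \<le> ?H (B n \<union> (\<Union>k. R (k + n)))" by (rule hausdorff_outer_mono)
    also have "\<dots> \<le> ?H (B n) + ?H (\<Union>k. R (k + n))" by (rule hausdorff_outer_Un)
    also have "\<dots> \<le> ?H (B n) + (\<Sum>k. ?H (R (k + n)))"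
      by (intro add_left_mono hausdorff_outer_UN)
    finally have 1: "?H (A - F) \<le> ?H (B n) + (\<Sum>k. ?H (R (k + n)))" .
    have "?H (A \<inter> F) + ?H (B n) \<le> ?H ((A \<inter> F) \<union> B n)"
    proof (rule hausdorff_outer_separated[OF _ r_pos[of n]])
      fix a b assume "a \<in> A \<inter> F" "b \<in> B n"
      then show "r n \<le> dist a b"
        using infdist_le[of a F b] by (auto simp: B_def dist_commute)
    qed
    also have "\<dots> \<le> ?H A" by (rule hausdorff_outer_mono) (auto simp: B_def)
    finally have 2: "?H (A \<inter> F) + ?H (B n) \<le> ?H A" .
    have "?H (A \<inter> F) + ?H (A - F) \<le> (?H (A \<inter> F) + ?H (B n)) + (\<Sum>k. ?H (R (k + n)))"
      using add_left_mono[OF 1] by (simp add: add.assoc)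
    also have "\<dots> \<le> ?H A + (\<Sum>k. ?H (R (k + n)))" using 2 by (rule add_right_mono)
    finally show ?thesis .
  qed
  have "(\<lambda>n. ?H A + (\<Sum>k. ?H (R (k + n)))) \<longlonglongrightarrow> ?H A + 0"
    by (intro tendsto_add tendsto_const tail)
  then show ?thesis
    using main by (intro LIMSEQ_le_const[where X="\<lambda>n. ?H A + (\<Sum>k. ?H (R (k + n)))"]) auto
qed

lemma measure_space_hausdorff_outer:
  "measure_space UNIV (sets borel) (hausdorff_outer s :: 'a::metric_space set \<Rightarrow> ennreal)"
proof -
  let ?L = "lambda_system UNIV UNIV (hausdorff_outer s :: 'a set \<Rightarrow> ennreal)"
  have closed: "F \<in> ?L" if "closed F" for F :: "'a set"
    unfolding lambda_system_def
  proof safe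
    fix A :: "'a set"
    have le: "hausdorff_outer s (F \<inter> A) + hausdorff_outer s ((UNIV - F) \<inter> A) \<le> hausdorff_outer s A"
    proof (cases "F = {} \<or> hausdorff_outer s A = top")
      case False
      then have "hausdorff_outer s (A \<inter> F) + hausdorff_outer s (A - F) \<le> hausdorff_outer s A"
        using that by (intro hausdorff_outer_closed_split) (auto simp: less_top)
      moreover have "(UNIV - F) \<inter> A = A - F" by auto
      ultimately show ?thesis by (simp add: Int_commute)
    qed (auto simp: hausdorff_outer_empty)
    have "A = (F \<inter> A) \<union> ((UNIV - F) \<inter> A)" by auto
    then have "hausdorff_outer s A \<le>
        hausdorff_outer s (F \<inter> A) + hausdorff_outer s ((UNIV - F) \<inter> A)"
      using hausdorff_outer_Un by metis
    with le show "hausdorff_outer s (F \<inter> A) + hausdorff_outer s ((UNIV - F) \<inter> A) =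
        hausdorff_outer s A" by (rule antisym)
  qed simp
  interpret sigma_algebra "UNIV :: 'a set" UNIV
    using sigma_algebra_Pow[of "UNIV :: 'a set"] by simp
  have ms: "measure_space UNIV ?L (hausdorff_outer s)"
    by (rule caratheodory_lemma[OF outer_measure_space_hausdorff_outer])
  then have "sigma_algebra UNIV ?L" by (simp add: measure_space_def)
  then have "sigma_sets UNIV {F :: 'a set. closed F} \<subseteq> ?L"
    using closed by (intro sigma_algebra.sigma_sets_subset) auto
  moreover have "sets (borel :: 'a measure) = sigma_sets UNIV {F. closed F}"
    by (simp add: borel_eq_closed)
  ultimately have "sets (borel :: 'a measure) \<subseteq> ?L" by simp
  then show ?thesis
    using measure_down[OF ms, of "sets borel"] sets.sigma_algebra_axioms[of "borel :: 'a measure"]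
    by simp
qed

lemma sets_hausdorff_measure [simp, measurable_cong]: "sets (hausdorff_measure s) = sets borel"
  by (simp add: hausdorff_measure_def) (metis sets.sigma_sets_eq space_borel)

lemma space_hausdorff_measure [simp]: "space (hausdorff_measure s) = UNIV"
  by (simp add: hausdorff_measure_def space_measure_of_conv)

lemma emeasure_hausdorff_measure:
  "A \<in> sets borel \<Longrightarrow> emeasure (hausdorff_measure s) A = hausdorff_outer s A"
  using measure_space_hausdorff_outer[of s]
  by (intro emeasure_measure_of_sigma[of UNIV "sets borel" "hausdorff_outer s" A,
        folded hausdorff_measure_def]) (auto simp: measure_space_def)

definition surface_measure :: "'a::euclidean_space set \<Rightarrow> 'a measure" where
  "surface_measure \<Omega> = restrict_space (hausdorff_measure (DIM('a) - 1)) (frontier \<Omega>)"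


section \<open>Lipschitz domains and the outward unit normal\<close>

text \<open>
  Near \<open>x\<close>, in an orthonormal frame whose last axis is \<open>e\<close>, the set \<open>\<Omega>\<close> is the part of a ball
  that lies above the graph of \<open>\<gamma>\<close>. Only the values of \<open>\<gamma>\<close> on the hyperplane orthogonal to \<open>e\<close>
  matter.
\<close>

definition lipschitz_chart ::
    "'a::euclidean_space set \<Rightarrow> 'a \<Rightarrow> 'a \<Rightarrow> real \<Rightarrow> ('a \<Rightarrow> real) \<Rightarrow> bool" where
  "lipschitz_chart \<Omega> x e r \<gamma> \<longleftrightarrow>
     norm e = 1 \<and> r > 0 \<and> (\<exists>L. L-lipschitz_on {y. y \<bullet> e = 0} \<gamma>) \<and>
     \<Omega> \<inter> ball x r = {y \<in> ball x r. \<gamma> (y - (y \<bullet> e) *\<^sub>R e) < y \<bullet> e}"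

definition bounded_lipschitz_domain :: "'a::euclidean_space set \<Rightarrow> bool" where
  "bounded_lipschitz_domain \<Omega> \<longleftrightarrow>
     open \<Omega> \<and> connected \<Omega> \<and> \<Omega> \<noteq> {} \<and> bounded \<Omega> \<and>
     (\<forall>x\<in>frontier \<Omega>. \<exists>e r \<gamma>. lipschitz_chart \<Omega> x e r \<gamma>)"

text \<open>
  Where the graph function \<open>\<gamma>\<close> is differentiable with (tangential) gradient \<open>g\<close>, the outward
  normal is the normalisation of the gradient \<open>g - e\<close> of \<open>y \<mapsto> \<gamma> (y - (y \<bullet> e) e) - y \<bullet> e\<close>,
  a function that is negative in \<open>\<Omega>\<close>.
\<close>

definition is_outward_unit_normal :: "'a::euclidean_space set \<Rightarrow> 'a \<Rightarrow> 'a \<Rightarrow> bool" where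
  "is_outward_unit_normal \<Omega> x n \<longleftrightarrow>
     (\<exists>e r \<gamma> g. lipschitz_chart \<Omega> x e r \<gamma> \<and> g \<bullet> e = 0 \<and>
        (\<gamma> has_derivative (\<lambda>h. g \<bullet> h)) (at (x - (x \<bullet> e) *\<^sub>R e) within {y. y \<bullet> e = 0}) \<and>
        n = (1 / sqrt (1 + (norm g)\<^sup>2)) *\<^sub>R (g - e))"

text \<open>
  The normal exists outside a set of surface measure zero (Rademacher's theorem) and is unique
  where it exists. It is extended by \<open>0\<close> to that null set, so that the three parts of the boundary
  below cover the boundary; sets of surface measure zero are immaterial throughout.
\<close>

definition outward_unit_normal :: "'a::euclidean_space set \<Rightarrow> 'a \<Rightarrow> 'a" where
  "outward_unit_normal \<Omega> x =
     (if \<exists>n. is_outward_unit_normal \<Omega> x n then SOME n. is_outward_unit_normal \<Omega> x n else 0)"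

definition outflow_boundary :: "'a::euclidean_space set \<Rightarrow> ('a \<Rightarrow> 'a) \<Rightarrow> 'a set" where
  "outflow_boundary \<Omega> \<beta> = {x \<in> frontier \<Omega>. \<beta> x \<bullet> outward_unit_normal \<Omega> x > 0}"

definition inflow_boundary :: "'a::euclidean_space set \<Rightarrow> ('a \<Rightarrow> 'a) \<Rightarrow> 'a set" where
  "inflow_boundary \<Omega> \<beta> = {x \<in> frontier \<Omega>. \<beta> x \<bullet> outward_unit_normal \<Omega> x < 0}"

definition characteristic_boundary :: "'a::euclidean_space set \<Rightarrow> ('a \<Rightarrow> 'a) \<Rightarrow> 'a set" where
  "characteristic_boundary \<Omega> \<beta> = {x \<in> frontier \<Omega>. \<beta> x \<bullet> outward_unit_normal \<Omega> x = 0}"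

text \<open>Null sets of the completion, so that no Borel measurability of \<open>\<Gamma>\<close> is presupposed.\<close>

definition surface_null :: "'a::euclidean_space set \<Rightarrow> 'a set \<Rightarrow> bool" where
  "surface_null \<Omega> \<Gamma> \<longleftrightarrow> \<Gamma> \<in> null_sets (completion (surface_measure \<Omega>))"


section \<open>Lebesgue and Sobolev spaces\<close>

text \<open>
  Elements of the function spaces are represented by functions on the whole space whose values
  outside \<open>\<Omega>\<close> (and on null sets) are irrelevant.
\<close>

definition L2_space :: "'a measure \<Rightarrow> ('a \<Rightarrow> 'b::euclidean_space) set" where
  "L2_space M = {f. f \<in> borel_measurable M \<and> integrable M (\<lambda>x. (norm (f x))\<^sup>2)}"

definition L2_norm :: "'a measure \<Rightarrow> ('a \<Rightarrow> 'b::euclidean_space) \<Rightarrow> real" where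
  "L2_norm M f = sqrt (\<integral>x. (norm (f x))\<^sup>2 \<partial>M)"

definition Linf_space :: "'a measure \<Rightarrow> ('a \<Rightarrow> 'b::euclidean_space) set" where
  "Linf_space M = {f. f \<in> borel_measurable M \<and> (\<exists>K. AE x in M. norm (f x) \<le> K)}"

definition essinf :: "'a measure \<Rightarrow> ('a \<Rightarrow> ereal) \<Rightarrow> ereal" where
  "essinf M f = - esssup M (\<lambda>x. - f x)"

primrec Ck :: "nat \<Rightarrow> ('a::euclidean_space \<Rightarrow> real) \<Rightarrow> bool" where
  "Ck 0 f \<longleftrightarrow> continuous_on UNIV f"
| "Ck (Suc k) f \<longleftrightarrow> (\<forall>x. f differentiable (at x)) \<and>
     (\<forall>b\<in>Basis. Ck k (\<lambda>x. frechet_derivative f (at x) b))"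

definition smooth :: "('a::euclidean_space \<Rightarrow> real) \<Rightarrow> bool" where
  "smooth f \<longleftrightarrow> (\<forall>k. Ck k f)"

definition test_functions :: "'a::euclidean_space set \<Rightarrow> ('a \<Rightarrow> real) set" where
  "test_functions \<Omega> = {\<phi>. smooth \<phi> \<and>
     compact (closure {x. \<phi> x \<noteq> 0}) \<and> closure {x. \<phi> x \<noteq> 0} \<subseteq> \<Omega>}"

definition locally_integrable ::
    "'a::euclidean_space set \<Rightarrow> ('a \<Rightarrow> 'b::euclidean_space) \<Rightarrow> bool" where
  "locally_integrable \<Omega> f \<longleftrightarrow> (\<forall>K. compact K \<and> K \<subseteq> \<Omega> \<longrightarrow> f absolutely_integrable_on K)"

definition is_weak_gradient ::
    "'a::euclidean_space set \<Rightarrow> ('a \<Rightarrow> real) \<Rightarrow> ('a \<Rightarrow> 'a) \<Rightarrow> bool" where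
  "is_weak_gradient \<Omega> v g \<longleftrightarrow> locally_integrable \<Omega> v \<and> locally_integrable \<Omega> g \<and>
     (\<forall>\<phi>\<in>test_functions \<Omega>. \<forall>b\<in>Basis.
        (\<integral>x. v x * frechet_derivative \<phi> (at x) b \<partial>lebesgue_on \<Omega>) =
        - (\<integral>x. (g x \<bullet> b) * \<phi> x \<partial>lebesgue_on \<Omega>))"

text \<open>A weak gradient is unique up to null sets; an arbitrary representative is chosen.\<close>

definition weak_gradient :: "'a::euclidean_space set \<Rightarrow> ('a \<Rightarrow> real) \<Rightarrow> 'a \<Rightarrow> 'a" where
  "weak_gradient \<Omega> v = (SOME g. is_weak_gradient \<Omega> v g)"

definition weak_divergence :: "'a::euclidean_space set \<Rightarrow> ('a \<Rightarrow> 'a) \<Rightarrow> 'a \<Rightarrow> real" where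
  "weak_divergence \<Omega> \<beta> x = (\<Sum>b\<in>Basis. weak_gradient \<Omega> (\<lambda>y. \<beta> y \<bullet> b) x \<bullet> b)"

definition W1inf_space :: "'a::euclidean_space set \<Rightarrow> ('a \<Rightarrow> real) set" where
  "W1inf_space \<Omega> = {v \<in> Linf_space (lebesgue_on \<Omega>).
     \<exists>g. is_weak_gradient \<Omega> v g \<and> g \<in> Linf_space (lebesgue_on \<Omega>)}"

definition H1_space :: "'a::euclidean_space set \<Rightarrow> ('a \<Rightarrow> real) set" where
  "H1_space \<Omega> = {v \<in> L2_space (lebesgue_on \<Omega>).
     \<exists>g. is_weak_gradient \<Omega> v g \<and> g \<in> L2_space (lebesgue_on \<Omega>)}"

definition H2_space :: "'a::euclidean_space set \<Rightarrow> ('a \<Rightarrow> real) set" where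
  "H2_space \<Omega> = {v \<in> H1_space \<Omega>. \<forall>b\<in>Basis. (\<lambda>x. weak_gradient \<Omega> v x \<bullet> b) \<in> H1_space \<Omega>}"

definition H1_norm :: "'a::euclidean_space set \<Rightarrow> ('a \<Rightarrow> real) \<Rightarrow> real" where
  "H1_norm \<Omega> v = sqrt ((L2_norm (lebesgue_on \<Omega>) v)\<^sup>2 +
     (L2_norm (lebesgue_on \<Omega>) (weak_gradient \<Omega> v))\<^sup>2)"

definition H2_norm :: "'a::euclidean_space set \<Rightarrow> ('a \<Rightarrow> real) \<Rightarrow> real" where
  "H2_norm \<Omega> v = sqrt ((H1_norm \<Omega> v)\<^sup>2 +
     (\<Sum>b\<in>Basis. (L2_norm (lebesgue_on \<Omega>) (weak_gradient \<Omega> (\<lambda>x. weak_gradient \<Omega> v x \<bullet> b)))\<^sup>2))"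


section \<open>Traces\<close>

text \<open>
  On a bounded Lipschitz domain, the Sobolev trace \<open>H\<^sup>1(\<Omega>) \<rightarrow> L\<^sup>2(\<partial>\<Omega>)\<close> is the continuous
  extension of the restriction map \<open>\<phi> \<mapsto> \<phi>|\<partial>\<Omega>\<close> from smooth functions on the closure of \<open>\<Omega>\<close>,
  which are dense in \<open>H\<^sup>1(\<Omega>)\<close>.
\<close>

definition is_trace :: "'a::euclidean_space set \<Rightarrow> ('a \<Rightarrow> real) \<Rightarrow> ('a \<Rightarrow> real) \<Rightarrow> bool" where
  "is_trace \<Omega> v g \<longleftrightarrow> v \<in> H1_space \<Omega> \<and> g \<in> L2_space (surface_measure \<Omega>) \<and>
     (\<exists>\<phi> :: nat \<Rightarrow> 'a \<Rightarrow> real. (\<forall>k. smooth (\<phi> k)) \<and>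
        (\<lambda>k. H1_norm \<Omega> (\<lambda>x. \<phi> k x - v x)) \<longlonglongrightarrow> 0 \<and>
        (\<lambda>k. \<integral>\<^sup>+x. ennreal ((\<phi> k x - g x)\<^sup>2) \<partial>surface_measure \<Omega>) \<longlonglongrightarrow> 0)"

definition trace_vanishes_on ::
    "'a::euclidean_space set \<Rightarrow> 'a set \<Rightarrow> ('a \<Rightarrow> real) \<Rightarrow> bool" where
  "trace_vanishes_on \<Omega> \<Gamma> v \<longleftrightarrow>
     (\<exists>g. is_trace \<Omega> v g \<and> (AE x in surface_measure \<Omega>. x \<in> \<Gamma> \<longrightarrow> g x = 0))"

definition H1_inflow_space :: "'a::euclidean_space set \<Rightarrow> ('a \<Rightarrow> 'a) \<Rightarrow> ('a \<Rightarrow> real) set" where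
  "H1_inflow_space \<Omega> \<beta> = {v \<in> H1_space \<Omega>. trace_vanishes_on \<Omega> (inflow_boundary \<Omega> \<beta>) v}"


section \<open>The transport problem and its regularization\<close>

text \<open>
  The graph space of \<open>v \<in> L\<^sup>2(\<Omega>)\<close> with \<open>\<beta> \<cdot> \<nabla>v \<in> L\<^sup>2(\<Omega>)\<close>, where \<open>\<beta> \<cdot> \<nabla>v\<close> is the distribution
  \<open>div (v \<beta>) - v div \<beta>\<close>. Note that \<open>frechet_derivative \<phi> (at x) (\<beta> x)\<close> is \<open>\<beta>(x) \<cdot> \<nabla>\<phi>(x)\<close>.
\<close>

definition graph_space :: "'a::euclidean_space set \<Rightarrow> ('a \<Rightarrow> 'a) \<Rightarrow> ('a \<Rightarrow> real) set" where
  "graph_space \<Omega> \<beta> = {v \<in> L2_space (lebesgue_on \<Omega>).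
     \<exists>w \<in> L2_space (lebesgue_on \<Omega>). \<forall>\<phi>\<in>test_functions \<Omega>.
       (\<integral>x. w x * \<phi> x \<partial>lebesgue_on \<Omega>) =
       - (\<integral>x. v x * (frechet_derivative \<phi> (at x) (\<beta> x) + weak_divergence \<Omega> \<beta> x * \<phi> x)
            \<partial>lebesgue_on \<Omega>)}"

text \<open>
  The condition \<open>v = 0\<close> on the inflow boundary is expressed by the Sobolev trace, so this is
  \<open>H\<^sup>1(\<Omega>) \<inter> H\<^sub>\<beta>\<^sub>,\<^sub>-(\<Omega>)\<close>; the space is only ever intersected with \<open>H\<^sup>2(\<Omega>)\<close>.
\<close>

definition H_beta_inflow_space :: "'a::euclidean_space set \<Rightarrow> ('a \<Rightarrow> 'a) \<Rightarrow> ('a \<Rightarrow> real) set" where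
  "H_beta_inflow_space \<Omega> \<beta> =
     {v \<in> graph_space \<Omega> \<beta>. trace_vanishes_on \<Omega> (inflow_boundary \<Omega> \<beta>) v}"

definition solves_transport ::
    "'a::euclidean_space set \<Rightarrow> ('a \<Rightarrow> 'a) \<Rightarrow> ('a \<Rightarrow> real) \<Rightarrow> ('a \<Rightarrow> real) \<Rightarrow> ('a \<Rightarrow> real) \<Rightarrow> bool"
  where
  "solves_transport \<Omega> \<beta> \<mu> f u \<longleftrightarrow>
     (AE x in lebesgue_on \<Omega>. \<beta> x \<bullet> weak_gradient \<Omega> u x + \<mu> x * u x = f x) \<and>
     trace_vanishes_on \<Omega> (inflow_boundary \<Omega> \<beta>) u"

definition solves_regularized ::
    "'a::euclidean_space set \<Rightarrow> ('a \<Rightarrow> 'a) \<Rightarrow> ('a \<Rightarrow> real) \<Rightarrow> real \<Rightarrow> ('a \<Rightarrow> real) \<Rightarrow> ('a \<Rightarrow> real)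
      \<Rightarrow> bool" where
  "solves_regularized \<Omega> \<beta> \<mu> \<epsilon> f w \<longleftrightarrow> w \<in> H1_inflow_space \<Omega> \<beta> \<and>
     (\<forall>v\<in>H1_inflow_space \<Omega> \<beta>.
        \<epsilon> * (\<integral>x. weak_gradient \<Omega> w x \<bullet> weak_gradient \<Omega> v x \<partial>lebesgue_on \<Omega>) +
        (\<integral>x. (\<beta> x \<bullet> weak_gradient \<Omega> w x + \<mu> x * w x) * v x \<partial>lebesgue_on \<Omega>) =
        (\<integral>x. f x * v x \<partial>lebesgue_on \<Omega>))"

end

theory Submission
  imports Defs
begin

text \<open>
  Write \<open>e = u - u\<^sub>\<epsilon>\<close>. Since \<open>\<Gamma>\<^sub>+\<close> and \<open>\<Gamma>\<^sub>0\<close> are null sets, \<open>u\<close> and \<open>u\<^sub>\<epsilon>\<close> have zero trace almost everywhere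
  on \<open>\<partial>\<Omega>\<close>, so \<open>e\<close> behaves like a test function. Testing the regularized problem with \<open>e\<close> and inserting
  the transport equation for \<open>f\<close> gives

  \<open>\<epsilon> \<parallel>\<nabla>e\<parallel>\<^sup>2 + \<integral> (\<mu> - div \<beta> / 2) e\<^sup>2 = \<epsilon> \<integral> \<nabla>u \<bullet> \<nabla>e = - \<epsilon> \<integral> \<Delta>u e\<close>,

  where the advection term has become the divergence term because \<open>e\<close> vanishes on the boundary
  (\<open>advection_identity\<close>), and the last equality is an integration by parts without boundary term
  (\<open>dirichlet_pairing_bound\<close>). The left-hand side is at least \<open>\<epsilon> \<parallel>\<nabla>e\<parallel>\<^sup>2 + c \<parallel>e\<parallel>\<^sup>2\<close> with \<open>c > 0\<close>, and the
  right-hand side at most a multiple of \<open>\<epsilon> \<parallel>u\<parallel>\<^bsub>H\<^sup>2\<^esub> \<parallel>e\<parallel>\<close>. Hence \<open>\<parallel>e\<parallel> = O(\<epsilon>)\<close>, and then \<open>\<parallel>\<nabla>e\<parallel>\<^sup>2 = O(\<epsilon>)\<close>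
  (\<open>energy_bound_imp_rates\<close>).

  Both integrations by parts hold for test functions by the definition of weak gradients. The
  substance of the proof is therefore that an \<open>H\<^sup>1\<close> function with zero trace is an \<open>H\<^sup>1\<close> limit of test
  functions (\<open>zero_trace_approximation\<close>). The trace is defined by smooth functions \<open>\<phi>\<^sub>k\<close> that converge in
  \<open>H\<^sup>1(\<Omega>)\<close> and in \<open>L\<^sup>2(\<partial>\<Omega>)\<close>; these are multiplied by smooth cutoffs \<open>\<eta>\<close> that vanish near the boundary
  and equal \<open>1\<close> at distance \<open>3 h\<close>. The dangerous term is \<open>\<phi>\<^sub>k \<nabla>\<eta>\<close>, of size \<open>\<bar>\<phi>\<^sub>k\<bar> / h\<close> in a collar of width
  \<open>O(h)\<close>. It is controlled by the Hardy inequality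

  \<open>\<integral>\<^bsub>collar\<^esub> \<phi>\<^sup>2 \<le> C h \<integral>\<^bsub>\<partial>\<Omega>\<^esub> \<phi>\<^sup>2 + C h\<^sup>2 \<integral>\<^bsub>collar\<^esub> \<bar>\<nabla>\<phi>\<bar>\<^sup>2\<close>

  (\<open>hardy_collar\<close>), which follows in each Lipschitz chart from the fundamental theorem of calculus along
  the axis of the chart. The only link between volume and surface measure is that translating a
  boundary set over a distance \<open>h\<close> sweeps out a volume of at most a constant times \<open>h\<close> times its
  Hausdorff measure (\<open>emeasure_sweep_le_hausdorff\<close>), which is a covering argument.

  Norms of weak gradients refer to a selected representative. That any two representatives agree
  almost everywhere is the fundamental lemma of the calculus of variations (\<open>fundamental_lemma\<close>), for
  which smooth bump functions of boxes are constructed from \<open>exp (- 1 / x)\<close>.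
\<close>

section \<open>Smooth functions\<close>

lemma Ck_SucI:
  assumes "\<And>x. (f has_derivative f' x) (at x)" "\<And>b. b \<in> Basis \<Longrightarrow> Ck k (\<lambda>x. f' x b)"
  shows "Ck (Suc k) f"
proof -
  have "frechet_derivative f (at x) = f' x" for x
    using frechet_derivative_at[OF assms(1)[of x]] by simp
  then show ?thesis
    using assms by (auto simp: differentiable_def)
qed

lemma Ck_Suc_has_derivative:
  "Ck (Suc k) f \<Longrightarrow> (f has_derivative frechet_derivative f (at x)) (at x)"
  by (simp add: frechet_derivative_works)

lemma Ck_Suc_partial: "Ck (Suc k) f \<Longrightarrow> b \<in> Basis \<Longrightarrow> Ck k (\<lambda>x. frechet_derivative f (at x) b)"
  by simp

lemma Ck_SucD: "Ck (Suc k) f \<Longrightarrow> Ck k f"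
proof (induction k arbitrary: f)
  case 0
  then show ?case
    by (auto simp: continuous_on_eq_continuous_at intro: differentiable_imp_continuous_within)
next
  case (Suc k)
  show ?case
    using Suc.prems Suc.IH by (simp only: Ck.simps) blast
qed

lemma Ck_le:
  assumes "Ck k f" "j \<le> k"
  shows "Ck j f"
  using assms(2,1) by (induction rule: dec_induct) (auto dest: Ck_SucD simp del: Ck.simps)

lemma Ck_const: "Ck k (\<lambda>x. c)"
proof (induction k arbitrary: c)
  case (Suc k)
  show ?case by (rule Ck_SucI[where f'="\<lambda>_ _. 0"]) (auto simp: Suc)
qed simp

lemma Ck_add:
  assumes "Ck k f" "Ck k g"
  shows "Ck k (\<lambda>x. f x + g x)"
  using assms
proof (induction k arbitrary: f g)
  case (Suc k)
  show ?case
    by (rule Ck_SucI[OF has_derivative_add[OF Suc.prems[THEN Ck_Suc_has_derivative]]])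
      (intro Suc.IH Suc.prems[THEN Ck_Suc_partial])
qed (auto intro: continuous_intros)

lemma Ck_mult:
  assumes "Ck k f" "Ck k g"
  shows "Ck k (\<lambda>x. f x * g x)"
  using assms
proof (induction k arbitrary: f g)
  case (Suc k)
  show ?case
    by (rule Ck_SucI[OF has_derivative_mult[OF Suc.prems[THEN Ck_Suc_has_derivative]]])
      (intro Ck_add Suc.IH Suc.prems[THEN Ck_Suc_partial] Suc.prems[THEN Ck_SucD])
qed (auto intro: continuous_intros)

lemma Ck_diff:
  assumes "Ck k f" "Ck k g"
  shows "Ck k (\<lambda>x. f x - g x)"
  using Ck_add[OF assms(1) Ck_mult[OF Ck_const[of k "-1"] assms(2)]] by simp

lemma Ck_prod: "(\<And>i. i \<in> I \<Longrightarrow> Ck k (f i)) \<Longrightarrow> Ck k (\<lambda>x. \<Prod>i\<in>I. f i x)"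
proof (induction I rule: infinite_finite_induct)
  case (insert i I)
  then show ?case by (simp add: Ck_mult)
qed (simp_all add: Ck_const)

lemma smooth_mult: "smooth f \<Longrightarrow> smooth g \<Longrightarrow> smooth (\<lambda>x. f x * g x)"
  by (simp add: smooth_def Ck_mult)

lemma smooth_diff: "smooth f \<Longrightarrow> smooth g \<Longrightarrow> smooth (\<lambda>x. f x - g x)"
  by (simp add: smooth_def Ck_diff)

text \<open>
  All derivatives of the classical flat function \<open>exp (-1/x)\<close> are linear combinations of the
  functions \<open>x powi -k * exp (-1/x)\<close>; carrying the index \<open>k\<close> makes the smoothness proof a
  one-step induction.
\<close>

definition exp_recip :: "nat \<Rightarrow> real \<Rightarrow> real" where
  "exp_recip k x = (if x \<le> 0 then 0 else inverse x ^ k * exp (- inverse x))"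

lemma DERIV_exp_recip:
  "(exp_recip k has_real_derivative exp_recip (k + 2) x - real k * exp_recip (k + 1) x) (at x)"
proof -
  consider "x < 0" | "x = 0" | "x > 0" by linarith
  then show ?thesis
  proof cases
    case 1
    have "((\<lambda>_. 0 :: real) has_real_derivative 0) (at x)" by simp
    then have "(exp_recip k has_real_derivative 0) (at x)"
      by (rule has_field_derivative_transform_within_open[where S="{..<0}"])
        (use 1 in \<open>auto simp: exp_recip_def\<close>)
    then show ?thesis using 1 by (simp add: exp_recip_def)
  next
    case 3
    have "((\<lambda>x. inverse x ^ k * exp (- inverse x)) has_real_derivative
       (- (inverse x ^ 2) * (real k * inverse x ^ (k - 1))) * exp (- inverse x)
       + inverse x ^ k * (exp (- inverse x) * inverse x ^ 2)) (at x)"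
      using 3 by (auto intro!: derivative_eq_intros simp: power2_eq_square)
    moreover have "(- (inverse x ^ 2) * (real k * inverse x ^ (k - 1))) * exp (- inverse x)
       + inverse x ^ k * (exp (- inverse x) * inverse x ^ 2)
       = exp_recip (k + 2) x - real k * exp_recip (k + 1) x"
      using 3 by (cases k) (simp_all add: exp_recip_def power2_eq_square)
    ultimately have "((\<lambda>x. inverse x ^ k * exp (- inverse x)) has_real_derivative
       exp_recip (k + 2) x - real k * exp_recip (k + 1) x) (at x)" by simp
    then show ?thesis
      by (rule has_field_derivative_transform_within_open[where S="{0<..}"])
        (use 3 in \<open>auto simp: exp_recip_def\<close>)
  next
    case 2
    have "((\<lambda>h. exp_recip k h / h) \<longlongrightarrow> 0) (at_right 0)"
    proof -
      have "((\<lambda>h. inverse h ^ (k + 1) / exp (inverse h)) \<longlongrightarrow> (0::real)) (at_right 0)"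
        by (rule filterlim_compose[OF tendsto_power_div_exp_0 filterlim_inverse_at_top_right])
      then show ?thesis
      proof (rule Lim_transform_eventually)
        show "\<forall>\<^sub>F h in at_right 0. inverse h ^ (k + 1) / exp (inverse h) = exp_recip k h / h"
          unfolding eventually_at_right_field
          by (rule exI[of _ 1]) (auto simp: exp_recip_def exp_minus field_simps)
      qed
    qed
    moreover have "((\<lambda>h. exp_recip k h / h) \<longlongrightarrow> 0) (at_left 0)"
      by (rule Lim_transform_eventually[OF tendsto_const[of 0]])
        (auto simp: exp_recip_def eventually_at_left_field intro!: exI[of _ "-1"])
    ultimately have "((\<lambda>h. exp_recip k h / h) \<longlongrightarrow> 0) (at 0)"
      by (simp add: filterlim_at_split)
    then show ?thesis using 2 by (simp add: DERIV_def exp_recip_def)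
  qed
qed

lemma Ck_exp_recip: "Ck m (\<lambda>x. exp_recip k (x \<bullet> v + c))"
proof (induction m arbitrary: k)
  case 0
  have "continuous_on UNIV (exp_recip k)"
    using DERIV_exp_recip DERIV_isCont by (blast intro: continuous_at_imp_continuous_on)
  then show ?case
    by (auto intro!: continuous_on_compose2[of UNIV "exp_recip k"] continuous_intros)
next
  case (Suc m)
  let ?D = "\<lambda>x. exp_recip (k + 2) (x \<bullet> v + c) - real k * exp_recip (k + 1) (x \<bullet> v + c)"
  have "((\<lambda>x. exp_recip k (x \<bullet> v + c)) has_derivative (\<lambda>h. h \<bullet> v * ?D x)) (at x)" for x
    by (rule has_derivative_compose[of "\<lambda>x. x \<bullet> v + c" "\<lambda>h. h \<bullet> v" x UNIV "exp_recip k"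
          "\<lambda>t. t * ?D x"])
      (use DERIV_exp_recip[of k "x \<bullet> v + c"] in
        \<open>auto intro!: derivative_eq_intros simp: has_field_derivative_def mult_commute_abs\<close>)
  then show ?case
    by (rule Ck_SucI) (intro Ck_mult Ck_const Ck_diff Suc.IH)
qed

section \<open>Gradients\<close>

definition grad :: "('a::euclidean_space \<Rightarrow> real) \<Rightarrow> 'a \<Rightarrow> 'a" where
  "grad f x = (\<Sum>b\<in>Basis. frechet_derivative f (at x) b *\<^sub>R b)"

lemma grad_inner_Basis: "b \<in> Basis \<Longrightarrow> grad f x \<bullet> b = frechet_derivative f (at x) b"
  by (simp add: grad_def inner_sum_left_Basis)

lemma grad_inner:
  assumes "f differentiable (at x)"
  shows "grad f x \<bullet> h = frechet_derivative f (at x) h"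
proof -
  interpret linear "frechet_derivative f (at x)"
    using assms by (rule linear_frechet_derivative)
  have "frechet_derivative f (at x) h = frechet_derivative f (at x) (\<Sum>b\<in>Basis. (h \<bullet> b) *\<^sub>R b)"
    by (simp add: euclidean_representation)
  also have "\<dots> = (\<Sum>b\<in>Basis. (h \<bullet> b) * frechet_derivative f (at x) b)"
    by (simp add: sum scale)
  also have "\<dots> = grad f x \<bullet> h"
    by (simp add: grad_def inner_sum_left inner_sum_right inner_commute[of _ h] mult.commute)
  finally show ?thesis by simp
qed

lemma has_derivative_imp_grad_inner:
  "(f has_derivative D) (at x) \<Longrightarrow> grad f x \<bullet> h = D h"
  by (metis differentiableI frechet_derivative_at grad_inner)

lemma has_derivative_grad:
  assumes "Ck (Suc 0) f"
  shows "(f has_derivative (\<lambda>h. grad f x \<bullet> h)) (at x)"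
proof -
  have "(\<lambda>h. grad f x \<bullet> h) = frechet_derivative f (at x)"
    using assms by (auto simp: grad_inner)
  then show ?thesis using Ck_Suc_has_derivative[OF assms] by simp
qed

lemma grad_eqI: 
  assumes "(f has_derivative (\<lambda>h. g \<bullet> h)) (at x)"
  shows "grad f x = g"
  using has_derivative_imp_grad_inner[OF assms] by (metis vector_eq_rdot)

lemma continuous_grad:
  assumes "Ck (Suc 0) f"
  shows "continuous_on S (grad f)"
proof -
  have "continuous_on UNIV (grad f)"
    unfolding grad_def by (intro continuous_intros) (use assms in auto)
  then show ?thesis by (rule continuous_on_subset) simp
qed

lemma Ck_imp_continuous: "Ck k f \<Longrightarrow> continuous_on S f"
  using Ck_le[of k f 0] by (auto intro: continuous_on_subset)

lemma grad_mult:
  assumes "Ck (Suc 0) f" "Ck (Suc 0) g"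
  shows "grad (\<lambda>x. f x * g x) x = f x *\<^sub>R grad g x + g x *\<^sub>R grad f x"
  by (rule grad_eqI, rule has_derivative_eq_rhs,
      rule has_derivative_mult[OF has_derivative_grad[OF assms(1)] has_derivative_grad[OF assms(2)]])
    (auto simp: inner_add_left mult.commute)

lemma grad_diff:
  assumes "Ck (Suc 0) f" "Ck (Suc 0) g"
  shows "grad (\<lambda>x. f x - g x) x = grad f x - grad g x"
  by (rule grad_eqI, rule has_derivative_eq_rhs,
      rule has_derivative_diff[OF has_derivative_grad[OF assms(1)] has_derivative_grad[OF assms(2)]])
    (auto simp: inner_diff_left)

lemma smooth_Ck: "smooth f \<Longrightarrow> Ck k f"
  by (simp add: smooth_def)

section \<open>The fundamental lemma of the calculus of variations\<close>

text \<open>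
  Since \<open>exp_recip 0 (n t) = exp (- 1 / (n t))\<close> tends to \<open>1\<close> for \<open>t > 0\<close> and vanishes for \<open>t \<le> 0\<close>,
  these bumps increase to the indicator function of the box as \<open>n\<close> grows. The factor is \<open>n + 1\<close> so
  that already \<open>n = 0\<close> gives a bump.
\<close>

definition box_bump :: "nat \<Rightarrow> 'a::euclidean_space \<Rightarrow> 'a \<Rightarrow> 'a \<Rightarrow> real" where
  "box_bump n a c x = (\<Prod>b\<in>Basis. exp_recip 0 (real (Suc n) * ((x - a) \<bullet> b)) *
     exp_recip 0 (real (Suc n) * ((c - x) \<bullet> b)))"

lemma exp_recip_0_bounds: "0 \<le> exp_recip 0 x" "exp_recip 0 x \<le> 1"
  by (auto simp: exp_recip_def)

lemma exp_recip_0_eq_0_iff: "exp_recip 0 x = 0 \<longleftrightarrow> x \<le> 0"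
  by (auto simp: exp_recip_def)

lemma box_bump_nonneg: "0 \<le> box_bump n a c x"
  unfolding box_bump_def by (intro prod_nonneg ballI mult_nonneg_nonneg exp_recip_0_bounds)

lemma box_bump_le_1: "box_bump n a c x \<le> 1"
  unfolding box_bump_def
  by (intro prod_le_1 conjI mult_nonneg_nonneg mult_le_one exp_recip_0_bounds)

lemma box_bump_nonzero_iff: "box_bump n a c x \<noteq> 0 \<longleftrightarrow> x \<in> box a c"
proof -
  have "box_bump n a c x \<noteq> 0 \<longleftrightarrow>
     (\<forall>b\<in>Basis. real (Suc n) * ((x - a) \<bullet> b) > 0 \<and> real (Suc n) * ((c - x) \<bullet> b) > 0)"
    unfolding box_bump_def by (simp add: exp_recip_0_eq_0_iff not_le del: of_nat_Suc)
  then show ?thesis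
    by (simp add: mem_box zero_less_mult_iff inner_diff_left del: of_nat_Suc)
qed

lemma smooth_box_bump: "smooth (box_bump n a c)"
proof -
  have eq: "real (Suc n) * ((x - a) \<bullet> b) = x \<bullet> (real (Suc n) *\<^sub>R b) + (- real (Suc n) * (a \<bullet> b))"
    "real (Suc n) * ((c - x) \<bullet> b) = x \<bullet> (- real (Suc n) *\<^sub>R b) + real (Suc n) * (c \<bullet> b)" for x b
    by (simp_all add: inner_diff_left algebra_simps)
  show ?thesis
    unfolding smooth_def box_bump_def eq by (intro allI Ck_prod Ck_mult Ck_exp_recip)
qed

lemma box_bump_tendsto: "(\<lambda>n. box_bump n a c x) \<longlonglongrightarrow> indicator (box a c) x"
proof (cases "x \<in> box a c")
  case False
  then have "box_bump n a c x = 0" for n using box_bump_nonzero_iff by blast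
  then show ?thesis using False by simp
next
  case True
  have lim: "(\<lambda>n. exp_recip 0 (real (Suc n) * t)) \<longlonglongrightarrow> 1" if "t > 0" for t
  proof -
    have "filterlim (\<lambda>n. real (Suc n) * t) at_top sequentially"
      using that by (intro filterlim_at_top_mult_tendsto_pos[OF tendsto_const] filterlim_compose[OF filterlim_real_sequentially filterlim_Suc])
        auto
    then have "(\<lambda>n. inverse (real (Suc n) * t)) \<longlonglongrightarrow> 0"
      by (rule filterlim_compose[OF tendsto_inverse_0_at_top[OF filterlim_ident]])
    then have "(\<lambda>n. exp (- inverse (real (Suc n) * t))) \<longlonglongrightarrow> exp (- 0)"
      by (intro tendsto_intros)
    moreover have "exp_recip 0 (real (Suc n) * t) = exp (- inverse (real (Suc n) * t))" for n
      using that by (simp add: exp_recip_def mult_le_0_iff del: of_nat_Suc)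
    ultimately show ?thesis by simp
  qed
  have "(\<lambda>n. box_bump n a c x) \<longlonglongrightarrow> (\<Prod>b\<in>(Basis :: 'a set). 1 * 1)"
    unfolding box_bump_def
  proof (rule tendsto_prod, rule tendsto_mult)
    fix b :: 'a assume "b \<in> Basis"
    with True show "(\<lambda>n. exp_recip 0 (real (Suc n) * ((x - a) \<bullet> b))) \<longlonglongrightarrow> 1"
      "(\<lambda>n. exp_recip 0 (real (Suc n) * ((c - x) \<bullet> b))) \<longlonglongrightarrow> 1"
      by (auto simp: mem_box inner_diff_left simp del: of_nat_Suc intro!: lim)
  qed
  then show ?thesis using True by simp
qed

lemma test_function_smooth: "\<phi> \<in> test_functions \<Omega> \<Longrightarrow> smooth \<phi>"
  by (simp add: test_functions_def)

lemma eq_0_outside_support: "x \<notin> closure {x. f x \<noteq> 0} \<Longrightarrow> f x = 0"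
  using closure_subset[of "{x. f x \<noteq> 0}"] by auto

lemma test_functionI:
  assumes "smooth \<phi>" "compact K" "K \<subseteq> \<Omega>" "\<And>x. x \<notin> K \<Longrightarrow> \<phi> x = 0"
  shows "\<phi> \<in> test_functions \<Omega>"
proof -
  have sub: "{x. \<phi> x \<noteq> 0} \<subseteq> K" using assms(4) by blast
  then have "closure {x. \<phi> x \<noteq> 0} \<subseteq> K"
    using compact_imp_closed[OF assms(2)] by (rule closure_minimal)
  moreover have "bounded {x. \<phi> x \<noteq> 0}"
    using bounded_subset[OF compact_imp_bounded[OF assms(2)] sub] .
  ultimately show ?thesis
    using assms(1,3) by (auto simp: test_functions_def compact_closure)
qed

lemma box_bump_test_function:
  assumes "cbox a c \<subseteq> \<Omega>"
  shows "box_bump n a c \<in> test_functions \<Omega>"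
proof (rule test_functionI[OF smooth_box_bump compact_cbox assms])
  show "box_bump n a c x = 0" if "x \<notin> cbox a c" for x
    using that box_bump_nonzero_iff[of n a c x] box_subset_cbox[of a c] by auto
qed

text \<open>
  Boxes form an intersection-stable generator of the Borel sets, so vanishing box integrals
  propagate to all Borel sets by the \<open>\<pi>\<close>-\<open>\<lambda>\<close> theorem. The total integral has to be assumed because
  the whole space is not a box.
\<close>

lemma AE_zero_of_box_integrals_zero:
  fixes h :: "'a::euclidean_space \<Rightarrow> real"
  assumes int: "integrable lebesgue h" and total: "integral\<^sup>L lebesgue h = 0"
    and box: "\<And>a c. (\<integral>x. indicator (box a c) x * h x \<partial>lebesgue) = 0"
  shows "AE x in lebesgue. h x = 0"
proof -
  have meas: "h \<in> borel_measurable (completion lborel)"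
    using borel_measurable_integrable[OF int] .
  obtain g where g[measurable]: "g \<in> borel_measurable lborel" and eq: "AE x in lborel. h x = g x"
    using completion_ex_borel_measurable_real[OF meas] by auto
  have eq': "AE x in lebesgue. h x = g x" using eq by (rule AE_completion)
  have gc: "g \<in> borel_measurable lebesgue" using g by (rule measurable_completion)
  have "integrable lebesgue g"
    using int integrable_cong_AE[OF meas gc eq'] by simp
  then have gint: "integrable lborel g" using integrable_completion[OF g] by simp
  have mult: "(\<integral>x. indicator A x * g x \<partial>lborel) = (\<integral>x. indicator A x * h x \<partial>lebesgue)"
    if [measurable]: "A \<in> sets borel" for A
  proof -
    have "(\<integral>x. indicator A x * g x \<partial>lborel) = (\<integral>x. indicator A x * g x \<partial>lebesgue)"
      by (rule integral_completion[symmetric]) measurable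
    also have "\<dots> = (\<integral>x. indicator A x * h x \<partial>lebesgue)"
    proof (rule integral_cong_AE)
      have ind: "(indicator A :: 'a \<Rightarrow> real) \<in> borel_measurable lebesgue"
        using that by (intro borel_measurable_indicator) simp
      show "(\<lambda>x. indicator A x * g x) \<in> borel_measurable lebesgue"
        "(\<lambda>x. indicator A x * h x) \<in> borel_measurable lebesgue"
        using meas gc by (auto intro!: borel_measurable_times ind)
      show "AE x in lebesgue. indicator A x * g x = indicator A x * h x"
        using eq' by eventually_elim simp
    qed
    finally show ?thesis .
  qed
  have tot: "integral\<^sup>L lborel g = 0"
    using mult[of UNIV] total by simp
  have zero: "(\<integral>x. indicator A x * g x \<partial>lborel) = 0" if A: "A \<in> sets borel" for A
  proof -
    have gen: "sets (borel :: 'a measure) = sigma_sets UNIV (range (\<lambda>(a, b). box a b))"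
      by (subst borel_eq_box) simp
    have "A \<in> sigma_sets UNIV (range (\<lambda>(a, b). box a b))" using A gen by simp
    then show ?thesis
    proof (induction rule: sigma_sets_induct_disjoint[rotated 2, consumes 1])
      case (1 A) then show ?case using mult box by auto
    next
      case 2 then show ?case by simp
    next
      case (3 A)
      then have [measurable]: "A \<in> sets borel" by (simp add: gen)
      have "(\<integral>x. indicator (UNIV - A) x * g x \<partial>lborel) = (\<integral>x. g x - indicator A x * g x \<partial>lborel)"
        by (rule Bochner_Integration.integral_cong) (auto simp: indicator_def)
      also have "\<dots> = integral\<^sup>L lborel g - (\<integral>x. indicator A x * g x \<partial>lborel)"
        using integrable_mult_indicator[of A lborel g] gint
        by (intro Bochner_Integration.integral_diff) auto
      finally show ?case using 3 tot by simp
    next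
      case (4 A)
      then have [measurable]: "A i \<in> sets borel" for i by (auto simp: gen)
      have "set_lebesgue_integral lborel (\<Union>i. A i) g = (\<Sum>i. set_lebesgue_integral lborel (A i) g)"
        using 4(1) gint integrable_mult_indicator[of "\<Union>i. A i" lborel g]
        by (intro lebesgue_integral_countable_add)
          (auto simp: disjoint_family_on_def set_integrable_def)
      then show ?case using 4 by (simp add: set_lebesgue_integral_def)
    qed (auto simp: Int_stable_def box_Int_box)
  qed
  have "AE x in lborel. g x = 0"
    using zero by (intro sigma_finite_measure.density_zero[OF sigma_finite_lborel gint]) (simp add: set_lebesgue_integral_def)
  then have "AE x in lborel. h x = 0" using eq by auto
  then show ?thesis by (rule AE_completion)
qed

lemma locally_integrable_cbox:
  "locally_integrable \<Omega> f \<Longrightarrow> cbox a c \<subseteq> \<Omega> \<Longrightarrow> f absolutely_integrable_on cbox a c"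
  by (auto simp: locally_integrable_def)

lemma integral_lebesgue_on_open:
  fixes f :: "'a::euclidean_space \<Rightarrow> real"
  assumes "open \<Omega>"
  shows "(\<integral>x. f x \<partial>lebesgue_on \<Omega>) = (\<integral>x. indicator \<Omega> x * f x \<partial>lebesgue)"
  by (subst integral_restrict_space) (auto simp: assms)

text \<open>
  The bumps of a box converge boundedly to its indicator, so all box integrals of \<open>f\<close> vanish.
\<close>

lemma fundamental_lemma:
  fixes f :: "'a::euclidean_space \<Rightarrow> real"
  assumes \<Omega>: "open \<Omega>" and f: "locally_integrable \<Omega> f"
    and zero: "\<And>\<phi>. \<phi> \<in> test_functions \<Omega> \<Longrightarrow> (\<integral>x. f x * \<phi> x \<partial>lebesgue_on \<Omega>) = 0"
  shows "AE x in lebesgue_on \<Omega>. f x = 0"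
proof -
  have box: "(\<integral>x. indicator (box a c) x * f x \<partial>lebesgue) = 0" if sub: "cbox a c \<subseteq> \<Omega>" for a c
  proof -
    have K: "integrable lebesgue (\<lambda>x. indicator (cbox a c) x * f x)"
      using locally_integrable_cbox[OF f sub] by (simp add: set_integrable_def)
    have K': "integrable lebesgue (\<lambda>x. indicator (box a c) x * f x)"
    proof -
      have "f absolutely_integrable_on box a c"
        by (rule set_integrable_subset[OF locally_integrable_cbox[OF f sub]])
          (auto simp: box_subset_cbox)
      then show ?thesis by (simp add: set_integrable_def)
    qed
    have bump_meas: "box_bump n a c \<in> borel_measurable lebesgue" for n
      using Ck_imp_continuous[OF smooth_Ck[OF smooth_box_bump[of n a c], of 0], of UNIV]
      by (intro measurable_completion) (simp add: borel_measurable_continuous_onI)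
    have eq: "(\<integral>x. f x * box_bump n a c x \<partial>lebesgue_on \<Omega>) =
        (\<integral>x. (indicator (cbox a c) x * f x) * box_bump n a c x \<partial>lebesgue)" for n
    proof -
      have "indicator \<Omega> x * (f x * box_bump n a c x) =
          (indicator (cbox a c) x * f x) * box_bump n a c x" for x
      proof (cases "x \<in> box a c")
        case True
        then have "x \<in> cbox a c" using box_subset_cbox by blast
        then show ?thesis using sub by auto
      next
        case False
        then show ?thesis using box_bump_nonzero_iff[of n a c x] by simp
      qed
      then show ?thesis
        unfolding integral_lebesgue_on_open[OF \<Omega>] by (intro Bochner_Integration.integral_cong refl)
    qed
    have "(\<lambda>n. \<integral>x. (indicator (cbox a c) x * f x) * box_bump n a c x \<partial>lebesgue) \<longlonglongrightarrow>
        (\<integral>x. indicator (box a c) x * f x \<partial>lebesgue)"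
    proof (rule integral_dominated_convergence[where w="\<lambda>x. \<bar>indicator (cbox a c) x * f x\<bar>"])
      show "AE x in lebesgue. (\<lambda>n. (indicator (cbox a c) x * f x) * box_bump n a c x) \<longlonglongrightarrow>
         indicator (box a c) x * f x"
      proof (rule AE_I2)
        fix x :: 'a
        have "(\<lambda>n. (indicator (cbox a c) x * f x) * box_bump n a c x) \<longlonglongrightarrow>
           (indicator (cbox a c) x * f x) * indicator (box a c) x"
          by (intro tendsto_intros box_bump_tendsto)
        moreover have "(indicator (cbox a c) x * f x) * indicator (box a c) x =
           indicator (box a c) x * f x"
          using box_subset_cbox[of a c] by (auto simp: indicator_def)
        ultimately show "(\<lambda>n. (indicator (cbox a c) x * f x) * box_bump n a c x) \<longlonglongrightarrow>
           indicator (box a c) x * f x" by simp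
      qed
      show "AE x in lebesgue. norm ((indicator (cbox a c) x * f x) * box_bump n a c x)
          \<le> \<bar>indicator (cbox a c) x * f x\<bar>" for n
        using box_bump_nonneg[of n a c] box_bump_le_1[of n a c]
        by (intro AE_I2) (auto simp: abs_mult intro!: mult_right_le_one_le)
      show "(\<lambda>x. (indicator (cbox a c) x * f x) * box_bump n a c x) \<in> borel_measurable lebesgue" for n
        by (rule borel_measurable_times[OF borel_measurable_integrable[OF K] bump_meas])
    qed (use K K' in \<open>auto intro: borel_measurable_integrable\<close>)
    moreover have "(\<integral>x. (indicator (cbox a c) x * f x) * box_bump n a c x \<partial>lebesgue) = 0" for n
      using zero[OF box_bump_test_function[OF sub, of n]] eq by simp
    ultimately show ?thesis by (simp add: LIMSEQ_const_iff)
  qed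
  have AE_box: "AE x in lebesgue. indicator (box p q) x * f x = 0" if sub: "cbox p q \<subseteq> \<Omega>" for p q
  proof (rule AE_zero_of_box_integrals_zero)
    have "f absolutely_integrable_on box p q"
      by (rule set_integrable_subset[OF locally_integrable_cbox[OF f sub]])
        (auto simp: box_subset_cbox)
    then show "integrable lebesgue (\<lambda>x. indicator (box p q) x * f x)"
      by (simp add: set_integrable_def)
    show "(\<integral>x. indicator (box p q) x * f x \<partial>lebesgue) = 0" by (rule box[OF sub])
  next
    fix a c
    obtain a' c' where b: "box a c \<inter> box p q = box a' c'" by (simp add: box_Int_box)
    have 0: "(\<integral>x. indicator (box a' c') x * f x \<partial>lebesgue) = 0"
    proof (cases "box a' c' = {}")
      case False
      then have "cbox a' c' = closure (box a' c')" by (simp add: closure_box)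
      also have "\<dots> \<subseteq> cbox p q"
        using b box_subset_cbox[of p q] by (intro closure_minimal closed_cbox) auto
      finally show ?thesis using sub by (intro box) auto
    qed simp
    have ind: "indicator (box a c) x * (indicator (box p q) x * f x) = indicator (box a' c') x * f x" for x
      by (simp add: b[symmetric] indicator_inter_arith)
    then show "(\<integral>x. indicator (box a c) x * (indicator (box p q) x * f x) \<partial>lebesgue) = 0"
      by (simp only: ind 0)
  qed
  obtain B where B: "countable B" "\<And>X. X \<in> B \<Longrightarrow> \<exists>p q. X = box p q \<and> cbox p q \<subseteq> \<Omega>"
    "\<Union>B = \<Omega>"
  proof -
    let ?F = "{X. \<exists>p q. X = box p q \<and> cbox p q \<subseteq> \<Omega>}"
    obtain B where B: "B \<subseteq> ?F" "countable B" "\<Union>B = \<Union>?F"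
      by (rule Lindelof[of ?F]) auto
    moreover have "\<Union>?F = \<Omega>"
    proof (intro equalityI subsetI)
      fix x assume "x \<in> \<Omega>"
      then obtain p q where "cbox p q \<subseteq> \<Omega>" "x \<in> box p q"
        by (rule open_contains_cbox[OF \<Omega>])
      then show "x \<in> \<Union>?F" by blast
    qed (use box_subset_cbox in blast)
    ultimately show thesis using that[of B] by (simp add: subset_eq)
  qed
  have "AE x in lebesgue. \<forall>X\<in>B. x \<in> X \<longrightarrow> f x = 0"
  proof (subst AE_ball_countable[OF B(1)], intro ballI)
    fix X assume "X \<in> B"
    then obtain p q where X: "X = box p q" "cbox p q \<subseteq> \<Omega>" using B(2) by blast
    show "AE x in lebesgue. x \<in> X \<longrightarrow> f x = 0"
      using AE_box[OF X(2)] by eventually_elim (auto simp: X(1))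
  qed
  then have "AE x in lebesgue. x \<in> \<Omega> \<longrightarrow> f x = 0"
    by eventually_elim (use B(3) in auto)
  then show ?thesis
    using \<Omega> by (subst AE_restrict_space_iff) auto
qed

section \<open>Weak gradients\<close>

lemma continuous_supported_integral:
  fixes f :: "'a::euclidean_space \<Rightarrow> real"
  assumes f: "continuous_on UNIV f" and supp: "\<And>x. x \<notin> cbox a c \<Longrightarrow> f x = 0"
  shows "integrable lborel f" "integral (cbox a c) f = integral\<^sup>L lborel f"
proof -
  have eq: "(\<lambda>x. indicator (cbox a c) x *\<^sub>R f x) = f"
    using supp by (auto simp: indicator_def fun_eq_iff)
  have si: "set_integrable lborel (cbox a c) f"
    unfolding set_integrable_def
    by (rule borel_integrable_compact) (auto intro: continuous_on_subset[OF f])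
  then show "integrable lborel f" unfolding set_integrable_def eq .
  show "integral (cbox a c) f = integral\<^sup>L lborel f"
    using set_borel_integral_eq_integral(2)[OF si] by (simp add: set_lebesgue_integral_def eq[simplified])
qed

lemma lborel_integral_translate:
  fixes f :: "'a::euclidean_space \<Rightarrow> real"
  assumes "f \<in> borel_measurable borel"
  shows "(\<integral>x. f (x + c) \<partial>lborel) = integral\<^sup>L lborel f"
proof -
  have "integral\<^sup>L lborel f = integral\<^sup>L (distr lborel borel ((+) c)) f"
    by (simp add: lborel_distr_plus)
  also have "\<dots> = (\<integral>x. f (c + x) \<partial>lborel)"
    using assms by (intro integral_distr) auto
  finally show ?thesis by (simp add: add.commute)
qed

text \<open>
  The integral of \<open>f (t + s v)\<close> over \<open>t\<close> does not depend on \<open>s\<close>, by translation invariance.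
  Differentiating it under the integral sign at \<open>s = 0\<close> gives the claim.
\<close>

lemma integral_grad_compact_support:
  fixes f :: "'a::euclidean_space \<Rightarrow> real"
  assumes f: "Ck (Suc 0) f" and supp: "bounded {x. f x \<noteq> 0}"
  shows "(\<integral>x. grad f x \<bullet> v \<partial>lborel) = 0"
proof -
  obtain R where R: "\<And>x. f x \<noteq> 0 \<Longrightarrow> norm x \<le> R"
    using supp by (auto simp: bounded_iff)
  obtain a where a: "cball (0 :: 'a) (R + norm v) \<subseteq> cbox (- a) a"
    using bounded_subset_cbox_symmetric[OF bounded_cball] by blast
  have out: "f (t + s *\<^sub>R v) = 0" if "t \<notin> cbox (- a) a" "s \<in> {-1..1}" for t :: 'a and s
  proof (rule ccontr)
    assume "f (t + s *\<^sub>R v) \<noteq> 0"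
    then have "norm (t + s *\<^sub>R v) \<le> R" by (rule R)
    moreover have "norm t \<le> norm (t + s *\<^sub>R v) + norm (s *\<^sub>R v)"
      by (metis add_diff_cancel_right' norm_triangle_ineq4)
    moreover have "norm (s *\<^sub>R v) \<le> norm v"
      using that(2) mult_right_mono[of "\<bar>s\<bar>" 1 "norm v"] by auto
    ultimately have "norm t \<le> R + norm v" by linarith
    then show False using a that(1) by auto
  qed
  have cf: "continuous_on UNIV f" by (rule Ck_imp_continuous[OF f])
  have cg: "continuous_on UNIV (grad f)" by (rule continuous_grad[OF f])
  let ?I = "\<lambda>s. integral (cbox (- a) a) (\<lambda>t. f (t + s *\<^sub>R v))"
  have const: "?I s = integral\<^sup>L lborel f" if "s \<in> {-1..1}" for s
  proof -
    have "?I s = (\<integral>t. f (t + s *\<^sub>R v) \<partial>lborel)"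
      using out[OF _ that]
      by (intro continuous_supported_integral(2) continuous_on_compose2[OF cf] continuous_intros) auto
    then show ?thesis
      using lborel_integral_translate[OF borel_measurable_continuous_onI[OF cf]] by simp
  qed
  have "(?I has_field_derivative integral (cbox (- a) a) (\<lambda>t. grad f (t + 0 *\<^sub>R v) \<bullet> v))
      (at 0 within {-1..1})"
  proof (rule leibniz_rule_field_derivative)
    fix s :: real and t :: 'a
    have "((\<lambda>s. f (t + s *\<^sub>R v)) has_derivative (\<lambda>h. grad f (t + s *\<^sub>R v) \<bullet> (h *\<^sub>R v)))
        (at s within {-1..1})"
      by (rule has_derivative_compose[OF _ has_derivative_grad[OF f]])
        (auto intro!: derivative_eq_intros)
    then show "((\<lambda>s. f (t + s *\<^sub>R v)) has_real_derivative grad f (t + s *\<^sub>R v) \<bullet> v)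
        (at s within {-1..1})"
      by (simp add: has_field_derivative_def mult_commute_abs)
  next
    show "continuous_on ({-1..1} \<times> cbox (- a) a) (\<lambda>(s, t). grad f (t + s *\<^sub>R v) \<bullet> v)"
      unfolding split_def
      by (intro continuous_intros continuous_on_compose2[OF cg]) auto
  qed (auto intro!: integrable_continuous continuous_on_compose2[OF cf] continuous_intros)
  then have "((\<lambda>_. integral\<^sup>L lborel f) has_field_derivative
      integral (cbox (- a) a) (\<lambda>t. grad f (t + 0 *\<^sub>R v) \<bullet> v)) (at 0 within {-1..1})"
    by (rule has_field_derivative_transform_within[OF _ zero_less_one]) (use const in auto)
  then have "((\<lambda>_. integral\<^sup>L lborel f) has_field_derivative
      integral (cbox (- a) a) (\<lambda>t. grad f t \<bullet> v)) (at 0 within {-1..1})"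
    by simp
  moreover have "at (0::real) within {-1..1} = at 0"
    by (rule at_within_interior) (simp add: interior_atLeastAtMost_real)
  ultimately have "integral (cbox (- a) a) (\<lambda>t. grad f t \<bullet> v) = 0"
    using DERIV_const DERIV_unique by metis
  moreover have "integral (cbox (- a) a) (\<lambda>t. grad f t \<bullet> v) = (\<integral>t. grad f t \<bullet> v \<partial>lborel)"
  proof (rule continuous_supported_integral(2))
    show "continuous_on UNIV (\<lambda>t. grad f t \<bullet> v)" by (intro continuous_intros cg)
    fix x assume x: "x \<notin> cbox (- a) a"
    have "((\<lambda>_. 0) has_derivative (\<lambda>h. 0 \<bullet> h)) (at x)" by simp
    then have "(f has_derivative (\<lambda>h. 0 \<bullet> h)) (at x)"
    proof (rule has_derivative_transform_within_open[where s="- cbox (- a) a"])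
      show "0 = f y" if "y \<in> - cbox (- a) a" for y using out[of y 0] that by simp
    qed (use x in auto)
    then have "grad f x = 0" by (rule grad_eqI)
    then show "grad f x \<bullet> v = 0" by simp
  qed
  ultimately show ?thesis by simp
qed

lemma grad_eq_0_outside:
  assumes "x \<notin> closure {x. f x \<noteq> 0}"
  shows "grad f x = 0"
proof (rule grad_eqI)
  have "((\<lambda>_. 0) has_derivative (\<lambda>h. 0 \<bullet> h)) (at x)" by simp
  then show "(f has_derivative (\<lambda>h. 0 \<bullet> h)) (at x)"
  proof (rule has_derivative_transform_within_open[where s="- closure {x. f x \<noteq> 0}"])
    show "0 = f y" if "y \<in> - closure {x. f x \<noteq> 0}" for y
      using that closure_subset[of "{x. f x \<noteq> 0}"] by auto
  qed (use assms in auto)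
qed

lemma test_function_eq_0: "\<phi> \<in> test_functions \<Omega> \<Longrightarrow> x \<notin> \<Omega> \<Longrightarrow> \<phi> x = 0"
  by (rule eq_0_outside_support) (auto simp: test_functions_def)

lemma grad_test_function_eq_0: "\<phi> \<in> test_functions \<Omega> \<Longrightarrow> x \<notin> \<Omega> \<Longrightarrow> grad \<phi> x = 0"
  by (rule grad_eq_0_outside) (auto simp: test_functions_def)

lemma integral_lebesgue_on_supported:
  fixes f :: "'a::euclidean_space \<Rightarrow> real"
  assumes "open \<Omega>" "f \<in> borel_measurable borel" "\<And>x. x \<notin> \<Omega> \<Longrightarrow> f x = 0"
  shows "(\<integral>x. f x \<partial>lebesgue_on \<Omega>) = integral\<^sup>L lborel f"
proof -
  have eq: "(\<lambda>x. indicator \<Omega> x * f x) = f" using assms(3) by (force simp: indicator_def)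
  show ?thesis
    unfolding integral_lebesgue_on_open[OF assms(1)] eq
    using assms(2) by (simp add: integral_completion)
qed

lemma continuous_absolutely_integrable_compact:
  fixes f :: "'a::euclidean_space \<Rightarrow> 'b::euclidean_space"
  assumes "continuous_on K f" "compact K"
  shows "f absolutely_integrable_on K"
proof -
  have "integrable lborel (\<lambda>x. indicator K x *\<^sub>R f x)"
    by (rule borel_integrable_compact[OF assms(2,1)])
  then show ?thesis
    unfolding set_integrable_def
    by (subst integrable_completion) auto
qed

lemma continuous_locally_integrable:
  "continuous_on UNIV f \<Longrightarrow> locally_integrable \<Omega> f"
  by (auto simp: locally_integrable_def intro: continuous_absolutely_integrable_compact continuous_on_subset)

text \<open>
  For a test function \<open>\<phi>\<close> the product \<open>f \<phi>\<close> has compact support, so its gradient integrates to zero;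
  the product rule turns this into the defining identity.
\<close>

lemma is_weak_gradient_classical:
  fixes f :: "'a::euclidean_space \<Rightarrow> real"
  assumes \<Omega>: "open \<Omega>" and f: "Ck (Suc 0) f"
  shows "is_weak_gradient \<Omega> f (grad f)"
  unfolding is_weak_gradient_def
proof (intro conjI ballI)
  show "locally_integrable \<Omega> f" "locally_integrable \<Omega> (grad f)"
    by (intro continuous_locally_integrable Ck_imp_continuous[OF f] continuous_grad[OF f])+
next
  fix \<phi> :: "'a \<Rightarrow> real" and b :: 'a assume \<phi>: "\<phi> \<in> test_functions \<Omega>" and b: "b \<in> Basis"
  have \<phi>1: "Ck (Suc 0) \<phi>" using \<phi> by (intro smooth_Ck test_function_smooth)
  have comp: "compact (closure {x. \<phi> x \<noteq> 0})" using \<phi> by (simp add: test_functions_def)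
  then have bd: "bounded {x. \<phi> x \<noteq> 0}" by (meson bounded_subset closure_subset compact_imp_bounded)
  obtain a where a: "closure {x. \<phi> x \<noteq> 0} \<subseteq> cbox (- a) a"
    using bounded_subset_cbox_symmetric[OF compact_imp_bounded[OF comp]] by blast
  have c: "continuous_on UNIV f" "continuous_on UNIV \<phi>" "continuous_on UNIV (grad f)"
    "continuous_on UNIV (grad \<phi>)"
    by (intro Ck_imp_continuous[OF f] Ck_imp_continuous[OF \<phi>1] continuous_grad f \<phi>1)+
  have c1: "continuous_on UNIV (\<lambda>x. f x * (grad \<phi> x \<bullet> b))"
    and c2: "continuous_on UNIV (\<lambda>x. (grad f x \<bullet> b) * \<phi> x)"
    by (intro continuous_intros c)+
  have out: "\<phi> x = 0 \<and> grad \<phi> x = 0" if "x \<notin> cbox (- a) a" for x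
    using that a closure_subset[of "{x. \<phi> x \<noteq> 0}"] grad_eq_0_outside[of x \<phi>] by blast
  have i1: "integrable lborel (\<lambda>x. f x * (grad \<phi> x \<bullet> b))"
    by (rule continuous_supported_integral(1)[OF c1, of "- a" a]) (simp add: out)
  have i2: "integrable lborel (\<lambda>x. (grad f x \<bullet> b) * \<phi> x)"
    by (rule continuous_supported_integral(1)[OF c2, of "- a" a]) (simp add: out)
  have "0 = (\<integral>x. grad (\<lambda>x. f x * \<phi> x) x \<bullet> b \<partial>lborel)"
    by (rule integral_grad_compact_support[symmetric])
      (auto intro!: Ck_mult f \<phi>1 intro: bounded_subset[OF bd] simp del: Ck.simps)
  also have "\<dots> = (\<integral>x. f x * (grad \<phi> x \<bullet> b) + (grad f x \<bullet> b) * \<phi> x \<partial>lborel)"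
    by (simp add: grad_mult[OF f \<phi>1] inner_add_left mult.commute[of "\<phi> _"])
  also have "\<dots> = (\<integral>x. f x * (grad \<phi> x \<bullet> b) \<partial>lborel) + (\<integral>x. (grad f x \<bullet> b) * \<phi> x \<partial>lborel)"
    by (rule Bochner_Integration.integral_add[OF i1 i2])
  finally have "(\<integral>x. f x * (grad \<phi> x \<bullet> b) \<partial>lborel) = - (\<integral>x. (grad f x \<bullet> b) * \<phi> x \<partial>lborel)"
    by simp
  moreover have "(\<integral>x. f x * frechet_derivative \<phi> (at x) b \<partial>lebesgue_on \<Omega>) =
      (\<integral>x. f x * (grad \<phi> x \<bullet> b) \<partial>lborel)"
    unfolding grad_inner_Basis[OF b, symmetric]
    by (rule integral_lebesgue_on_supported[OF \<Omega>])
      (auto simp: grad_test_function_eq_0[OF \<phi>] intro!: borel_measurable_continuous_onI c1)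
  moreover have "(\<integral>x. (grad f x \<bullet> b) * \<phi> x \<partial>lebesgue_on \<Omega>) = (\<integral>x. (grad f x \<bullet> b) * \<phi> x \<partial>lborel)"
    by (rule integral_lebesgue_on_supported[OF \<Omega>])
      (auto simp: test_function_eq_0[OF \<phi>] intro!: borel_measurable_continuous_onI c2)
  ultimately show "(\<integral>x. f x * frechet_derivative \<phi> (at x) b \<partial>lebesgue_on \<Omega>) =
      - (\<integral>x. (grad f x \<bullet> b) * \<phi> x \<partial>lebesgue_on \<Omega>)" by simp
qed

lemma locally_integrable_mult_integrable:
  fixes f \<psi> :: "'a::euclidean_space \<Rightarrow> real"
  assumes \<Omega>: "open \<Omega>" and f: "locally_integrable \<Omega> f" and K: "compact K" "K \<subseteq> \<Omega>"
    and \<psi>: "continuous_on UNIV \<psi>" "\<And>x. x \<notin> K \<Longrightarrow> \<psi> x = 0"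
  shows "integrable (lebesgue_on \<Omega>) (\<lambda>x. f x * \<psi> x)"
proof -
  have int: "integrable lebesgue (\<lambda>x. indicator K x * f x)"
    using f K by (simp add: locally_integrable_def set_integrable_def)
  have "bounded (\<psi> ` K)"
    by (intro compact_imp_bounded compact_continuous_image K continuous_on_subset[OF \<psi>(1)]) simp
  then obtain B where B: "\<And>x. x \<in> K \<Longrightarrow> norm (\<psi> x) \<le> B" by (auto simp: bounded_iff)
  have B': "\<bar>\<psi> x\<bar> \<le> \<bar>B\<bar>" for x using B[of x] \<psi>(2)[of x] by (cases "x \<in> K") auto
  have meas: "\<psi> \<in> borel_measurable lebesgue"
    using \<psi>(1) by (intro measurable_completion) (simp add: borel_measurable_continuous_onI)
  have "integrable lebesgue (\<lambda>x. (indicator K x * f x) * \<psi> x)"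
  proof (rule Bochner_Integration.integrable_bound)
    show "integrable lebesgue (\<lambda>x. \<bar>B\<bar> * (indicator K x * f x))" using int by simp
    show "(\<lambda>x. (indicator K x * f x) * \<psi> x) \<in> borel_measurable lebesgue"
      by (rule borel_measurable_times[OF borel_measurable_integrable[OF int] meas])
    show "AE x in lebesgue. norm (indicator K x * f x * \<psi> x) \<le> norm (\<bar>B\<bar> * (indicator K x * f x))"
    proof (rule AE_I2)
      fix x
      show "norm (indicator K x * f x * \<psi> x) \<le> norm (\<bar>B\<bar> * (indicator K x * f x))"
        using mult_left_mono[OF B'[of x] abs_ge_zero[of "indicator K x * f x"]]
        by (simp add: abs_mult mult.commute)
    qed
  qed
  moreover have "(\<lambda>x. (indicator K x * f x) * \<psi> x) = (\<lambda>x. indicator \<Omega> x * (f x * \<psi> x))"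
    using K \<psi>(2) by (auto simp: indicator_def fun_eq_iff)
  ultimately show ?thesis
    using \<Omega> by (subst integrable_restrict_space) auto
qed

lemma locally_integrable_mult_test_function:
  fixes f \<phi> :: "'a::euclidean_space \<Rightarrow> real"
  assumes \<Omega>: "open \<Omega>" and f: "locally_integrable \<Omega> f" and \<phi>: "\<phi> \<in> test_functions \<Omega>"
  shows "integrable (lebesgue_on \<Omega>) (\<lambda>x. f x * \<phi> x)"
    "b \<in> Basis \<Longrightarrow> integrable (lebesgue_on \<Omega>) (\<lambda>x. f x * frechet_derivative \<phi> (at x) b)"
proof -
  let ?K = "closure {x. \<phi> x \<noteq> 0}"
  have K: "compact ?K" "?K \<subseteq> \<Omega>" using \<phi> by (auto simp: test_functions_def)
  have \<phi>1: "Ck (Suc 0) \<phi>" using \<phi> by (intro smooth_Ck test_function_smooth)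
  show "integrable (lebesgue_on \<Omega>) (\<lambda>x. f x * \<phi> x)"
    using closure_subset[of "{x. \<phi> x \<noteq> 0}"]
    by (intro locally_integrable_mult_integrable[OF \<Omega> f K] Ck_imp_continuous[OF \<phi>1]) auto
  show "integrable (lebesgue_on \<Omega>) (\<lambda>x. f x * frechet_derivative \<phi> (at x) b)" if "b \<in> Basis"
    unfolding grad_inner_Basis[OF that, symmetric]
    by (intro locally_integrable_mult_integrable[OF \<Omega> f K] continuous_intros continuous_grad[OF \<phi>1])
      (simp add: grad_eq_0_outside)
qed

lemma locally_integrable_diff:
  "locally_integrable \<Omega> f \<Longrightarrow> locally_integrable \<Omega> g \<Longrightarrow> locally_integrable \<Omega> (\<lambda>x. f x - g x)"
  by (auto simp: locally_integrable_def)

lemma locally_integrable_inner: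
  assumes "locally_integrable \<Omega> f"
  shows "locally_integrable \<Omega> (\<lambda>x. f x \<bullet> b)"
  unfolding locally_integrable_def
proof (intro allI impI)
  fix K assume "compact K \<and> K \<subseteq> \<Omega>"
  then have "integrable lebesgue (\<lambda>x. (indicator K x *\<^sub>R f x) \<bullet> b)"
    using assms by (intro integrable_inner_left) (auto simp: locally_integrable_def set_integrable_def)
  then show "(\<lambda>x. f x \<bullet> b) absolutely_integrable_on K"
    by (simp add: set_integrable_def)
qed

lemma is_weak_gradient_diff:
  assumes \<Omega>: "open \<Omega>" and v: "is_weak_gradient \<Omega> v g" and w: "is_weak_gradient \<Omega> w h"
  shows "is_weak_gradient \<Omega> (\<lambda>x. v x - w x) (\<lambda>x. g x - h x)"
  unfolding is_weak_gradient_def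
proof (intro conjI ballI)
  have loc: "locally_integrable \<Omega> v" "locally_integrable \<Omega> w" "locally_integrable \<Omega> g"
    "locally_integrable \<Omega> h" using v w by (auto simp: is_weak_gradient_def)
  then show "locally_integrable \<Omega> (\<lambda>x. v x - w x)" "locally_integrable \<Omega> (\<lambda>x. g x - h x)"
    by (auto intro: locally_integrable_diff)
  fix \<phi> :: "'a \<Rightarrow> real" and b :: 'a assume \<phi>: "\<phi> \<in> test_functions \<Omega>" and b: "b \<in> Basis"
  show "(\<integral>x. (v x - w x) * frechet_derivative \<phi> (at x) b \<partial>lebesgue_on \<Omega>) =
      - (\<integral>x. ((g x - h x) \<bullet> b) * \<phi> x \<partial>lebesgue_on \<Omega>)"
    using v w \<phi> b loc(1,2)[THEN locally_integrable_mult_test_function(2)[OF \<Omega> _ \<phi> b]]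
      loc(3,4)[THEN locally_integrable_inner[of _ _ b],
        THEN locally_integrable_mult_test_function(1)[OF \<Omega> _ \<phi>]]
    by (simp add: is_weak_gradient_def left_diff_distrib inner_diff_left)
qed

lemma weak_gradient_unique:
  assumes \<Omega>: "open \<Omega>" and g: "is_weak_gradient \<Omega> v g" and h: "is_weak_gradient \<Omega> v h"
  shows "AE x in lebesgue_on \<Omega>. g x = h x"
proof -
  have 0: "is_weak_gradient \<Omega> (\<lambda>x. v x - v x) (\<lambda>x. g x - h x)"
    by (rule is_weak_gradient_diff[OF \<Omega> g h])
  have "AE x in lebesgue_on \<Omega>. (g x - h x) \<bullet> b = 0" if b: "b \<in> Basis" for b
  proof (rule fundamental_lemma[OF \<Omega>])
    show "locally_integrable \<Omega> (\<lambda>x. (g x - h x) \<bullet> b)"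
      using 0 by (intro locally_integrable_inner) (simp add: is_weak_gradient_def)
    show "(\<integral>x. ((g x - h x) \<bullet> b) * \<phi> x \<partial>lebesgue_on \<Omega>) = 0" if "\<phi> \<in> test_functions \<Omega>" for \<phi>
      using 0 b that by (auto simp: is_weak_gradient_def)
  qed
  then have "AE x in lebesgue_on \<Omega>. \<forall>b\<in>Basis. (g x - h x) \<bullet> b = 0"
    by (subst AE_ball_countable) (auto intro: countable_finite)
  then show ?thesis
    by eventually_elim (metis euclidean_all_zero_iff right_minus_eq)
qed

lemma is_weak_gradient_weak_gradient:
  "is_weak_gradient \<Omega> v g \<Longrightarrow> is_weak_gradient \<Omega> v (weak_gradient \<Omega> v)"
  unfolding weak_gradient_def by (rule someI[of _ g])

lemma weak_gradient_AE_eq: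
  "open \<Omega> \<Longrightarrow> is_weak_gradient \<Omega> v g \<Longrightarrow> AE x in lebesgue_on \<Omega>. weak_gradient \<Omega> v x = g x"
  by (rule weak_gradient_unique[OF _ is_weak_gradient_weak_gradient])

section \<open>Smooth cutoff functions\<close>

text \<open>
  All derivatives fall on \<open>\<rho>\<close>, and each partial derivative of the convolution is again the
  convolution of \<open>\<kappa>\<close> with a partial derivative of \<open>\<rho>\<close>; this makes the induction on \<open>k\<close> close.
\<close>

lemma Ck_convolution:
  fixes \<kappa> \<rho> :: "'a::euclidean_space \<Rightarrow> real"
  assumes \<kappa>: "continuous_on UNIV \<kappa>" and \<rho>: "Ck k \<rho>"
  shows "Ck k (\<lambda>x. integral (cbox p q) (\<lambda>t. \<kappa> t * \<rho> (x - t)))"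
  using \<rho>
proof (induction k arbitrary: \<rho>)
  case 0
  then have c: "continuous_on UNIV \<rho>" by simp
  have "continuous_on UNIV (\<lambda>x. integral (cbox p q) (\<lambda>t. \<kappa> t * \<rho> (x - t)))"
    unfolding split_def
    by (rule integral_continuous_on_param, unfold split_def)
      (intro continuous_intros continuous_on_compose2[OF c] continuous_on_compose2[OF \<kappa>]; simp)
  then show ?case by simp
next
  case (Suc k)
  have \<rho>1: "Ck (Suc 0) \<rho>" using Suc.prems by (rule Ck_le) simp
  have c: "continuous_on UNIV \<rho>" by (rule Ck_imp_continuous[OF \<rho>1])
  have cg: "continuous_on UNIV (grad \<rho>)" by (rule continuous_grad[OF \<rho>1])
  define F where "F x t = \<kappa> t *\<^sub>R blinfun_inner_right (grad \<rho> (x - t))" for x t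
  have F_apply: "blinfun_apply (F x t) = (\<lambda>h. \<kappa> t * (grad \<rho> (x - t) \<bullet> h))" for x t
    by (simp add: F_def fun_eq_iff blinfun.scaleR_left)
  have F_cont: "continuous_on S (\<lambda>z. F (fst z) (snd z))" for S
    unfolding F_def
    by (intro continuous_intros bounded_linear.continuous_on[OF bounded_linear_blinfun_inner_right]
        continuous_on_compose2[OF cg] continuous_on_compose2[OF \<kappa>]) auto
  have deriv: "((\<lambda>x. integral (cbox p q) (\<lambda>t. \<kappa> t * \<rho> (x - t))) has_derivative
      integral (cbox p q) (F x)) (at x within UNIV)" for x
  proof (rule leibniz_rule)
    fix x t
    have "((\<lambda>x. \<rho> (x - t)) has_derivative (\<lambda>h. grad \<rho> (x - t) \<bullet> h)) (at x)"
      by (rule has_derivative_compose[OF _ has_derivative_grad[OF \<rho>1]])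
        (auto intro!: derivative_eq_intros)
    then show "((\<lambda>x. \<kappa> t * \<rho> (x - t)) has_derivative blinfun_apply (F x t)) (at x within UNIV)"
      unfolding F_apply by (intro has_derivative_mult_right) simp
  next
    show "(\<lambda>t. \<kappa> t * \<rho> (x - t)) integrable_on cbox p q" for x
      by (intro integrable_continuous continuous_intros continuous_on_compose2[OF c]
          continuous_on_compose2[OF \<kappa>]) auto
    show "continuous_on (UNIV \<times> cbox p q) (\<lambda>(x, t). F x t)"
      using F_cont by (simp add: split_def)
  qed auto
  have "blinfun_apply (integral (cbox p q) (F x)) b =
      integral (cbox p q) (\<lambda>t. \<kappa> t * frechet_derivative \<rho> (at (x - t)) b)" if "b \<in> Basis" for x b
  proof -
    have "F x integrable_on cbox p q"
      using continuous_on_compose2[OF F_cont[of UNIV], of "cbox p q" "\<lambda>t. (x, t)"]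
      by (intro integrable_continuous) (simp add: continuous_on_Pair)
    then show ?thesis
      using that by (simp add: blinfun_apply_integral F_apply grad_inner_Basis)
  qed
  with deriv show ?case
    using Suc.IH[OF Ck_Suc_partial[OF Suc.prems]]
    by (intro Ck_SucI[where f'="\<lambda>x. integral (cbox p q) (F x)"]) (simp_all del: Ck.simps)
qed

lemma norm_grad_le_lipschitz:
  assumes f: "Ck (Suc 0) f" and lip: "\<And>x y. \<bar>f x - f y\<bar> \<le> L * norm (x - y)"
  shows "norm (grad f x) \<le> L"
proof -
  let ?v = "grad f x"
  have "((\<lambda>s. f (x + s *\<^sub>R ?v)) has_derivative (\<lambda>s. ?v \<bullet> (s *\<^sub>R ?v))) (at 0)"
    by (rule has_derivative_compose[of "\<lambda>s. x + s *\<^sub>R ?v" "\<lambda>s. s *\<^sub>R ?v" 0 UNIV f "\<lambda>h. ?v \<bullet> h"])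
      (use has_derivative_grad[OF f, of x] in \<open>auto intro!: derivative_eq_intros\<close>)
  then have "((\<lambda>s. f (x + s *\<^sub>R ?v)) has_real_derivative ?v \<bullet> ?v) (at 0)"
    by (simp add: has_field_derivative_def mult_commute_abs)
  then have "((\<lambda>s. (f (x + s *\<^sub>R ?v) - f x) / s) \<longlongrightarrow> ?v \<bullet> ?v) (at 0)"
    by (simp add: DERIV_def)
  moreover have "\<forall>\<^sub>F s in at 0. (f (x + s *\<^sub>R ?v) - f x) / s \<le> L * norm ?v"
  proof (rule eventuallyI)
    fix s :: real
    have "\<bar>f (x + s *\<^sub>R ?v) - f x\<bar> \<le> L * norm ?v * \<bar>s\<bar>"
      using lip[of "x + s *\<^sub>R ?v" x] by (simp add: mult_ac)
    moreover have "0 \<le> L * norm ?v"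
      using lip[of "x + ?v" x] by simp
    ultimately show "(f (x + s *\<^sub>R ?v) - f x) / s \<le> L * norm ?v"
      by (cases "s = 0") (auto simp: abs_le_iff divide_le_eq mult_ac abs_if split: if_splits)
  qed
  ultimately have "?v \<bullet> ?v \<le> L * norm ?v"
    by (rule tendsto_upperbound) simp
  then have "norm ?v * norm ?v \<le> L * norm ?v"
    by (simp add: dot_square_norm power2_eq_square)
  moreover have "0 \<le> L"
  proof -
    obtain b :: 'a where "b \<in> Basis" using nonempty_Basis by blast
    then show ?thesis using lip[of b 0] order_trans[OF abs_ge_zero lip[of b 0]] by simp
  qed
  ultimately show ?thesis by (cases "norm ?v = 0") auto
qed

lemma mollifier_exists:
  fixes r :: real
  assumes "r > 0"
  obtains \<rho> :: "'a::euclidean_space \<Rightarrow> real" where "smooth \<rho>" "\<And>x. 0 \<le> \<rho> x"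
    "\<And>x. \<rho> x \<noteq> 0 \<Longrightarrow> norm x < r" "integrable lborel \<rho>" "integral\<^sup>L lborel \<rho> = 1"
proof -
  obtain a c :: 'a where ac: "cbox a c \<subseteq> ball 0 r" "0 \<in> box a c"
    using open_contains_cbox[of "ball (0 :: 'a) r" 0] assms by (metis centre_in_ball open_ball)
  let ?B = "box_bump 0 a c"
  have int: "integrable lborel ?B"
    using box_bump_nonzero_iff[of 0 a c] box_subset_cbox[of a c]
    by (intro continuous_supported_integral(1)[of _ a c] Ck_imp_continuous smooth_Ck smooth_box_bump) blast
  have "integral\<^sup>L lborel ?B \<noteq> 0"
  proof
    assume "integral\<^sup>L lborel ?B = 0"
    then have "AE x in lborel. ?B x = 0"
      by (subst (asm) integral_nonneg_eq_0_iff_AE[OF int]) (simp_all add: box_bump_nonneg)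
    then have "AE x in lborel. x \<notin> box a c"
      by eventually_elim (use box_bump_nonzero_iff in blast)
    then have "box a c \<in> null_sets lborel" by (subst AE_iff_null_sets) auto
    then have "negligible (box a c)"
      by (simp add: negligible_iff_null_sets null_sets_completionI)
    then show False using ac(2) by (simp add: negligible_interval)
  qed
  moreover have "integral\<^sup>L lborel ?B \<ge> 0" by (intro Bochner_Integration.integral_nonneg box_bump_nonneg)
  ultimately have pos: "integral\<^sup>L lborel ?B > 0" by simp
  show thesis
  proof
    show "smooth (\<lambda>x. inverse (integral\<^sup>L lborel ?B) * ?B x)"
      unfolding smooth_def by (intro allI Ck_mult Ck_const smooth_Ck smooth_box_bump)
    show "0 \<le> inverse (integral\<^sup>L lborel ?B) * ?B x" for x
      using pos box_bump_nonneg by (intro mult_nonneg_nonneg) auto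
    show "norm x < r" if "inverse (integral\<^sup>L lborel ?B) * ?B x \<noteq> 0" for x
    proof -
      have "x \<in> box a c" using that box_bump_nonzero_iff[of 0 a c x] by auto
      then show ?thesis using ac(1) box_subset_cbox[of a c] by fastforce
    qed
    show "integrable lborel (\<lambda>x. inverse (integral\<^sup>L lborel ?B) * ?B x)" using int by simp
    show "(\<integral>x. inverse (integral\<^sup>L lborel ?B) * ?B x \<partial>lborel) = 1" using pos by simp
  qed
qed

lemma lborel_integral_reflect:
  fixes f :: "'a::euclidean_space \<Rightarrow> real"
  assumes "f \<in> borel_measurable borel"
  shows "(\<integral>t. f (x - t) \<partial>lborel) = integral\<^sup>L lborel f"
proof -
  have "lborel = distr lborel borel (\<lambda>y. x - y)"
    using lborel_affine[of "-1" x] by (simp add: density_1)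
  then have "integral\<^sup>L lborel f = integral\<^sup>L (distr lborel borel (\<lambda>y. x - y)) f" by simp
  also have "\<dots> = (\<integral>t. f (x - t) \<partial>lborel)"
    using assms by (intro integral_distr) auto
  finally show ?thesis by simp
qed

text \<open>
  The distance to the complement, truncated linearly between \<open>h\<close> and \<open>2 h\<close>, is \<open>1/h\<close>-Lipschitz.
  Averaging it with a mollifier of radius \<open>h/2\<close> makes it smooth and keeps the Lipschitz constant,
  which bounds the gradient. The averaging shifts the thresholds by at most \<open>h/2\<close>.
\<close>

lemma cutoff_exists:
  fixes \<Omega> :: "'a::euclidean_space set"
  assumes \<Omega>: "open \<Omega>" "bounded \<Omega>" and h: "h > 0"
  obtains \<eta> where "\<eta> \<in> test_functions \<Omega>" "\<And>x. 0 \<le> \<eta> x" "\<And>x. \<eta> x \<le> 1"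
    "\<And>x. 3 * h \<le> infdist x (- \<Omega>) \<Longrightarrow> \<eta> x = 1" "\<And>x. norm (grad \<eta> x) \<le> 1 / h"
proof -
  let ?D = "\<lambda>x. infdist x (- \<Omega>)"
  obtain \<rho> :: "'a \<Rightarrow> real" where \<rho>: "smooth \<rho>" "\<And>x. 0 \<le> \<rho> x"
    "\<And>x. \<rho> x \<noteq> 0 \<Longrightarrow> norm x < h / 2" "integrable lborel \<rho>" "integral\<^sup>L lborel \<rho> = 1"
    using mollifier_exists[of "h / 2"] h by auto
  define \<kappa> where "\<kappa> y = max 0 (min 1 (?D y / h - 1))" for y
  have \<kappa>_cont: "continuous_on UNIV \<kappa>"
    unfolding \<kappa>_def using h by (intro continuous_intros) auto
  have \<kappa>01: "0 \<le> \<kappa> y" "\<kappa> y \<le> 1" for y by (auto simp: \<kappa>_def)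
  have \<kappa>_lip: "\<bar>\<kappa> y - \<kappa> z\<bar> \<le> norm (y - z) / h" for y z
  proof -
    have "\<bar>\<kappa> y - \<kappa> z\<bar> \<le> \<bar>?D y / h - ?D z / h\<bar>"
      unfolding \<kappa>_def by (auto simp: max_def min_def abs_if)
    also have "\<dots> = \<bar>?D y - ?D z\<bar> / h" using h by (simp add: abs_divide diff_divide_distrib[symmetric])
    also have "\<dots> \<le> norm (y - z) / h"
      using infdist_triangle_abs[of y "- \<Omega>" z] h by (simp add: divide_right_mono dist_norm)
    finally show ?thesis .
  qed
  have D0: "?D y = 0" if "y \<notin> \<Omega>" for y using that by simp
  have \<kappa>_out: "\<kappa> y = 0" if "?D y \<le> h" for y
  proof -
    have "?D y / h \<le> 1" using that h by simp
    then show ?thesis by (simp add: \<kappa>_def)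
  qed
  have \<kappa>_1: "\<kappa> y = 1" if "2 * h \<le> ?D y" for y
    using that h by (simp add: \<kappa>_def pos_le_divide_eq min_absorb1)
  obtain a where a: "\<Omega> \<subseteq> cbox (- a) a" using bounded_subset_cbox_symmetric[OF \<Omega>(2)] by blast
  have \<rho>_cont: "continuous_on UNIV \<rho>" by (rule Ck_imp_continuous[OF smooth_Ck[OF \<rho>(1)]])
  define \<eta> where "\<eta> x = integral (cbox (- a) a) (\<lambda>t. \<kappa> t * \<rho> (x - t))" for x
  have \<eta>_smooth: "smooth \<eta>"
    unfolding smooth_def \<eta>_def by (intro allI Ck_convolution \<kappa>_cont smooth_Ck \<rho>)
  have meas: "(\<lambda>s. \<kappa> (x - s) * \<rho> s) \<in> borel_measurable borel" for x
    by (intro borel_measurable_continuous_onI continuous_intros \<rho>_cont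
        continuous_on_compose2[OF \<kappa>_cont]) auto
  have int: "integrable lborel (\<lambda>s. \<kappa> (x - s) * \<rho> s)" for x
  proof (rule Bochner_Integration.integrable_bound[OF \<rho>(4)])
    show "AE s in lborel. norm (\<kappa> (x - s) * \<rho> s) \<le> norm (\<rho> s)"
      using \<kappa>01 by (intro AE_I2) (simp add: abs_mult mult_left_le_one_le)
  qed (use meas in simp)
  have \<eta>_eq: "\<eta> x = (\<integral>s. \<kappa> (x - s) * \<rho> s \<partial>lborel)" for x
  proof -
    have "\<eta> x = (\<integral>t. \<kappa> t * \<rho> (x - t) \<partial>lborel)"
      unfolding \<eta>_def
    proof (rule continuous_supported_integral(2))
      show "continuous_on UNIV (\<lambda>t. \<kappa> t * \<rho> (x - t))"
        by (intro continuous_intros \<kappa>_cont continuous_on_compose2[OF \<rho>_cont]) auto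
      show "\<kappa> t * \<rho> (x - t) = 0" if "t \<notin> cbox (- a) a" for t
      proof -
          have "t \<notin> \<Omega>" using a that by auto
          then show ?thesis using \<kappa>_out[of t] D0[of t] h by simp
        qed
    qed
    also have "\<dots> = (\<integral>t. (\<lambda>s. \<kappa> (x - s) * \<rho> s) (x - t) \<partial>lborel)" by simp
    also have "\<dots> = (\<integral>s. \<kappa> (x - s) * \<rho> s \<partial>lborel)"
      by (rule lborel_integral_reflect[OF meas])
    finally show ?thesis .
  qed
  have near: "\<bar>?D x - ?D (x - s)\<bar> < h / 2" if "\<rho> s \<noteq> 0" for x s
    using infdist_triangle_abs[of x "- \<Omega>" "x - s"] \<rho>(3)[OF that] by (simp add: dist_norm)
  show thesis
  proof
    show "0 \<le> \<eta> x" for x unfolding \<eta>_eq by (intro Bochner_Integration.integral_nonneg mult_nonneg_nonneg \<kappa>01 \<rho>)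
    have "\<eta> x \<le> integral\<^sup>L lborel \<rho>" for x
      unfolding \<eta>_eq
      by (rule integral_mono[OF int \<rho>(4)]) (simp add: \<kappa>01 \<rho> mult_left_le_one_le)
    then show "\<eta> x \<le> 1" for x using \<rho>(5) by simp
    show "\<eta> x = 1" if "3 * h \<le> ?D x" for x
    proof -
      have "\<kappa> (x - s) * \<rho> s = \<rho> s" for s
      proof (cases "\<rho> s = 0")
        case False
        then have "2 * h \<le> ?D (x - s)" using near[of s x] that h by linarith
        then show ?thesis by (simp add: \<kappa>_1)
      qed simp
      then show ?thesis unfolding \<eta>_eq using \<rho>(5) by presburger
    qed
    show "norm (grad \<eta> x) \<le> 1 / h" for x
    proof (rule norm_grad_le_lipschitz[OF smooth_Ck[OF \<eta>_smooth]])
      fix y z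
      have "\<bar>\<eta> y - \<eta> z\<bar> = \<bar>\<integral>s. \<kappa> (y - s) * \<rho> s - \<kappa> (z - s) * \<rho> s \<partial>lborel\<bar>"
        unfolding \<eta>_eq by (subst Bochner_Integration.integral_diff[OF int int]) simp
      also have "\<dots> \<le> (\<integral>s. norm (y - z) / h * \<rho> s \<partial>lborel)"
      proof (rule order_trans[OF integral_abs_bound integral_mono])
        fix s
        have "\<bar>\<kappa> (y - s) * \<rho> s - \<kappa> (z - s) * \<rho> s\<bar> = \<bar>\<kappa> (y - s) - \<kappa> (z - s)\<bar> * \<rho> s"
          using \<rho>(2)[of s] by (simp add: left_diff_distrib[symmetric] abs_mult)
        also have "\<dots> \<le> norm (y - z) / h * \<rho> s"
          using \<kappa>_lip[of "y - s" "z - s"] \<rho>(2)[of s] by (intro mult_right_mono) auto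
        finally show "\<bar>\<kappa> (y - s) * \<rho> s - \<kappa> (z - s) * \<rho> s\<bar> \<le> norm (y - z) / h * \<rho> s" .
      qed (use int \<rho>(4) in auto)
      also have "\<dots> = 1 / h * norm (y - z)" using \<rho>(5) by simp
      finally show "\<bar>\<eta> y - \<eta> z\<bar> \<le> 1 / h * norm (y - z)" .
    qed
    show "\<eta> \<in> test_functions \<Omega>"
    proof -
      have zero: "\<kappa> (x - s) * \<rho> s = 0" if "?D x < h / 2" for x s
      proof (cases "\<rho> s = 0")
        case False
        then have "?D (x - s) \<le> h" using near[of s x] that h by linarith
        then show ?thesis by (simp add: \<kappa>_out)
      qed simp
      have "\<eta> x = 0" if "?D x < h / 2" for x
        unfolding \<eta>_eq zero[OF that] by (rule Bochner_Integration.integral_zero)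
      then have out: "\<eta> x = 0" if "x \<notin> {x. h / 2 \<le> ?D x}" for x using that by simp
      have cl: "closed {x. h / 2 \<le> ?D x}" by (intro closed_Collect_le continuous_intros)
      have sub: "{x. h / 2 \<le> ?D x} \<subseteq> \<Omega>" using D0 h by fastforce
      then have "compact {x. h / 2 \<le> ?D x}"
        using cl bounded_subset[OF \<Omega>(2)] by (simp add: compact_eq_bounded_closed)
      then show ?thesis by (rule test_functionI[OF \<eta>_smooth _ sub out])
    qed
  qed
qed

section \<open>Surface measure and the volume of swept sets\<close>

definition sweep :: "'a::euclidean_space \<Rightarrow> real \<Rightarrow> 'a set \<Rightarrow> 'a set" where
  "sweep e h A = (\<lambda>(y, s). y + s *\<^sub>R e) ` (A \<times> {0..h})"

lemma compact_sweep: "compact A \<Longrightarrow> compact (sweep e h A)"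
  unfolding sweep_def
  by (intro compact_continuous_image compact_Times compact_Icc)
    (auto simp: split_def intro!: continuous_intros)

lemma sweep_UN: "sweep e h (\<Union>i. A i) = (\<Union>i. sweep e h (A i))"
  by (auto simp: sweep_def)

lemma sweep_mono: "A \<subseteq> B \<Longrightarrow> sweep e h A \<subseteq> sweep e h B"
  by (auto simp: sweep_def)

text \<open>
  The sweep of \<open>C\<close> is covered by at most \<open>2 h / r\<close> balls of radius \<open>2 r\<close> centred along a segment, for
  every \<open>r\<close> between the diameter of \<open>C\<close> and \<open>h\<close>. Only in the limit is \<open>r\<close> the diameter itself, which
  may be zero: for points this gives \<open>0\<close> in dimension at least two and \<open>O(h)\<close> in dimension one,
  where \<open>0 ^ 0 = 1\<close>.
\<close>

lemma emeasure_sweep_le: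
  fixes C :: "'a::euclidean_space set"
  assumes C: "compact C" "C \<noteq> {}" and e: "norm e = 1" and dh: "diameter C < h"
  shows "emeasure lborel (sweep e h C) \<le>
    ennreal (2 * 2 ^ DIM('a) * unit_ball_vol (real DIM('a)) * h * diameter C ^ (DIM('a) - 1))"
proof -
  let ?n = "DIM('a)" and ?d = "diameter C"
  let ?K = "2 * 2 ^ ?n * unit_ball_vol (real ?n)"
  have d0: "0 \<le> ?d" by (intro diameter_ge_0 compact_imp_bounded C)
  have n: "?n = Suc (?n - 1)" using DIM_positive[where 'a='a] by simp
  obtain y0 where y0: "y0 \<in> C" using C by auto
  have bound: "emeasure lborel (sweep e h C) \<le> ennreal (?K * h * r ^ (?n - 1))"
    if r: "?d < r" "r < h" for r
  proof -
    have r0: "0 < r" using d0 r by simp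
    define m where "m = nat \<lfloor>h / r\<rfloor>"
    let ?B = "\<lambda>j. cball (y0 + (real j * r) *\<^sub>R e) (2 * r)"
    have "sweep e h C \<subseteq> (\<Union>j\<in>{..m}. ?B j)"
    proof
      fix x assume "x \<in> sweep e h C"
      then obtain y s where y: "y \<in> C" and s: "0 \<le> s" "s \<le> h" and x: "x = y + s *\<^sub>R e"
        by (auto simp: sweep_def)
      define j where "j = nat \<lfloor>s / r\<rfloor>"
      have "j \<le> m"
        unfolding j_def m_def using s r0 by (intro nat_mono floor_mono divide_right_mono) auto
      have "real j = of_int \<lfloor>s / r\<rfloor>" using s r0 by (simp add: j_def)
      then have "real j \<le> s / r" "s / r < real j + 1" by linarith+
      then have j: "real j * r \<le> s" "s < real j * r + r"
        using r0 by (simp_all add: field_simps)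
      have "norm (x - (y0 + (real j * r) *\<^sub>R e)) = norm ((y - y0) + (s - real j * r) *\<^sub>R e)"
        by (simp add: x algebra_simps)
      also have "\<dots> \<le> norm (y - y0) + \<bar>s - real j * r\<bar>"
        using norm_triangle_ineq[of "y - y0" "(s - real j * r) *\<^sub>R e"] e by simp
      also have "\<dots> \<le> r + r"
        using diameter_bounded_bound[OF compact_imp_bounded[OF C(1)] y y0] r j
        by (auto simp: dist_norm)
      finally have "x \<in> ?B j" by (simp add: dist_norm norm_minus_commute)
      then show "x \<in> (\<Union>j\<in>{..m}. ?B j)" using \<open>j \<le> m\<close> by blast
    qed
    then have "emeasure lborel (sweep e h C) \<le> emeasure lborel (\<Union>j\<in>{..m}. ?B j)"
      by (rule emeasure_mono) auto
    also have "\<dots> \<le> (\<Sum>j\<in>{..m}. emeasure lborel (?B j))"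
      by (rule emeasure_subadditive_finite) auto
    also have "\<dots> = ennreal (real (Suc m) * (unit_ball_vol (real ?n) * (2 * r) ^ ?n))"
      using r0 by (simp add: emeasure_cball ennreal_mult ennreal_of_nat_eq_real_of_nat)
    also have "\<dots> \<le> ennreal (?K * h * r ^ (?n - 1))"
    proof (rule ennreal_leI)
      have "real m \<le> h / r" using r r0 d0 by (simp add: m_def)
      moreover have "1 \<le> h / r" using r r0 by simp
      ultimately have "real (Suc m) \<le> 2 * (h / r)" by simp
      then have "real (Suc m) * (unit_ball_vol (real ?n) * (2 * r) ^ ?n) \<le>
          2 * (h / r) * (unit_ball_vol (real ?n) * (2 * r) ^ ?n)"
        using r0 by (intro mult_right_mono) auto
      also have "\<dots> = ?K * h * r ^ (?n - 1)"
        using power_minus_mult[of ?n r] r0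
        by (simp add: power_mult_distrib mult.commute[of r] flip: power_minus_mult[of ?n r])
      finally show "real (Suc m) * (unit_ball_vol (real ?n) * (2 * r) ^ ?n) \<le> ?K * h * r ^ (?n - 1)" .
    qed
    finally show ?thesis .
  qed
  show ?thesis
  proof (rule tendsto_lowerbound[where F="at_right ?d"])
    show "((\<lambda>r. ennreal (?K * h * r ^ (?n - 1))) \<longlongrightarrow> ennreal (?K * h * ?d ^ (?n - 1))) (at_right ?d)"
      by (intro tendsto_ennrealI tendsto_intros)
    show "\<forall>\<^sub>F r in at_right ?d. emeasure lborel (sweep e h C) \<le> ennreal (?K * h * r ^ (?n - 1))"
      unfolding eventually_at_right_field using dh bound by blast
  qed simp
qed

text \<open>
  Surface measure controls the volume of the region that a set sweeps out when it is translated over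
  a distance \<open>h\<close>: up to a dimensional factor, \<open>h\<close> times the Hausdorff gauge of each set of a fine
  cover bounds the volume of its sweep. The estimates for traces below rest on this property of
  surface measure.
\<close>

lemma emeasure_sweep_le_hausdorff:
  fixes A :: "'a::euclidean_space set"
  assumes e: "norm e = 1" and h: "0 < h" and S: "S \<in> sets borel" "S \<subseteq> sweep e h A"
  shows "emeasure lborel S \<le> ennreal (2 * 4 ^ DIM('a) * unit_ball_vol (real DIM('a)) /
    unit_ball_vol (real (DIM('a) - 1)) * h) * hausdorff_outer (DIM('a) - 1) A"
proof -
  let ?n = "DIM('a)"
  let ?K = "2 * 2 ^ ?n * unit_ball_vol (real ?n)"
  let ?c = "2 * 4 ^ ?n * unit_ball_vol (real ?n) / unit_ball_vol (real (?n - 1)) * h"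
  have w: "0 < unit_ball_vol (real ?n)" "0 < unit_ball_vol (real (?n - 1))" by simp_all
  obtain W where W: "unit_ball_vol (real (?n - 1)) = W" "0 < W" using w(2) by blast
  have c0: "0 < ?c" using h w by simp
  have le: "emeasure lborel S / ennreal ?c \<le> (\<Sum>i. hausdorff_gauge (?n - 1) (C i))"
    if C: "C \<in> fine_covers (h / 2) A" for C
  proof -
    \<comment> \<open>Closures have the same diameter, and their sweeps are compact, hence measurable.\<close>
    have bd: "bounded (C i)" "diameter (C i) < h" for i
    proof -
      have "bounded (C i) \<and> diameter (C i) \<le> h / 2" using C by (simp add: fine_covers_def)
      then show "bounded (C i)" "diameter (C i) < h" using h by auto
    qed
    have cpt: "compact (closure (C i))" for i using bd by (simp add: compact_closure)
    have "A \<subseteq> (\<Union>i. closure (C i))"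
    proof
      fix x assume "x \<in> A"
      then obtain i where "x \<in> C i" using C by (auto simp: fine_covers_def)
      then show "x \<in> (\<Union>i. closure (C i))" using closure_subset by blast
    qed
    then have "S \<subseteq> sweep e h (\<Union>i. closure (C i))"
      using S(2) sweep_mono by blast
    then have "emeasure lborel S \<le> emeasure lborel (\<Union>i. sweep e h (closure (C i)))"
    proof (intro emeasure_mono)
      show "(\<Union>i. sweep e h (closure (C i))) \<in> sets lborel"
        using cpt by (intro sets.countable_UN) (auto intro!: borel_compact compact_sweep)
    qed (simp add: sweep_UN)
    also have "\<dots> \<le> (\<Sum>i. emeasure lborel (sweep e h (closure (C i))))"
      using cpt by (intro emeasure_subadditive_countably)
        (auto intro!: borel_compact compact_sweep)
    also have "\<dots> \<le> (\<Sum>i. ennreal ?c * hausdorff_gauge (?n - 1) (C i))"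
    proof (intro suminf_le summableI)
      fix i
      show "emeasure lborel (sweep e h (closure (C i))) \<le> ennreal ?c * hausdorff_gauge (?n - 1) (C i)"
      proof (cases "C i = {}")
        case False
        have d: "diameter (closure (C i)) = diameter (C i)" "0 \<le> diameter (C i)"
          using bd by (auto intro: diameter_closure diameter_ge_0)
        have "emeasure lborel (sweep e h (closure (C i))) \<le> ennreal (?K * h * diameter (C i) ^ (?n - 1))"
          using emeasure_sweep_le[OF cpt _ e, of i h] False bd d by simp
        also have "?K * h * diameter (C i) ^ (?n - 1) \<le>
            ?c * (unit_ball_vol (real (?n - 1)) * (diameter (C i) / 2) ^ (?n - 1))"
        proof -
          have "?c * (unit_ball_vol (real (?n - 1)) * (diameter (C i) / 2) ^ (?n - 1)) =
            2 * 4 ^ ?n * unit_ball_vol (real ?n) * h * (diameter (C i) / 2) ^ (?n - 1)"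
            using W(2) unfolding W(1) by simp
          also have "\<dots> = 2 * (2 ^ ?n * 2 ^ ?n) * unit_ball_vol (real ?n) * h * diameter (C i) ^ (?n - 1) / 2 ^ (?n - 1)"
            by (simp add: power_divide flip: power_mult_distrib)
          also have "\<dots> = (?K * h * diameter (C i) ^ (?n - 1)) * (2 ^ ?n / 2 ^ (?n - 1))"
            by simp
          also have "\<dots> \<ge> (?K * h * diameter (C i) ^ (?n - 1)) * 1"
            using h d w by (intro mult_left_mono) (auto intro!: power_increasing)
          finally show ?thesis by simp
        qed
        also have "ennreal (?c * (unit_ball_vol (real (?n - 1)) * (diameter (C i) / 2) ^ (?n - 1))) =
            ennreal ?c * hausdorff_gauge (?n - 1) (C i)"
          using False c0 d w by (subst ennreal_mult) (auto simp: hausdorff_gauge_def)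
        finally show ?thesis by (simp add: ennreal_leI)
      qed (simp add: sweep_def)
    qed
    also have "\<dots> = ennreal ?c * (\<Sum>i. hausdorff_gauge (?n - 1) (C i))" by simp
    finally show ?thesis using c0 by (intro divide_le_posI_ennreal) auto
  qed
  have "emeasure lborel S / ennreal ?c \<le> hausdorff_content (?n - 1) (h / 2) A"
    unfolding hausdorff_content_def by (rule INF_greatest) (rule le)
  also have "\<dots> \<le> hausdorff_outer (?n - 1) A"
    using h by (intro hausdorff_content_le_outer) simp
  finally have "ennreal ?c * (emeasure lborel S / ennreal ?c) \<le> ennreal ?c * hausdorff_outer (?n - 1) A"
    by (rule mult_left_mono) simp
  moreover have "ennreal ?c * (emeasure lborel S / ennreal ?c) = emeasure lborel S"
    unfolding ennreal_times_divide using c0 by (intro ennreal_mult_divide_eq[of "ennreal ?c"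
        "emeasure lborel S", unfolded mult.commute[of "emeasure lborel S"]]) auto
  ultimately show ?thesis by simp
qed

section \<open>A Hardy inequality near a Lipschitz boundary\<close>

text \<open>
  In a Lipschitz chart with axis \<open>e\<close>, the coordinates of a point are its height over the graph of \<open>\<gamma>\<close>
  and its foot, the point of the graph below it; inside the chart the domain is the set of positive
  height. A layer consists of the points of height less than \<open>h\<close> over a piece \<open>A\<close> of the graph.
\<close>

definition height :: "'a::euclidean_space \<Rightarrow> ('a \<Rightarrow> real) \<Rightarrow> 'a \<Rightarrow> real" where
  "height e \<gamma> x = x \<bullet> e - \<gamma> (x - (x \<bullet> e) *\<^sub>R e)"

definition foot :: "'a::euclidean_space \<Rightarrow> ('a \<Rightarrow> real) \<Rightarrow> 'a \<Rightarrow> 'a" where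
  "foot e \<gamma> x = x - height e \<gamma> x *\<^sub>R e"

definition layer :: "'a::euclidean_space \<Rightarrow> ('a \<Rightarrow> real) \<Rightarrow> 'a set \<Rightarrow> real \<Rightarrow> 'a set" where
  "layer e \<gamma> A h = {x. 0 < height e \<gamma> x \<and> height e \<gamma> x < h \<and> foot e \<gamma> x \<in> A}"

lemma inner_unit: "norm e = 1 \<Longrightarrow> e \<bullet> e = (1 :: real)"
  by (simp add: dot_square_norm)

lemma height_shift:
  assumes "norm e = 1"
  shows "height e \<gamma> (x + t *\<^sub>R e) = height e \<gamma> x + t"
proof -
  have "x + t *\<^sub>R e - ((x + t *\<^sub>R e) \<bullet> e) *\<^sub>R e = x - (x \<bullet> e) *\<^sub>R e"
    by (simp add: inner_add_left inner_unit[OF assms] algebra_simps)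
  then show ?thesis by (simp only: height_def) (simp add: inner_add_left inner_unit[OF assms])
qed

lemma foot_shift: "norm e = 1 \<Longrightarrow> foot e \<gamma> (x + t *\<^sub>R e) = foot e \<gamma> x"
  by (simp add: foot_def height_shift algebra_simps)

lemma foot_plus_height: "foot e \<gamma> x + height e \<gamma> x *\<^sub>R e = x"
  by (simp add: foot_def)

lemma height_foot: "norm e = 1 \<Longrightarrow> height e \<gamma> (foot e \<gamma> x) = 0"
  using height_shift[of e \<gamma> x "- height e \<gamma> x"] by (simp add: foot_def)

text \<open>
  The factor \<open>2\<close> is a crude bound for the norm of the projection along \<open>e\<close>.
\<close>

lemma height_lipschitz:
  assumes e: "norm e = 1" and L: "L-lipschitz_on {y. y \<bullet> e = 0} \<gamma>"
  shows "\<bar>height e \<gamma> x - height e \<gamma> y\<bar> \<le> (1 + 2 * L) * norm (x - y)"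
proof -
  let ?p = "\<lambda>x. x - (x \<bullet> e) *\<^sub>R e"
  have L0: "0 \<le> L" using L by (rule lipschitz_on_nonneg)
  have ip: "\<bar>(x - y) \<bullet> e\<bar> \<le> norm (x - y)"
    using Cauchy_Schwarz_ineq2[of "x - y" e] e by simp
  have p: "?p z \<in> {y. y \<bullet> e = 0}" for z by (simp add: inner_diff_left inner_unit[OF e])
  have "norm (?p x - ?p y) = norm ((x - y) - ((x - y) \<bullet> e) *\<^sub>R e)"
    by (simp add: algebra_simps inner_diff_left)
  also have "\<dots> \<le> norm (x - y) + \<bar>(x - y) \<bullet> e\<bar>"
    using norm_triangle_ineq4[of "x - y" "((x - y) \<bullet> e) *\<^sub>R e"] e by simp
  finally have "norm (?p x - ?p y) \<le> 2 * norm (x - y)" using ip by simp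
  then have "\<bar>\<gamma> (?p x) - \<gamma> (?p y)\<bar> \<le> L * (2 * norm (x - y))"
    using lipschitz_onD[OF L p[of x] p[of y]] mult_left_mono[OF _ L0, of "norm (?p x - ?p y)" "2 * norm (x - y)"]
    by (simp add: dist_norm)
  moreover have "height e \<gamma> x - height e \<gamma> y = (x - y) \<bullet> e - (\<gamma> (?p x) - \<gamma> (?p y))"
    by (simp add: height_def inner_diff_left)
  ultimately have "\<bar>height e \<gamma> x - height e \<gamma> y\<bar> \<le> norm (x - y) + L * (2 * norm (x - y))"
    using ip by linarith
  then show ?thesis by (simp add: algebra_simps)
qed

lemma continuous_height:
  assumes "norm e = 1" "L-lipschitz_on {y. y \<bullet> e = 0} \<gamma>"
  shows "continuous_on S (height e \<gamma>)"
proof -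
  have "0 \<le> L" using assms(2) by (rule lipschitz_on_nonneg)
  then have "(1 + 2 * L)-lipschitz_on S (height e \<gamma>)"
    using height_lipschitz[OF assms] by (intro lipschitz_onI) (auto simp: dist_norm)
  then show ?thesis by (rule lipschitz_on_continuous_on)
qed

lemma continuous_foot:
  assumes "norm e = 1" "L-lipschitz_on {y. y \<bullet> e = 0} \<gamma>"
  shows "continuous_on S (foot e \<gamma>)"
  unfolding foot_def by (intro continuous_intros continuous_height[OF assms])

lemma foot_layer_subset_sweep: "layer e \<gamma> A h \<inter> foot e \<gamma> -` B \<subseteq> sweep e h B"
proof
  fix x assume "x \<in> layer e \<gamma> A h \<inter> foot e \<gamma> -` B"
  then show "x \<in> sweep e h B"
    unfolding sweep_def layer_def
    by (intro image_eqI[of _ _ "(foot e \<gamma> x, height e \<gamma> x)"]) (auto simp: foot_plus_height)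
qed

lemma layer_borel:
  assumes "norm e = 1" "L-lipschitz_on {y. y \<bullet> e = 0} \<gamma>" and A: "A \<in> sets borel"
  shows "layer e \<gamma> A h \<in> sets borel"
proof -
  have [measurable]: "height e \<gamma> \<in> borel_measurable borel" "foot e \<gamma> \<in> borel_measurable borel"
    by (intro borel_measurable_continuous_onI continuous_height[OF assms(1,2)]
        continuous_foot[OF assms(1,2)])+
  have "foot e \<gamma> -` A \<in> sets borel"
    using measurable_sets[OF \<open>foot e \<gamma> \<in> borel_measurable borel\<close> A] by simp
  moreover have "{x. 0 < height e \<gamma> x} \<in> sets borel" "{x. height e \<gamma> x < h} \<in> sets borel"
    by measurable
  ultimately have "{x. 0 < height e \<gamma> x} \<inter> {x. height e \<gamma> x < h} \<inter> foot e \<gamma> -` A \<in> sets borel"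
    by blast
  moreover have "layer e \<gamma> A h = {x. 0 < height e \<gamma> x} \<inter> {x. height e \<gamma> x < h} \<inter> foot e \<gamma> -` A"
    by (auto simp: layer_def)
  ultimately show ?thesis by simp
qed

text \<open>
  The dimensional factor of \<open>emeasure_sweep_le_hausdorff\<close>.
\<close>

definition sweep_const :: "'a::euclidean_space itself \<Rightarrow> real" where
  "sweep_const _ = 2 * 4 ^ DIM('a) * unit_ball_vol (real DIM('a)) / unit_ball_vol (real (DIM('a) - 1))"

lemma sweep_const_pos: "0 < sweep_const TYPE('a::euclidean_space)"
  by (simp add: sweep_const_def)

lemma space_surface_measure: "space (surface_measure \<Omega>) = frontier \<Omega>"
  by (simp add: surface_measure_def space_restrict_space)

lemma emeasure_surface_measure:
  fixes \<Omega> :: "'a::euclidean_space set"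
  assumes "A \<in> sets (surface_measure \<Omega>)"
  shows "A \<in> sets borel" "A \<subseteq> frontier \<Omega>" "emeasure (surface_measure \<Omega>) A = hausdorff_outer (DIM('a) - 1) A"
proof -
  have "frontier \<Omega> \<in> sets borel" by simp
  then show b: "A \<in> sets borel" "A \<subseteq> frontier \<Omega>"
    using assms by (auto simp: surface_measure_def sets_restrict_space)
  then show "emeasure (surface_measure \<Omega>) A = hausdorff_outer (DIM('a) - 1) A"
    by (simp add: surface_measure_def emeasure_restrict_space emeasure_hausdorff_measure)
qed

lemma sets_surface_measure: "sets (surface_measure \<Omega>) = sets (restrict_space borel (frontier \<Omega>))"
  unfolding surface_measure_def by (rule sets_restrict_space_cong) simp

lemma borel_measurable_surface_measure:
  assumes "F \<in> borel_measurable borel"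
  shows "F \<in> borel_measurable (surface_measure \<Omega>)"
  using measurable_restrict_space1[OF assms, of "frontier \<Omega>"]
    measurable_cong_sets[OF sets_surface_measure refl] by blast

text \<open>
  The points of a layer whose feet lie in \<open>B\<close> belong to the sweep of \<open>B\<close>. Hence the push-forward of
  volume under the foot map is dominated, set by set, by a multiple of surface measure.
\<close>

lemma nn_integral_foot_le:
  fixes \<Omega> :: "'a::euclidean_space set" and F :: "'a \<Rightarrow> ennreal"
  assumes e: "norm e = 1" and L: "L-lipschitz_on {y. y \<bullet> e = 0} \<gamma>" and h: "0 < h"
    and A: "A \<in> sets borel" "A \<subseteq> frontier \<Omega>" and F: "F \<in> borel_measurable borel"
  shows "(\<integral>\<^sup>+x. F (foot e \<gamma> x) * indicator (layer e \<gamma> A h) x \<partial>lborel) \<le>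
    ennreal (sweep_const TYPE('a) * h) * (\<integral>\<^sup>+x. F x \<partial>surface_measure \<Omega>)"
proof -
  let ?T = "layer e \<gamma> A h" and ?S = "surface_measure \<Omega>"
  have T: "?T \<in> sets borel" by (rule layer_borel[OF e L A(1)])
  have foot_meas: "foot e \<gamma> \<in> borel_measurable borel"
    by (intro borel_measurable_continuous_onI continuous_foot[OF e L])
  have space: "space (restrict_space lborel ?T) = ?T" by (simp add: space_restrict_space)
  have "foot e \<gamma> \<in> restrict_space lborel ?T \<rightarrow>\<^sub>M restrict_space borel (frontier \<Omega>)"
  proof (rule measurable_restrict_space2)
    show "foot e \<gamma> \<in> space (restrict_space lborel ?T) \<rightarrow> frontier \<Omega>"
      using A(2) unfolding space by (auto simp: layer_def)
    show "foot e \<gamma> \<in> restrict_space lborel ?T \<rightarrow>\<^sub>M borel"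
      using foot_meas by (intro measurable_restrict_space1) simp
  qed
  then have meas: "foot e \<gamma> \<in> restrict_space lborel ?T \<rightarrow>\<^sub>M ?S"
    using measurable_cong_sets[OF refl sets_surface_measure] by blast
  let ?N = "distr (restrict_space lborel ?T) ?S (foot e \<gamma>)"
  let ?M = "scale_measure (ennreal (sweep_const TYPE('a) * h)) ?S"
  have FS: "F \<in> borel_measurable ?S" by (rule borel_measurable_surface_measure[OF F])
  have "?N \<le> ?M"
  proof -
    have "emeasure ?N \<le> emeasure ?M"
    proof (rule le_funI)
    fix B
    show "emeasure ?N B \<le> emeasure ?M B"
    proof (cases "B \<in> sets ?S")
      case True
      have "emeasure ?N B = emeasure (restrict_space lborel ?T) (foot e \<gamma> -` B \<inter> ?T)"
        using emeasure_distr[OF meas True] unfolding space .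
      also have "\<dots> = emeasure lborel (?T \<inter> foot e \<gamma> -` B)"
        using T by (subst emeasure_restrict_space) (auto simp: Int_commute)
      also have "\<dots> \<le> ennreal (sweep_const TYPE('a) * h) * hausdorff_outer (DIM('a) - 1) B"
        unfolding sweep_const_def
      proof (rule emeasure_sweep_le_hausdorff[OF e h _ foot_layer_subset_sweep])
        show "?T \<inter> foot e \<gamma> -` B \<in> sets borel"
          using T measurable_sets[OF foot_meas emeasure_surface_measure(1)[OF True]]
          by (intro sets.Int) auto
      qed
      also have "\<dots> = emeasure ?M B" by (simp add: emeasure_surface_measure(3)[OF True])
      finally show ?thesis .
    qed (simp add: emeasure_notin_sets)
    qed
    then show ?thesis by (simp add: le_measure_iff space_scale_measure)
  qed
  then have "(\<integral>\<^sup>+x. F x \<partial>?N) \<le> (\<integral>\<^sup>+x. F x \<partial>?M)"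
    by (intro nn_integral_mono_measure) simp_all
  moreover have "(\<integral>\<^sup>+x. F x \<partial>?N) = (\<integral>\<^sup>+x. F (foot e \<gamma> x) * indicator ?T x \<partial>lborel)"
    using T FS by (subst nn_integral_distr[OF meas]) (simp_all add: nn_integral_restrict_space)
  ultimately show ?thesis by (simp add: nn_integral_scale_measure[OF FS])
qed

text \<open>
  Jensen's inequality, from the variance of \<open>g\<close> around its mean \<open>m\<close>.
\<close>

lemma square_integral_le:
  fixes g :: "real \<Rightarrow> real"
  assumes s: "0 < s" and g: "continuous_on {0..s} g"
  shows "(integral {0..s} g)\<^sup>2 \<le> s * integral {0..s} (\<lambda>t. (g t)\<^sup>2)"
proof -
  define m where "m = integral {0..s} g / s"
  have i: "g integrable_on {0..s}" "(\<lambda>t. (g t)\<^sup>2) integrable_on {0..s}"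
    by (intro integrable_continuous_real continuous_intros g)+
  have hi: "((\<lambda>t. (g t)\<^sup>2 - 2 * m * g t + m\<^sup>2) has_integral
     (integral {0..s} (\<lambda>t. (g t)\<^sup>2) - 2 * m * integral {0..s} g + m\<^sup>2 * s)) {0..s}"
    using s i has_integral_const_real[of "m\<^sup>2" 0 s]
    by (intro has_integral_add has_integral_diff has_integral_mult_right integrable_integral)
      (simp_all add: mult.commute)
  have sq: "(g t)\<^sup>2 - 2 * m * g t + m\<^sup>2 = (g t - m)\<^sup>2" for t
    by (simp add: power2_diff algebra_simps)
  have "0 \<le> integral {0..s} (\<lambda>t. (g t)\<^sup>2) - 2 * m * integral {0..s} g + m\<^sup>2 * s"
    by (rule has_integral_nonneg[OF hi]) (simp add: sq)
  then have "0 \<le> integral {0..s} (\<lambda>t. (g t)\<^sup>2) - (integral {0..s} g)\<^sup>2 / s"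
    using s by (simp add: m_def power2_eq_square field_simps)
  then show ?thesis using s by (simp add: field_simps)
qed

lemma C1_square_increment_le:
  fixes \<phi> :: "'a::euclidean_space \<Rightarrow> real"
  assumes \<phi>: "Ck (Suc 0) \<phi>" and e: "norm e = 1" and s: "0 < s"
  shows "ennreal ((\<phi> x - \<phi> (x - s *\<^sub>R e))\<^sup>2) \<le>
    ennreal s * (\<integral>\<^sup>+t. ennreal ((norm (grad \<phi> (x - t *\<^sub>R e)))\<^sup>2) * indicator {0..s} t \<partial>lborel)"
proof -
  let ?g = "\<lambda>t. grad \<phi> (x - t *\<^sub>R e) \<bullet> (- e)" and ?G = "\<lambda>t. (norm (grad \<phi> (x - t *\<^sub>R e)))\<^sup>2"
  have cg: "continuous_on S (\<lambda>t. grad \<phi> (x - t *\<^sub>R e))" for S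
    by (rule continuous_on_compose2[OF continuous_grad[OF \<phi>, of UNIV]]) (auto intro!: continuous_intros)
  have "(?g has_integral \<phi> (x - s *\<^sub>R e) - \<phi> (x - 0 *\<^sub>R e)) {0..s}"
  proof (rule fundamental_theorem_of_calculus)
    fix t
    have "((\<lambda>t. \<phi> (x - t *\<^sub>R e)) has_derivative (\<lambda>r. grad \<phi> (x - t *\<^sub>R e) \<bullet> (- (r *\<^sub>R e)))) (at t within {0..s})"
      by (rule has_derivative_compose[OF _ has_derivative_grad[OF \<phi>]])
        (auto intro!: derivative_eq_intros)
    then show "((\<lambda>t. \<phi> (x - t *\<^sub>R e)) has_vector_derivative ?g t) (at t within {0..s})"
      by (simp add: has_vector_derivative_def)
  qed (use s in simp)
  from integral_unique[OF this, symmetric]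
  have eq: "\<phi> (x - s *\<^sub>R e) - \<phi> x = integral {0..s} ?g" by (simp only: scaleR_zero_left diff_zero)
  have "(\<phi> x - \<phi> (x - s *\<^sub>R e))\<^sup>2 = (integral {0..s} ?g)\<^sup>2"
    by (subst power2_commute) (simp only: eq)
  also have "\<dots> \<le> s * integral {0..s} (\<lambda>t. (?g t)\<^sup>2)"
    by (intro square_integral_le s continuous_intros cg)
  also have "\<dots> \<le> s * integral {0..s} ?G"
  proof (intro mult_left_mono integral_le integrable_continuous_real continuous_intros cg)
    fix t
    have "\<bar>?g t\<bar> \<le> norm (grad \<phi> (x - t *\<^sub>R e))"
      using Cauchy_Schwarz_ineq2[of "grad \<phi> (x - t *\<^sub>R e)" "- e"] e by simp
    then show "(?g t)\<^sup>2 \<le> ?G t" using abs_le_square_iff by fastforce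
  qed (use s in auto)
  finally have le: "(\<phi> x - \<phi> (x - s *\<^sub>R e))\<^sup>2 \<le> s * integral {0..s} ?G" .
  have I0: "0 \<le> integral {0..s} ?G"
    by (intro Henstock_Kurzweil_Integration.integral_nonneg integrable_continuous_real continuous_intros cg) auto
  have "(?G has_integral integral {0..s} ?G) {0..s}"
    by (intro integrable_integral integrable_continuous_real continuous_intros cg)
  then have "((\<lambda>t. if t \<in> {0..s} then ?G t else 0) has_integral integral {0..s} ?G) UNIV"
    by (subst has_integral_restrict_UNIV)
  moreover have "(\<lambda>t. if t \<in> {0..s} then ?G t else 0) = (\<lambda>t. ?G t * indicator {0..s} t)"
    by (auto simp: indicator_def)
  ultimately have "((\<lambda>t. ?G t * indicator {0..s} t) has_integral integral {0..s} ?G) UNIV"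
    by simp
  then have "(\<integral>\<^sup>+t. ennreal (?G t * indicator {0..s} t) \<partial>lborel) = ennreal (integral {0..s} ?G)"
    by (intro nn_integral_has_integral_lborel borel_measurable_times borel_measurable_indicator
        borel_measurable_continuous_onI continuous_intros cg) auto
  moreover have "ennreal (?G t * indicator {0..s} t) = ennreal (?G t) * indicator {0..s} t" for t
    by (simp add: indicator_def)
  ultimately have "(\<integral>\<^sup>+t. ennreal (?G t) * indicator {0..s} t \<partial>lborel) = ennreal (integral {0..s} ?G)"
    by simp
  then show ?thesis
    using le s I0 by (simp add: ennreal_mult[symmetric] ennreal_leI)
qed

lemma nn_integral_lborel_translate:
  fixes f :: "'a::euclidean_space \<Rightarrow> ennreal"
  assumes "f \<in> borel_measurable borel"
  shows "(\<integral>\<^sup>+x. f (x - c) \<partial>lborel) = (\<integral>\<^sup>+x. f x \<partial>lborel)"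
proof -
  have "(\<integral>\<^sup>+x. f x \<partial>lborel) = (\<integral>\<^sup>+x. f x \<partial>distr lborel borel ((+) (- c)))"
    by (simp add: lborel_distr_plus)
  also have "\<dots> = (\<integral>\<^sup>+x. f (- c + x) \<partial>lborel)"
    using assms by (intro nn_integral_distr) auto
  finally show ?thesis by simp
qed

text \<open>
  On each segment from a point \<open>x\<close> of the layer to its foot, \<open>\<phi>\<close> differs from its value at the foot by
  the integral of a directional derivative. The segment stays in the layer, so after exchanging the
  integrals, translation invariance bounds the contribution of each parameter \<open>t\<close> by the Dirichlet
  energy of the layer. One factor \<open>h\<close> comes from Jensen's inequality, the other from the range of \<open>t\<close>.
\<close>

lemma layer_estimate:
  fixes \<Omega> :: "'a::euclidean_space set" and \<phi> :: "'a \<Rightarrow> real"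
  assumes e: "norm e = 1" and L: "L-lipschitz_on {y. y \<bullet> e = 0} \<gamma>" and h: "0 < h"
    and A: "A \<in> sets borel" "A \<subseteq> frontier \<Omega>" and \<phi>: "Ck (Suc 0) \<phi>"
  shows "(\<integral>\<^sup>+x. ennreal ((\<phi> x)\<^sup>2) * indicator (layer e \<gamma> A h) x \<partial>lborel) \<le>
    ennreal (2 * sweep_const TYPE('a) * h) * (\<integral>\<^sup>+x. ennreal ((\<phi> x)\<^sup>2) \<partial>surface_measure \<Omega>) +
    ennreal (2 * h\<^sup>2) * (\<integral>\<^sup>+x. ennreal ((norm (grad \<phi> x))\<^sup>2) * indicator (layer e \<gamma> A h) x \<partial>lborel)"
proof -
  let ?T = "layer e \<gamma> A h"
  let ?G = "\<lambda>x. ennreal ((norm (grad \<phi> x))\<^sup>2) * indicator ?T x"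
  have T[measurable]: "?T \<in> sets borel" by (rule layer_borel[OF e L A(1)])
  have [measurable]: "\<phi> \<in> borel_measurable borel" "grad \<phi> \<in> borel_measurable borel"
    "foot e \<gamma> \<in> borel_measurable borel"
    by (intro borel_measurable_continuous_onI continuous_foot[OF e L] Ck_imp_continuous[OF \<phi>]
        continuous_grad[OF \<phi>])+
  have G[measurable]: "?G \<in> borel_measurable borel" by measurable
  let ?H = "\<lambda>x t. ?G (x - t *\<^sub>R e) * indicator {0..h} t"
  have pt: "ennreal ((\<phi> x)\<^sup>2) * indicator ?T x \<le>
      ennreal (2 * (\<phi> (foot e \<gamma> x))\<^sup>2) * indicator ?T x + ennreal (2 * h) * (\<integral>\<^sup>+t. ?H x t \<partial>lborel)" for x
  proof (cases "x \<in> ?T")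
    case True
    define s where "s = height e \<gamma> x"
    have s: "0 < s" "s < h" using True by (auto simp: s_def layer_def)
    have foot: "foot e \<gamma> x = x - s *\<^sub>R e" by (simp add: s_def foot_def)
    have inT: "x - t *\<^sub>R e \<in> ?T" if "t \<in> {0..s}" "t \<noteq> s" for t
      using True that height_shift[OF e, of \<gamma> x "- t"] foot_shift[OF e, of \<gamma> x "- t"]
      by (auto simp: layer_def s_def)
    have "(\<integral>\<^sup>+t. ennreal ((norm (grad \<phi> (x - t *\<^sub>R e)))\<^sup>2) * indicator {0..s} t \<partial>lborel)
        \<le> (\<integral>\<^sup>+t. ?H x t \<partial>lborel)"
    proof (rule nn_integral_mono_AE)
      show "AE t in lborel. ennreal ((norm (grad \<phi> (x - t *\<^sub>R e)))\<^sup>2) * indicator {0..s} t \<le> ?H x t"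
        using AE_lborel_singleton[of s]
        by eventually_elim (use s inT in \<open>auto simp: indicator_def\<close>)
    qed
    then have "ennreal ((\<phi> x - \<phi> (x - s *\<^sub>R e))\<^sup>2) \<le> ennreal h * (\<integral>\<^sup>+t. ?H x t \<partial>lborel)"
      using s by (intro order_trans[OF C1_square_increment_le[OF \<phi> e s(1)]] mult_mono ennreal_leI) auto
    then have "ennreal 2 * ennreal ((\<phi> x - \<phi> (x - s *\<^sub>R e))\<^sup>2) \<le> ennreal 2 * (ennreal h * (\<integral>\<^sup>+t. ?H x t \<partial>lborel))"
      by (rule mult_left_mono) simp
    also have "\<dots> = ennreal (2 * h) * (\<integral>\<^sup>+t. ?H x t \<partial>lborel)"
      using s by (simp add: ennreal_mult mult.assoc)
    finally have 1: "ennreal (2 * (\<phi> x - \<phi> (x - s *\<^sub>R e))\<^sup>2) \<le> ennreal (2 * h) * (\<integral>\<^sup>+t. ?H x t \<partial>lborel)"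
      by (simp add: ennreal_mult)
    have "(\<phi> x)\<^sup>2 \<le> 2 * (\<phi> (foot e \<gamma> x))\<^sup>2 + 2 * (\<phi> x - \<phi> (x - s *\<^sub>R e))\<^sup>2"
      unfolding foot using sum_squares_bound[of "\<phi> (x - s *\<^sub>R e)" "\<phi> x - \<phi> (x - s *\<^sub>R e)"]
      by (simp add: power2_eq_square algebra_simps)
    then have "ennreal ((\<phi> x)\<^sup>2) \<le> ennreal (2 * (\<phi> (foot e \<gamma> x))\<^sup>2 + 2 * (\<phi> x - \<phi> (x - s *\<^sub>R e))\<^sup>2)"
      by (rule ennreal_leI)
    also have "\<dots> = ennreal (2 * (\<phi> (foot e \<gamma> x))\<^sup>2) + ennreal (2 * (\<phi> x - \<phi> (x - s *\<^sub>R e))\<^sup>2)"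
      by (rule ennreal_plus) auto
    finally have "ennreal ((\<phi> x)\<^sup>2) \<le> ennreal (2 * (\<phi> (foot e \<gamma> x))\<^sup>2) + ennreal (2 * (\<phi> x - \<phi> (x - s *\<^sub>R e))\<^sup>2)" .
    then show ?thesis using True 1 by (simp add: add_left_mono order_trans)
  qed simp
  have "(\<integral>\<^sup>+x. ennreal ((\<phi> x)\<^sup>2) * indicator ?T x \<partial>lborel) \<le>
     (\<integral>\<^sup>+x. ennreal (2 * (\<phi> (foot e \<gamma> x))\<^sup>2) * indicator ?T x + ennreal (2 * h) * (\<integral>\<^sup>+t. ?H x t \<partial>lborel) \<partial>lborel)"
    by (intro nn_integral_mono pt)
  also have "\<dots> = (\<integral>\<^sup>+x. ennreal (2 * (\<phi> (foot e \<gamma> x))\<^sup>2) * indicator ?T x \<partial>lborel) +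
      ennreal (2 * h) * (\<integral>\<^sup>+x. \<integral>\<^sup>+t. ?H x t \<partial>lborel \<partial>lborel)"
    by (subst nn_integral_add) (auto simp: nn_integral_cmult)
  also have "(\<integral>\<^sup>+x. \<integral>\<^sup>+t. ?H x t \<partial>lborel \<partial>lborel) = (\<integral>\<^sup>+t. \<integral>\<^sup>+x. ?H x t \<partial>lborel \<partial>lborel)"
    by (rule lborel_pair.Fubini'[symmetric]) measurable
  also have "\<dots> = (\<integral>\<^sup>+t. (\<integral>\<^sup>+x. ?G x \<partial>lborel) * indicator {0..h} t \<partial>lborel)"
    by (intro nn_integral_cong) (simp add: nn_integral_multc nn_integral_lborel_translate[OF G])
  also have "\<dots> = (\<integral>\<^sup>+x. ?G x \<partial>lborel) * ennreal h"
    using h by (simp add: nn_integral_cmult)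
  also have "(\<integral>\<^sup>+x. ennreal (2 * (\<phi> (foot e \<gamma> x))\<^sup>2) * indicator ?T x \<partial>lborel) \<le>
      ennreal (sweep_const TYPE('a) * h) * (\<integral>\<^sup>+x. ennreal (2 * (\<phi> x)\<^sup>2) \<partial>surface_measure \<Omega>)"
    by (rule nn_integral_foot_le[OF e L h A]) measurable
  also have "(\<integral>\<^sup>+x. ennreal (2 * (\<phi> x)\<^sup>2) \<partial>surface_measure \<Omega>) =
      ennreal 2 * (\<integral>\<^sup>+x. ennreal ((\<phi> x)\<^sup>2) \<partial>surface_measure \<Omega>)"
    by (subst nn_integral_cmult[symmetric])
      (auto simp: ennreal_mult intro!: borel_measurable_surface_measure)
  finally show ?thesis
    using h sweep_const_pos[where 'a='a]
    by (simp add: ennreal_mult power2_eq_square mult_ac)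
qed

lemma chart_frontier_height:
  assumes \<Omega>: "open \<Omega>" and e: "norm e = 1" and L: "L-lipschitz_on {y. y \<bullet> e = 0} \<gamma>"
    and chart: "\<Omega> \<inter> ball x0 r = {y \<in> ball x0 r. 0 < height e \<gamma> y}"
    and y: "y \<in> ball x0 r"
  shows "y \<in> frontier \<Omega> \<longleftrightarrow> height e \<gamma> y = 0"
proof
  assume "y \<in> frontier \<Omega>"
  then have cl: "y \<in> closure \<Omega>" and "y \<notin> \<Omega>" using \<Omega> by (auto simp: frontier_def interior_open)
  then have le: "\<not> 0 < height e \<gamma> y" using chart y by blast
  have op: "open (ball x0 r \<inter> {y. height e \<gamma> y < 0})"
    by (intro open_Int open_ball open_Collect_less continuous_height[OF e L] continuous_intros)
  have "\<not> height e \<gamma> y < 0"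
  proof
    assume "height e \<gamma> y < 0"
    then have "y \<in> ball x0 r \<inter> {y. height e \<gamma> y < 0}" using y by simp
    then obtain z where "z \<in> \<Omega>" "z \<in> ball x0 r" "height e \<gamma> z < 0"
      using cl op by (auto simp: closure_iff_nhds_not_empty dest!: spec[of _ "ball x0 r \<inter> {y. height e \<gamma> y < 0}"])
    then show False using chart by force
  qed
  with le show "height e \<gamma> y = 0" by simp
next
  assume h0: "height e \<gamma> y = 0"
  then have out: "y \<notin> \<Omega>" using chart y by force
  have "y \<in> closure \<Omega>"
    unfolding closure_approachable
  proof (intro allI impI)
    fix \<delta> :: real assume \<delta>: "0 < \<delta>"
    obtain \<rho> where \<rho>: "\<rho> > 0" "ball y \<rho> \<subseteq> ball x0 r" using y open_contains_ball by blast
    define t where "t = min \<delta> \<rho> / 2"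
    have t: "0 < t" "t < \<delta>" "t < \<rho>" using \<delta> \<rho> by (auto simp: t_def)
    have d: "dist (y + t *\<^sub>R e) y = t" "dist y (y + t *\<^sub>R e) = t"
      using e t by (auto simp: dist_norm)
    then have "y + t *\<^sub>R e \<in> ball y \<rho>" using t by simp
    then have "y + t *\<^sub>R e \<in> ball x0 r" using \<rho>(2) by blast
    moreover have "0 < height e \<gamma> (y + t *\<^sub>R e)" using h0 t by (simp add: height_shift[OF e])
    ultimately have "y + t *\<^sub>R e \<in> \<Omega>" using chart by blast
    then show "\<exists>z\<in>\<Omega>. dist z y < \<delta>" using d t by (intro bexI[of _ "y + t *\<^sub>R e"]) auto
  qed
  then show "y \<in> frontier \<Omega>" using out \<Omega> by (simp add: frontier_def interior_open)
qed

text \<open>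
  The segment from \<open>x\<close> to a nearest point of the complement has to cross the boundary.
\<close>

lemma nearest_frontier_point:
  fixes \<Omega> :: "'a::euclidean_space set"
  assumes \<Omega>: "open \<Omega>" "bounded \<Omega>" and x: "x \<in> \<Omega>"
  obtains y where "y \<in> frontier \<Omega>" "dist x y \<le> infdist x (- \<Omega>)"
proof -
  have ne: "- \<Omega> \<noteq> {}"
    using \<Omega>(2) not_bounded_UNIV by (metis Compl_empty_eq double_complement)
  obtain z where z: "z \<in> - \<Omega>" "infdist x (- \<Omega>) = dist x z"
    using infdist_attains_inf[of "- \<Omega>" x] \<Omega>(1) ne by (auto simp: closed_def)
  have "closed_segment x z \<inter> frontier \<Omega> \<noteq> {}"
    using x z by (intro connected_Int_frontier) auto
  then obtain y where y: "y \<in> closed_segment x z" "y \<in> frontier \<Omega>" by blast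
  then have "dist x y \<le> dist x z"
    by (metis dist_commute dist_in_closed_segment(1))
  then show thesis using that y z by simp
qed

definition collar :: "'a::euclidean_space set \<Rightarrow> real \<Rightarrow> 'a set" where
  "collar \<Omega> h = {x \<in> \<Omega>. infdist x (- \<Omega>) < h}"

text \<open>
  The right-hand side of the estimates below. A Hardy inequality has the weights \<open>A = O(h)\<close> and
  \<open>B = O(h\<^sup>2)\<close>; division by \<open>h\<^sup>2\<close>, the square of the gradient of a cutoff, turns them into
  \<open>O(1/h)\<close> and \<open>O(1)\<close>.
\<close>

definition collar_energy :: "'a::euclidean_space set \<Rightarrow> real \<Rightarrow> real \<Rightarrow> real \<Rightarrow> ('a \<Rightarrow> real) \<Rightarrow> ennreal" where
  "collar_energy \<Omega> A B r \<phi> =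
     ennreal A * (\<integral>\<^sup>+x. ennreal ((\<phi> x)\<^sup>2) \<partial>surface_measure \<Omega>) +
     ennreal B * (\<integral>\<^sup>+x. ennreal ((norm (grad \<phi> x))\<^sup>2) * indicator (collar \<Omega> r) x \<partial>lborel)"

lemma open_collar: "open \<Omega> \<Longrightarrow> open (collar \<Omega> h)"
proof -
  assume "open \<Omega>"
  moreover have "open {x. infdist x (- \<Omega>) < h}" by (intro open_Collect_less continuous_intros)
  moreover have "collar \<Omega> h = \<Omega> \<inter> {x. infdist x (- \<Omega>) < h}" by (auto simp: collar_def)
  ultimately show ?thesis by (simp add: open_Int)
qed

lemma borel_collar: "open \<Omega> \<Longrightarrow> collar \<Omega> h \<in> sets borel"
  by (intro borel_open open_collar)

lemma collar_mono: "h \<le> k \<Longrightarrow> collar \<Omega> h \<subseteq> collar \<Omega> k"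
  by (auto simp: collar_def)

text \<open>
  Near a boundary point, a layer over the graph is caught between a collar and a wider collar, so
  that the estimate for layers applies.
\<close>

lemma local_hardy:
  fixes \<Omega> :: "'a::euclidean_space set"
  assumes \<Omega>: "open \<Omega>" "bounded \<Omega>" and chart: "lipschitz_chart \<Omega> x0 e r \<gamma>"
  obtains \<Lambda> h0 where "1 \<le> \<Lambda>" "0 < h0"
    "\<And>h \<phi>. 0 < h \<Longrightarrow> h < h0 \<Longrightarrow> Ck (Suc 0) \<phi> \<Longrightarrow>
      (\<integral>\<^sup>+x. ennreal ((\<phi> x)\<^sup>2) * indicator (collar \<Omega> h \<inter> ball x0 (r / 4)) x \<partial>lborel) \<le>
        collar_energy \<Omega> (2 * sweep_const TYPE('a) * (\<Lambda> * h)) (2 * (\<Lambda> * h)\<^sup>2) (\<Lambda> * h) \<phi>"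
proof -
  obtain L where e: "norm e = 1" and r: "0 < r" and L: "L-lipschitz_on {y. y \<bullet> e = 0} \<gamma>"
    and ch: "\<Omega> \<inter> ball x0 r = {y \<in> ball x0 r. 0 < height e \<gamma> y}"
    using chart by (auto simp: lipschitz_chart_def height_def)
  have L0: "0 \<le> L" using L by (rule lipschitz_on_nonneg)
  let ?\<Lambda> = "1 + 2 * L"
  let ?A = "frontier \<Omega> \<inter> ball x0 (r / 2)"
  have A: "?A \<in> sets borel" "?A \<subseteq> frontier \<Omega>" by auto
  have small: "layer e \<gamma> ?A h \<subseteq> collar \<Omega> h" if h: "0 < h" "h \<le> r / 2" for h
  proof
    fix x assume x: "x \<in> layer e \<gamma> ?A h"
    then have foot: "foot e \<gamma> x \<in> frontier \<Omega>" "dist x0 (foot e \<gamma> x) < r / 2"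
      and ht: "0 < height e \<gamma> x" "height e \<gamma> x < h" by (auto simp: layer_def)
    have d: "dist x (foot e \<gamma> x) = height e \<gamma> x" using ht e by (simp add: foot_def dist_norm)
    have "x \<in> ball x0 r"
      using dist_triangle2[of x0 x "foot e \<gamma> x"] foot(2) d ht h by simp
    then have "x \<in> \<Omega>" using ch ht by blast
    moreover have "foot e \<gamma> x \<in> - \<Omega>"
      using foot(1) \<Omega>(1) by (simp add: frontier_def interior_open)
    then have "infdist x (- \<Omega>) < h" using infdist_le[of "foot e \<gamma> x" "- \<Omega>" x] d ht by simp
    ultimately show "x \<in> collar \<Omega> h" by (simp add: collar_def)
  qed
  have big: "collar \<Omega> h \<inter> ball x0 (r / 4) \<subseteq> layer e \<gamma> ?A (?\<Lambda> * h)" if h: "0 < h" "?\<Lambda> * h \<le> r / 4" for h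
  proof
    fix z assume z: "z \<in> collar \<Omega> h \<inter> ball x0 (r / 4)"
    then have zO: "z \<in> \<Omega>" "infdist z (- \<Omega>) < h" "dist x0 z < r / 4" by (auto simp: collar_def)
    obtain y where y: "y \<in> frontier \<Omega>" "dist z y \<le> infdist z (- \<Omega>)"
      using nearest_frontier_point[OF \<Omega> zO(1)] .
    have hle: "h \<le> ?\<Lambda> * h" using h(1) L0 by simp
    have "dist x0 y < r" using dist_triangle[of x0 y z] y(2) zO(2,3) h(2) hle r by linarith
    then have "y \<in> ball x0 r" by simp
    then have hy: "height e \<gamma> y = 0" using chart_frontier_height[OF \<Omega>(1) e L ch] y(1) by blast
    have "?\<Lambda> * norm (z - y) < ?\<Lambda> * h"
      using y(2) zO(2) L0 by (intro mult_strict_left_mono) (auto simp: dist_norm)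
    then have hz: "height e \<gamma> z < ?\<Lambda> * h"
      using height_lipschitz[OF e L, of z y] hy by simp
    have zr: "z \<in> ball x0 r" using zO r by simp
    then have pos: "0 < height e \<gamma> z" using ch zO(1) by blast
    have d: "dist z (foot e \<gamma> z) = height e \<gamma> z" using pos e by (simp add: foot_def dist_norm)
    have fb: "foot e \<gamma> z \<in> ball x0 (r / 2)"
      using dist_triangle[of x0 "foot e \<gamma> z" z] d hz zO(3) h by simp
    then have "foot e \<gamma> z \<in> ball x0 r" using r by simp
    then have "foot e \<gamma> z \<in> frontier \<Omega>"
      using chart_frontier_height[OF \<Omega>(1) e L ch] height_foot[OF e] by blast
    then show "z \<in> layer e \<gamma> ?A (?\<Lambda> * h)" using fb hz pos by (simp add: layer_def)
  qed
  show thesis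
  proof
    show "1 \<le> ?\<Lambda>" using L0 by simp
    show "0 < r / (4 * ?\<Lambda>)" using L0 r by simp
    fix h and \<phi> :: "'a \<Rightarrow> real" assume h: "0 < h" "h < r / (4 * ?\<Lambda>)" and \<phi>: "Ck (Suc 0) \<phi>"
    have h': "0 < ?\<Lambda> * h" "?\<Lambda> * h \<le> r / 4" using h L0 by (auto simp: pos_less_divide_eq mult_ac intro!: mult_pos_pos add_pos_nonneg)
    have "(\<integral>\<^sup>+x. ennreal ((\<phi> x)\<^sup>2) * indicator (collar \<Omega> h \<inter> ball x0 (r / 4)) x \<partial>lborel) \<le>
      (\<integral>\<^sup>+x. ennreal ((\<phi> x)\<^sup>2) * indicator (layer e \<gamma> ?A (?\<Lambda> * h)) x \<partial>lborel)"
      using big[OF h(1) h'(2)] by (intro nn_integral_mono mult_left_mono) (auto simp: indicator_def)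
    also have "\<dots> \<le> ennreal (2 * sweep_const TYPE('a) * (?\<Lambda> * h)) * (\<integral>\<^sup>+x. ennreal ((\<phi> x)\<^sup>2) \<partial>surface_measure \<Omega>) +
      ennreal (2 * (?\<Lambda> * h)\<^sup>2) *
        (\<integral>\<^sup>+x. ennreal ((norm (grad \<phi> x))\<^sup>2) * indicator (layer e \<gamma> ?A (?\<Lambda> * h)) x \<partial>lborel)"
      by (rule layer_estimate[OF e L h'(1) A \<phi>])
    also have "(\<integral>\<^sup>+x. ennreal ((norm (grad \<phi> x))\<^sup>2) * indicator (layer e \<gamma> ?A (?\<Lambda> * h)) x \<partial>lborel) \<le>
        (\<integral>\<^sup>+x. ennreal ((norm (grad \<phi> x))\<^sup>2) * indicator (collar \<Omega> (?\<Lambda> * h)) x \<partial>lborel)"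
      using small[OF h'(1)] h'(2) r by (intro nn_integral_mono mult_left_mono) (auto simp: indicator_def)
    finally show "(\<integral>\<^sup>+x. ennreal ((\<phi> x)\<^sup>2) * indicator (collar \<Omega> h \<inter> ball x0 (r / 4)) x \<partial>lborel) \<le>
        collar_energy \<Omega> (2 * sweep_const TYPE('a) * (?\<Lambda> * h)) (2 * (?\<Lambda> * h)\<^sup>2) (?\<Lambda> * h) \<phi>"
      by (simp add: collar_energy_def add_left_mono mult_left_mono)
  qed
qed

lemma collar_subset_nbhd:
  fixes \<Omega> :: "'a::euclidean_space set"
  assumes \<Omega>: "open \<Omega>" "bounded \<Omega>" and U: "open U" "frontier \<Omega> \<subseteq> U"
  obtains h where "0 < h" "collar \<Omega> h \<subseteq> U"
proof -
  have "compact (frontier \<Omega>)" using \<Omega>(2) by (rule compact_frontier_bounded)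
  then obtain h where h: "0 < h" "(\<Union>x\<in>frontier \<Omega>. ball x h) \<subseteq> U"
    using compact_subset_open_imp_ball_epsilon_subset[OF _ U] by blast
  have "collar \<Omega> h \<subseteq> U"
  proof
    fix z assume z: "z \<in> collar \<Omega> h"
    then obtain y where "y \<in> frontier \<Omega>" "dist z y \<le> infdist z (- \<Omega>)"
      using nearest_frontier_point[OF \<Omega>] by (auto simp: collar_def)
    then have "z \<in> ball y h" using z by (simp add: collar_def dist_commute)
    then show "z \<in> U" using h(2) \<open>y \<in> frontier \<Omega>\<close> by blast
  qed
  then show thesis using that h(1) by blast
qed

text \<open>
  The boundary is compact, so finitely many charts cover a whole collar, and the constants of the
  local estimates can be combined.
\<close>

lemma hardy_collar:
  fixes \<Omega> :: "'a::euclidean_space set"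
  assumes \<Omega>: "bounded_lipschitz_domain \<Omega>"
  obtains C \<Lambda> h0 where "0 < C" "1 \<le> \<Lambda>" "0 < h0"
    "\<And>h \<phi>. 0 < h \<Longrightarrow> h < h0 \<Longrightarrow> Ck (Suc 0) \<phi> \<Longrightarrow>
      (\<integral>\<^sup>+x. ennreal ((\<phi> x)\<^sup>2) * indicator (collar \<Omega> h) x \<partial>lborel) \<le>
        collar_energy \<Omega> (C * h) (C * h\<^sup>2) (\<Lambda> * h) \<phi>"
proof -
  have op: "open \<Omega>" and bd: "bounded \<Omega>" using \<Omega> by (auto simp: bounded_lipschitz_domain_def)
  let ?P = "\<lambda>x \<rho> \<Lambda> h0. 0 < \<rho> \<and> 1 \<le> \<Lambda> \<and> 0 < h0 \<and> (\<forall>h \<phi>. 0 < h \<longrightarrow> h < h0 \<longrightarrow> Ck (Suc 0) \<phi> \<longrightarrow>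
      (\<integral>\<^sup>+y. ennreal ((\<phi> y)\<^sup>2) * indicator (collar \<Omega> h \<inter> ball x \<rho>) y \<partial>lborel) \<le>
        collar_energy \<Omega> (2 * sweep_const TYPE('a) * (\<Lambda> * h)) (2 * (\<Lambda> * h)\<^sup>2) (\<Lambda> * h) \<phi>)"
  have "\<exists>\<rho> \<Lambda> h0. ?P x \<rho> \<Lambda> h0" if x: "x \<in> frontier \<Omega>" for x
  proof -
    obtain e r \<gamma> where c: "lipschitz_chart \<Omega> x e r \<gamma>"
      using \<Omega> x unfolding bounded_lipschitz_domain_def by blast
    show ?thesis
    proof (rule local_hardy[OF op bd c])
      fix \<Lambda> h0 assume pos: "1 \<le> \<Lambda>" "0 < h0" and *: "\<And>h \<phi>. 0 < h \<Longrightarrow> h < h0 \<Longrightarrow> Ck (Suc 0) \<phi> \<Longrightarrow>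
      (\<integral>\<^sup>+y. ennreal ((\<phi> y)\<^sup>2) * indicator (collar \<Omega> h \<inter> ball x (r / 4)) y \<partial>lborel) \<le>
        collar_energy \<Omega> (2 * sweep_const TYPE('a) * (\<Lambda> * h)) (2 * (\<Lambda> * h)\<^sup>2) (\<Lambda> * h) \<phi>"
      have r: "0 < r / 4" using c by (simp add: lipschitz_chart_def)
      have "?P x (r / 4) \<Lambda> h0" by (intro conjI allI impI r pos *)
      then show "\<exists>\<rho> \<Lambda> h0. ?P x \<rho> \<Lambda> h0" by blast
    qed
  qed
  moreover define Q where "Q = ?P"
  ultimately have "\<forall>x\<in>frontier \<Omega>. \<exists>\<rho> \<Lambda> h0. Q x \<rho> \<Lambda> h0" by simp
  then obtain \<rho> \<Lambda> h0 where "\<And>x. x \<in> frontier \<Omega> \<Longrightarrow> Q x (\<rho> x) (\<Lambda> x) (h0 x)"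
    by metis
  then have P: "?P x (\<rho> x) (\<Lambda> x) (h0 x)" if "x \<in> frontier \<Omega>" for x
    using that unfolding Q_def by blast
  obtain I where I: "finite I" "I \<subseteq> frontier \<Omega>" "frontier \<Omega> \<subseteq> (\<Union>x\<in>I. ball x (\<rho> x))"
  proof (rule compactE_image[OF compact_frontier_bounded[OF bd]])
    show "frontier \<Omega> \<subseteq> (\<Union>x\<in>frontier \<Omega>. ball x (\<rho> x))"
    proof
      fix x assume x: "x \<in> frontier \<Omega>"
      then have "x \<in> ball x (\<rho> x)" using P[OF x] by simp
      with x show "x \<in> (\<Union>x\<in>frontier \<Omega>. ball x (\<rho> x))" by blast
    qed
  qed auto
  obtain h1 where h1: "0 < h1" "collar \<Omega> h1 \<subseteq> (\<Union>x\<in>I. ball x (\<rho> x))"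
    using collar_subset_nbhd[OF op bd _ I(3)] by blast
  define \<Lambda>m where "\<Lambda>m = Max (insert 1 (\<Lambda> ` I))"
  define hm where "hm = Min (insert h1 (h0 ` I))"
  have \<Lambda>m: "1 \<le> \<Lambda>m" "\<And>x. x \<in> I \<Longrightarrow> \<Lambda> x \<le> \<Lambda>m" using I(1) by (auto simp: \<Lambda>m_def)
  have hm: "0 < hm" "hm \<le> h1" "\<And>x. x \<in> I \<Longrightarrow> hm \<le> h0 x"
    using I(1,2) h1 P by (auto simp: hm_def)
  define C where "C = real (card I) * (2 * sweep_const TYPE('a) * \<Lambda>m + 2 * \<Lambda>m\<^sup>2) + 1"
  show thesis
  proof
    show "0 < C" unfolding C_def
      using sweep_const_pos[where 'a='a] \<Lambda>m(1) by (intro add_nonneg_pos mult_nonneg_nonneg add_nonneg_nonneg) auto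
    show "1 \<le> \<Lambda>m" "0 < hm" by fact+
    fix h and \<phi> :: "'a \<Rightarrow> real" assume h: "0 < h" "h < hm" and \<phi>: "Ck (Suc 0) \<phi>"
    let ?S = "\<integral>\<^sup>+x. ennreal ((\<phi> x)\<^sup>2) \<partial>surface_measure \<Omega>"
    let ?G = "\<integral>\<^sup>+x. ennreal ((norm (grad \<phi> x))\<^sup>2) * indicator (collar \<Omega> (\<Lambda>m * h)) x \<partial>lborel"
    have [measurable]: "\<phi> \<in> borel_measurable borel"
      by (intro borel_measurable_continuous_onI Ck_imp_continuous[OF \<phi>])
    note [measurable] = borel_collar[OF op]
    have "(\<integral>\<^sup>+x. ennreal ((\<phi> x)\<^sup>2) * indicator (collar \<Omega> h) x \<partial>lborel) \<le>
      (\<integral>\<^sup>+x. (\<Sum>i\<in>I. ennreal ((\<phi> x)\<^sup>2) * indicator (collar \<Omega> h \<inter> ball i (\<rho> i)) x) \<partial>lborel)"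
    proof (rule nn_integral_mono)
      fix x
      show "ennreal ((\<phi> x)\<^sup>2) * indicator (collar \<Omega> h) x \<le>
        (\<Sum>i\<in>I. ennreal ((\<phi> x)\<^sup>2) * indicator (collar \<Omega> h \<inter> ball i (\<rho> i)) x)"
      proof (cases "x \<in> collar \<Omega> h")
        case True
        then obtain i where i: "i \<in> I" "x \<in> ball i (\<rho> i)"
          using h1(2) collar_mono[of h h1 \<Omega>] h hm(2) by fastforce
        have "ennreal ((\<phi> x)\<^sup>2) * indicator (collar \<Omega> h) x =
          ennreal ((\<phi> x)\<^sup>2) * indicator (collar \<Omega> h \<inter> ball i (\<rho> i)) x" using True i by simp
        also have "\<dots> \<le> (\<Sum>i\<in>I. ennreal ((\<phi> x)\<^sup>2) * indicator (collar \<Omega> h \<inter> ball i (\<rho> i)) x)"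
          using I(1) i(1) by (rule member_le_sum[rotated 2]) auto
        finally show ?thesis .
      qed simp
    qed
    also have "\<dots> = (\<Sum>i\<in>I. \<integral>\<^sup>+x. ennreal ((\<phi> x)\<^sup>2) * indicator (collar \<Omega> h \<inter> ball i (\<rho> i)) x \<partial>lborel)"
    proof (rule nn_integral_sum)
      fix i
      have [measurable]: "collar \<Omega> h \<inter> ball i (\<rho> i) \<in> sets borel"
        using borel_collar[OF op] by (intro sets.Int) auto
      show "(\<lambda>x. ennreal ((\<phi> x)\<^sup>2) * indicator (collar \<Omega> h \<inter> ball i (\<rho> i)) x) \<in> borel_measurable lborel"
        by measurable
    qed
    also have "\<dots> \<le> (\<Sum>i\<in>I. ennreal (2 * sweep_const TYPE('a) * \<Lambda>m * h) * ?S + ennreal (2 * \<Lambda>m\<^sup>2 * h\<^sup>2) * ?G)"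
    proof (rule sum_mono)
      fix i assume i: "i \<in> I"
      have Pi: "?P i (\<rho> i) (\<Lambda> i) (h0 i)" using P i I(2) by blast
      have \<Lambda>i: "1 \<le> \<Lambda> i" "\<Lambda> i \<le> \<Lambda>m" using Pi \<Lambda>m(2)[OF i] by auto
      have "h < h0 i" using h hm(3)[OF i] by simp
      with Pi h \<phi> have "(\<integral>\<^sup>+x. ennreal ((\<phi> x)\<^sup>2) * indicator (collar \<Omega> h \<inter> ball i (\<rho> i)) x \<partial>lborel) \<le>
        collar_energy \<Omega> (2 * sweep_const TYPE('a) * (\<Lambda> i * h)) (2 * (\<Lambda> i * h)\<^sup>2) (\<Lambda> i * h) \<phi>" by blast
      also have "\<dots> \<le> ennreal (2 * sweep_const TYPE('a) * \<Lambda>m * h) * ?S + ennreal (2 * \<Lambda>m\<^sup>2 * h\<^sup>2) * ?G"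
      proof -
        have "2 * sweep_const TYPE('a) * (\<Lambda> i * h) \<le> 2 * sweep_const TYPE('a) * \<Lambda>m * h"
          using sweep_const_pos[where 'a='a] h \<Lambda>i by simp
        then have 1: "ennreal (2 * sweep_const TYPE('a) * (\<Lambda> i * h)) \<le> ennreal (2 * sweep_const TYPE('a) * \<Lambda>m * h)"
          by (rule ennreal_leI)
        have "2 * (\<Lambda> i * h)\<^sup>2 \<le> 2 * \<Lambda>m\<^sup>2 * h\<^sup>2"
          using h \<Lambda>i by (simp add: power_mult_distrib power_mono)
        then have 2: "ennreal (2 * (\<Lambda> i * h)\<^sup>2) \<le> ennreal (2 * \<Lambda>m\<^sup>2 * h\<^sup>2)"
          by (rule ennreal_leI)
        have "indicator (collar \<Omega> (\<Lambda> i * h)) x \<le> (indicator (collar \<Omega> (\<Lambda>m * h)) x :: ennreal)" for x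
          using collar_mono[of "\<Lambda> i * h" "\<Lambda>m * h" \<Omega>] h \<Lambda>i by (auto simp: indicator_def)
        then have "(\<integral>\<^sup>+x. ennreal ((norm (grad \<phi> x))\<^sup>2) * indicator (collar \<Omega> (\<Lambda> i * h)) x \<partial>lborel) \<le> ?G"
          by (intro nn_integral_mono mult_left_mono) auto
        then show ?thesis unfolding collar_energy_def by (intro add_mono mult_mono 1 2) auto
      qed
      finally show "(\<integral>\<^sup>+x. ennreal ((\<phi> x)\<^sup>2) * indicator (collar \<Omega> h \<inter> ball i (\<rho> i)) x \<partial>lborel) \<le>
        ennreal (2 * sweep_const TYPE('a) * \<Lambda>m * h) * ?S + ennreal (2 * \<Lambda>m\<^sup>2 * h\<^sup>2) * ?G" .
    qed
    also have "\<dots> = ennreal (real (card I) * (2 * sweep_const TYPE('a) * \<Lambda>m * h)) * ?S +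
        ennreal (real (card I) * (2 * \<Lambda>m\<^sup>2 * h\<^sup>2)) * ?G"
      using sweep_const_pos[where 'a='a] h \<Lambda>m(1)
      by (simp add: ennreal_mult ennreal_of_nat_eq_real_of_nat distrib_left mult.assoc)
    also have "\<dots> \<le> ennreal (C * h) * ?S + ennreal (C * h\<^sup>2) * ?G"
    proof -
      have "real (card I) * (2 * sweep_const TYPE('a) * \<Lambda>m) \<le> C" "real (card I) * (2 * \<Lambda>m\<^sup>2) \<le> C"
        using sweep_const_pos[where 'a='a] \<Lambda>m(1) by (simp_all add: C_def distrib_left)
      then have "real (card I) * (2 * sweep_const TYPE('a) * \<Lambda>m) * h \<le> C * h"
        "real (card I) * (2 * \<Lambda>m\<^sup>2) * h\<^sup>2 \<le> C * h\<^sup>2"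
        using h by (simp_all add: mult_right_mono)
      then show ?thesis
        by (intro add_mono mult_right_mono ennreal_leI) (simp_all only: mult.assoc zero_le)
    qed
    finally show "(\<integral>\<^sup>+x. ennreal ((\<phi> x)\<^sup>2) * indicator (collar \<Omega> h) x \<partial>lborel) \<le>
        collar_energy \<Omega> (C * h) (C * h\<^sup>2) (\<Lambda>m * h) \<phi>"
      by (simp add: collar_energy_def)
  qed
qed

section \<open>Cutting off smooth functions in a collar\<close>

text \<open>
  By the product rule, the gradient of \<open>\<phi> \<eta> - \<phi>\<close> consists of \<open>(\<eta> - 1) \<nabla>\<phi>\<close>, which lives in the collar
  where \<open>\<eta> \<noteq> 1\<close>, and of \<open>\<phi> \<nabla>\<eta>\<close>, whose square is at most \<open>\<phi>\<^sup>2 / h\<^sup>2\<close> on the same collar. The Hardy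
  inequality absorbs the factor \<open>1 / h\<^sup>2\<close>. One cutoff serves all \<open>\<phi>\<close>.
\<close>

lemma cutoff_error:
  fixes \<Omega> :: "'a::euclidean_space set"
  assumes \<Omega>: "bounded_lipschitz_domain \<Omega>"
  obtains C \<Lambda> h0 where "0 < C" "1 \<le> \<Lambda>" "0 < h0"
    "\<And>h. 0 < h \<Longrightarrow> h < h0 \<Longrightarrow> \<exists>\<eta>\<in>test_functions \<Omega>. \<forall>\<phi>. smooth \<phi> \<longrightarrow>
      (\<integral>\<^sup>+x. ennreal ((\<phi> x * \<eta> x - \<phi> x)\<^sup>2) * indicator \<Omega> x \<partial>lborel) \<le>
        collar_energy \<Omega> (C / h) C (\<Lambda> * h) \<phi> \<and>
      (\<integral>\<^sup>+x. ennreal ((norm (grad (\<lambda>x. \<phi> x * \<eta> x) x - grad \<phi> x))\<^sup>2) * indicator \<Omega> x \<partial>lborel) \<le>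
        collar_energy \<Omega> (C / h) C (\<Lambda> * h) \<phi>"
proof -
  have op: "open \<Omega>" and bd: "bounded \<Omega>" using \<Omega> by (auto simp: bounded_lipschitz_domain_def)
  obtain C \<Lambda> h0 where C: "0 < C" and \<Lambda>: "1 \<le> \<Lambda>" and h0: "0 < h0"
    and hardy: "\<And>h \<phi>. 0 < h \<Longrightarrow> h < h0 \<Longrightarrow> Ck (Suc 0) \<phi> \<Longrightarrow>
      (\<integral>\<^sup>+x. ennreal ((\<phi> x)\<^sup>2) * indicator (collar \<Omega> h) x \<partial>lborel) \<le>
        collar_energy \<Omega> (C * h) (C * h\<^sup>2) (\<Lambda> * h) \<phi>"
  proof (rule hardy_collar[OF \<Omega>], goal_cases)
    case (1 C \<Lambda> h0)
    show ?case by (rule 1(1)[OF 1(2-)])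
  qed
  let ?K = "2 + 32 * C"
  show thesis
  proof (rule that[of ?K "4 * \<Lambda>" "min 1 (h0 / 4)"])
    \<comment> \<open>\<open>\<eta>\<close> equals \<open>1\<close> at depth \<open>3 h\<close>, hence has zero gradient at depth \<open>4 h\<close>: the collar of width \<open>4 h\<close>
      contains the whole error, and the Hardy inequality is used at that width.\<close>
    fix h assume "0 < h" "h < min 1 (h0 / 4)"
    then have h: "0 < h" "h < 1" "4 * h < h0" by auto
    obtain \<eta> where \<eta>: "\<eta> \<in> test_functions \<Omega>" "\<And>x. 0 \<le> \<eta> x" "\<And>x. \<eta> x \<le> 1"
      "\<And>x. 3 * h \<le> infdist x (- \<Omega>) \<Longrightarrow> \<eta> x = 1" "\<And>x. norm (grad \<eta> x) \<le> 1 / h"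
    proof (rule cutoff_exists[OF op bd h(1)], goal_cases)
      case (1 \<eta>)
      show ?case by (rule 1(1)[OF 1(2-)])
    qed
    have \<eta>1: "Ck (Suc 0) \<eta>" by (intro smooth_Ck test_function_smooth[OF \<eta>(1)])
    have grad0: "grad \<eta> x = 0" if "4 * h \<le> infdist x (- \<Omega>)" for x
    proof (rule grad_eqI)
      have "((\<lambda>_. 1) has_derivative (\<lambda>v. 0 \<bullet> v)) (at x)" by simp
      then show "(\<eta> has_derivative (\<lambda>v. 0 \<bullet> v)) (at x)"
      proof (rule has_derivative_transform_within_open[where s="{x. 3 * h < infdist x (- \<Omega>)}"])
        show "open {x. 3 * h < infdist x (- \<Omega>)}" by (intro open_Collect_less continuous_intros)
      qed (use that h \<eta>(4) in auto)
    qed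
    show "\<exists>\<eta>\<in>test_functions \<Omega>. \<forall>\<phi>. smooth \<phi> \<longrightarrow>
      (\<integral>\<^sup>+x. ennreal ((\<phi> x * \<eta> x - \<phi> x)\<^sup>2) * indicator \<Omega> x \<partial>lborel) \<le>
        collar_energy \<Omega> (?K / h) ?K (4 * \<Lambda> * h) \<phi> \<and>
      (\<integral>\<^sup>+x. ennreal ((norm (grad (\<lambda>x. \<phi> x * \<eta> x) x - grad \<phi> x))\<^sup>2) * indicator \<Omega> x \<partial>lborel) \<le>
        collar_energy \<Omega> (?K / h) ?K (4 * \<Lambda> * h) \<phi>"
    proof (rule bexI[OF _ \<eta>(1)], intro allI impI)
      fix \<phi> :: "'a \<Rightarrow> real" assume \<phi>: "smooth \<phi>"
      have \<phi>1: "Ck (Suc 0) \<phi>" by (rule smooth_Ck[OF \<phi>])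
      have [measurable]: "\<phi> \<in> borel_measurable borel" "grad \<phi> \<in> borel_measurable borel"
        by (intro borel_measurable_continuous_onI Ck_imp_continuous[OF \<phi>1] continuous_grad[OF \<phi>1])+
      note [measurable] = borel_collar[OF op]
      let ?B = "\<integral>\<^sup>+x. ennreal ((\<phi> x)\<^sup>2) \<partial>surface_measure \<Omega>"
      let ?G = "\<lambda>r. \<integral>\<^sup>+x. ennreal ((norm (grad \<phi> x))\<^sup>2) * indicator (collar \<Omega> r) x \<partial>lborel"
      let ?A = "\<integral>\<^sup>+x. ennreal ((\<phi> x)\<^sup>2) * indicator (collar \<Omega> (4 * h)) x \<partial>lborel"
      have A: "?A \<le> ennreal (4 * C * h) * ?B + ennreal (16 * C * h\<^sup>2) * ?G (4 * \<Lambda> * h)"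
        using hardy[of "4 * h" \<phi>] h \<phi>1 by (simp add: collar_energy_def power_mult_distrib mult_ac)
      have Gmono: "?G (4 * h) \<le> ?G (4 * \<Lambda> * h)"
        using collar_mono[of "4 * h" "4 * \<Lambda> * h" \<Omega>] h \<Lambda>
        by (intro nn_integral_mono mult_left_mono) (auto simp: indicator_def)
      have val: "ennreal ((\<phi> x * \<eta> x - \<phi> x)\<^sup>2) * indicator \<Omega> x \<le>
          ennreal ((\<phi> x)\<^sup>2) * indicator (collar \<Omega> (4 * h)) x" for x
      proof (cases "x \<in> \<Omega> \<and> infdist x (- \<Omega>) < 4 * h")
        case True
        have "(\<phi> x * \<eta> x - \<phi> x)\<^sup>2 = (\<phi> x)\<^sup>2 * (1 - \<eta> x)\<^sup>2"
          by (simp add: power2_eq_square algebra_simps)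
        also have "\<dots> \<le> (\<phi> x)\<^sup>2 * 1"
          using \<eta>(2,3)[of x] by (intro mult_left_mono power_le_one) auto
        finally show ?thesis using True by (simp add: collar_def ennreal_leI)
      next
        case False
        then show ?thesis using \<eta>(4)[of x] h by (auto simp: collar_def)
      qed
      have gr: "ennreal ((norm (grad (\<lambda>x. \<phi> x * \<eta> x) x - grad \<phi> x))\<^sup>2) * indicator \<Omega> x \<le>
          ennreal 2 * (ennreal ((norm (grad \<phi> x))\<^sup>2) * indicator (collar \<Omega> (4 * h)) x) +
          ennreal (2 / h\<^sup>2) * (ennreal ((\<phi> x)\<^sup>2) * indicator (collar \<Omega> (4 * h)) x)" for x
      proof (cases "x \<in> \<Omega> \<and> infdist x (- \<Omega>) < 4 * h")
        case True
        let ?a = "(1 - \<eta> x) * norm (grad \<phi> x)" and ?b = "\<bar>\<phi> x\<bar> * (1 / h)"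
        have "norm (grad (\<lambda>x. \<phi> x * \<eta> x) x - grad \<phi> x) =
            norm (\<phi> x *\<^sub>R grad \<eta> x - (1 - \<eta> x) *\<^sub>R grad \<phi> x)"
          unfolding grad_mult[OF \<phi>1 \<eta>1] by (simp add: algebra_simps)
        also have "\<dots> \<le> \<bar>\<phi> x\<bar> * norm (grad \<eta> x) + (1 - \<eta> x) * norm (grad \<phi> x)"
          using norm_triangle_ineq4[of "\<phi> x *\<^sub>R grad \<eta> x" "(1 - \<eta> x) *\<^sub>R grad \<phi> x"] \<eta>(3)[of x] by simp
        also have "\<dots> \<le> \<bar>\<phi> x\<bar> * (1 / h) + 1 * norm (grad \<phi> x)"
          using \<eta>(2,5)[of x] by (intro add_mono mult_left_mono mult_right_mono) auto
        finally have "(norm (grad (\<lambda>x. \<phi> x * \<eta> x) x - grad \<phi> x))\<^sup>2 \<le> (?b + norm (grad \<phi> x))\<^sup>2"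
          by (intro power_mono) auto
        also have "\<dots> \<le> 2 * (norm (grad \<phi> x))\<^sup>2 + 2 * ?b\<^sup>2"
          using sum_squares_bound[of ?b "norm (grad \<phi> x)"] by (simp add: power2_sum)
        also have "2 * ?b\<^sup>2 = 2 / h\<^sup>2 * (\<phi> x)\<^sup>2" by (simp add: power_mult_distrib power_divide)
        finally have "ennreal ((norm (grad (\<lambda>x. \<phi> x * \<eta> x) x - grad \<phi> x))\<^sup>2) \<le>
            ennreal (2 * (norm (grad \<phi> x))\<^sup>2 + 2 / h\<^sup>2 * (\<phi> x)\<^sup>2)" by (rule ennreal_leI)
        also have "\<dots> = ennreal 2 * ennreal ((norm (grad \<phi> x))\<^sup>2) + ennreal (2 / h\<^sup>2) * ennreal ((\<phi> x)\<^sup>2)"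
          using ennreal_mult[of "2 / h\<^sup>2" "(\<phi> x)\<^sup>2"] ennreal_mult[of 2 "(norm (grad \<phi> x))\<^sup>2"]
          by (subst ennreal_plus) (auto simp del: times_divide_eq_left)
        finally show ?thesis using True by (simp add: collar_def)
      next
        case False
        show ?thesis
        proof (cases "x \<in> \<Omega>")
          case True
          then have "grad (\<lambda>x. \<phi> x * \<eta> x) x - grad \<phi> x = 0"
            using False grad0[of x] \<eta>(4)[of x] h by (simp add: grad_mult[OF \<phi>1 \<eta>1])
          then show ?thesis by simp
        qed simp
      qed
      let ?E = "ennreal ?K * ?G (4 * \<Lambda> * h) + ennreal (?K / h) * ?B"
      have AE: "ennreal c * ?A \<le> ennreal (c * (16 * C * h\<^sup>2)) * ?G (4 * \<Lambda> * h) + ennreal (c * (4 * C * h)) * ?B"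
        if "0 \<le> c" for c
      proof -
        have "ennreal c * ?A \<le> ennreal c * (ennreal (4 * C * h) * ?B + ennreal (16 * C * h\<^sup>2) * ?G (4 * \<Lambda> * h))"
          using A by (rule mult_left_mono) simp
        also have "\<dots> = ennreal (c * (16 * C * h\<^sup>2)) * ?G (4 * \<Lambda> * h) + ennreal (c * (4 * C * h)) * ?B"
          using that C h by (simp add: distrib_left ennreal_mult mult.assoc add.commute)
        finally show ?thesis .
      qed
      have "(\<integral>\<^sup>+x. ennreal ((\<phi> x * \<eta> x - \<phi> x)\<^sup>2) * indicator \<Omega> x \<partial>lborel) \<le> ?A"
        by (intro nn_integral_mono val)
      also have "\<dots> \<le> ?E"
      proof -
        have "?A \<le> ennreal (16 * C * h\<^sup>2) * ?G (4 * \<Lambda> * h) + ennreal (4 * C * h) * ?B"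
          using AE[of 1] by simp
        also have "\<dots> \<le> ?E"
        proof (intro add_mono mult_right_mono ennreal_leI)
          have "h\<^sup>2 \<le> 1" using h by (simp add: power_le_one)
          then have "16 * C * h\<^sup>2 \<le> 16 * C * 1" using C by (intro mult_left_mono) auto
          then show "16 * C * h\<^sup>2 \<le> ?K" using C by linarith
          have "4 * C * h \<le> 4 * C * 1" using C h by (intro mult_left_mono) auto
          also have "\<dots> \<le> ?K * 1" using C by simp
          also have "\<dots> \<le> ?K * (1 / h)" using C h by (intro mult_left_mono) auto
          finally show "4 * C * h \<le> ?K / h" by simp
        qed auto
        finally show ?thesis .
      qed
      finally have 1: "(\<integral>\<^sup>+x. ennreal ((\<phi> x * \<eta> x - \<phi> x)\<^sup>2) * indicator \<Omega> x \<partial>lborel) \<le> ?E" .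
      have "(\<integral>\<^sup>+x. ennreal ((norm (grad (\<lambda>x. \<phi> x * \<eta> x) x - grad \<phi> x))\<^sup>2) * indicator \<Omega> x \<partial>lborel) \<le>
          (\<integral>\<^sup>+x. ennreal 2 * (ennreal ((norm (grad \<phi> x))\<^sup>2) * indicator (collar \<Omega> (4 * h)) x) +
          ennreal (2 / h\<^sup>2) * (ennreal ((\<phi> x)\<^sup>2) * indicator (collar \<Omega> (4 * h)) x) \<partial>lborel)"
        by (intro nn_integral_mono gr)
      also have "\<dots> = ennreal 2 * ?G (4 * h) + ennreal (2 / h\<^sup>2) * ?A"
        by (subst nn_integral_add) (auto simp: nn_integral_cmult simp del: ennreal_numeral)
      also have "\<dots> \<le> ennreal 2 * ?G (4 * \<Lambda> * h) +
          (ennreal (2 / h\<^sup>2 * (16 * C * h\<^sup>2)) * ?G (4 * \<Lambda> * h) + ennreal (2 / h\<^sup>2 * (4 * C * h)) * ?B)"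
        by (intro add_mono mult_left_mono Gmono AE) (use h in auto)
      also have "2 / h\<^sup>2 * (16 * C * h\<^sup>2) = 32 * C" using h by simp
      also have "2 / h\<^sup>2 * (4 * C * h) = 8 * C / h" using h by (simp add: power2_eq_square)
      also have "ennreal 2 * ?G (4 * \<Lambda> * h) + (ennreal (32 * C) * ?G (4 * \<Lambda> * h) + ennreal (8 * C / h) * ?B) =
          ennreal ?K * ?G (4 * \<Lambda> * h) + ennreal (8 * C / h) * ?B"
        using C by (simp add: distrib_right add.assoc)
      also have "\<dots> \<le> ?E"
        using C h by (intro add_left_mono mult_right_mono ennreal_leI divide_right_mono) auto
      finally have 2: "(\<integral>\<^sup>+x. ennreal ((norm (grad (\<lambda>x. \<phi> x * \<eta> x) x - grad \<phi> x))\<^sup>2) * indicator \<Omega> x \<partial>lborel) \<le> ?E" .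
      have "?E = collar_energy \<Omega> (?K / h) ?K (4 * \<Lambda> * h) \<phi>"
        unfolding collar_energy_def by (rule add.commute)
      then show "(\<integral>\<^sup>+x. ennreal ((\<phi> x * \<eta> x - \<phi> x)\<^sup>2) * indicator \<Omega> x \<partial>lborel) \<le>
          collar_energy \<Omega> (?K / h) ?K (4 * \<Lambda> * h) \<phi> \<and>
        (\<integral>\<^sup>+x. ennreal ((norm (grad (\<lambda>x. \<phi> x * \<eta> x) x - grad \<phi> x))\<^sup>2) * indicator \<Omega> x \<partial>lborel) \<le>
          collar_energy \<Omega> (?K / h) ?K (4 * \<Lambda> * h) \<phi>"
        using 1 2 by simp
    qed
  qed (use C \<Lambda> h0 in auto)
qed

section \<open>Square integrable functions\<close>

lemma L2_norm_nonneg: "0 \<le> L2_norm M f"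
  by (simp add: L2_norm_def)

lemma L2_norm_sq: "(L2_norm M f)\<^sup>2 = (\<integral>x. (norm (f x))\<^sup>2 \<partial>M)"
  by (simp add: L2_norm_def)

lemma ennreal_L2_norm_sq:
  assumes "f \<in> L2_space M"
  shows "ennreal ((L2_norm M f)\<^sup>2) = (\<integral>\<^sup>+x. ennreal ((norm (f x))\<^sup>2) \<partial>M)"
  unfolding L2_norm_sq using assms
  by (subst nn_integral_eq_integral) (auto simp: L2_space_def)

lemma L2_spaceI_AE_bound:
  assumes "f \<in> borel_measurable M" "integrable M g" "AE x in M. (norm (f x))\<^sup>2 \<le> g x"
  shows "f \<in> L2_space M"
proof -
  have "integrable M (\<lambda>x. (norm (f x))\<^sup>2)"
    using assms by (intro Bochner_Integration.integrable_bound[OF assms(2)]) auto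
  then show ?thesis using assms(1) by (simp add: L2_space_def)
qed

lemma L2_diff:
  assumes "f \<in> L2_space M" "g \<in> L2_space M"
  shows "(\<lambda>x. f x - g x) \<in> L2_space M"
proof (rule L2_spaceI_AE_bound)
  show "integrable M (\<lambda>x. 2 * (norm (f x))\<^sup>2 + 2 * (norm (g x))\<^sup>2)"
    using assms by (auto simp: L2_space_def)
  show "AE x in M. (norm (f x - g x))\<^sup>2 \<le> 2 * (norm (f x))\<^sup>2 + 2 * (norm (g x))\<^sup>2"
  proof (rule AE_I2)
    fix x
    have "(norm (f x - g x))\<^sup>2 \<le> (norm (f x) + norm (g x))\<^sup>2"
      by (intro power_mono norm_triangle_ineq4) auto
    also have "\<dots> \<le> 2 * (norm (f x))\<^sup>2 + 2 * (norm (g x))\<^sup>2"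
      using sum_squares_bound[of "norm (f x)" "norm (g x)"] by (simp add: power2_sum)
    finally show "(norm (f x - g x))\<^sup>2 \<le> 2 * (norm (f x))\<^sup>2 + 2 * (norm (g x))\<^sup>2" .
  qed
qed (use assms in \<open>auto simp: L2_space_def\<close>)

lemma L2_inner_integrable:
  assumes "f \<in> L2_space M" "g \<in> L2_space M"
  shows "integrable M (\<lambda>x. f x \<bullet> g x)"
proof (rule Bochner_Integration.integrable_bound)
  show "integrable M (\<lambda>x. (norm (f x))\<^sup>2 + (norm (g x))\<^sup>2)"
    using assms by (auto simp: L2_space_def)
  show "AE x in M. norm (f x \<bullet> g x) \<le> norm ((norm (f x))\<^sup>2 + (norm (g x))\<^sup>2)"
  proof (rule AE_I2)
    fix x
    have "2 * norm (f x) * norm (g x) \<le> (norm (f x))\<^sup>2 + (norm (g x))\<^sup>2" by (rule sum_squares_bound)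
    moreover have "0 \<le> norm (f x) * norm (g x)" by simp
    ultimately show "norm (f x \<bullet> g x) \<le> norm ((norm (f x))\<^sup>2 + (norm (g x))\<^sup>2)"
      using Cauchy_Schwarz_ineq2[of "f x" "g x"] by simp
  qed
qed (use assms in \<open>auto simp: L2_space_def intro!: borel_measurable_inner\<close>)

text \<open>
  The norm of \<open>s f + t g\<close> is a non-negative quadratic form in \<open>(s, t)\<close>; its values at
  \<open>(\<parallel>g\<parallel>\<^sup>2, - \<langle>f, g\<rangle>)\<close>, and along \<open>s = 1\<close> in the degenerate case \<open>\<parallel>g\<parallel> = 0\<close>, give the inequality.
\<close>

lemma L2_Cauchy_Schwarz:
  assumes f: "f \<in> L2_space M" and g: "g \<in> L2_space M"
  shows "\<bar>\<integral>x. f x \<bullet> g x \<partial>M\<bar> \<le> L2_norm M f * L2_norm M g"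
proof -
  let ?I = "\<integral>x. f x \<bullet> g x \<partial>M"
  have int: "integrable M (\<lambda>x. f x \<bullet> g x)" by (rule L2_inner_integrable[OF f g])
  have fi: "integrable M (\<lambda>x. (norm (f x))\<^sup>2)" "integrable M (\<lambda>x. (norm (g x))\<^sup>2)"
    using f g by (auto simp: L2_space_def)
  let ?a = "(L2_norm M f)\<^sup>2" and ?b = "(L2_norm M g)\<^sup>2"
  have quad: "0 \<le> s\<^sup>2 * ?a + 2 * s * t * ?I + t\<^sup>2 * ?b" for s t
  proof -
    have "0 \<le> (\<integral>x. (norm (s *\<^sub>R f x + t *\<^sub>R g x))\<^sup>2 \<partial>M)" by simp
    also have "(\<lambda>x. (norm (s *\<^sub>R f x + t *\<^sub>R g x))\<^sup>2) =
        (\<lambda>x. s\<^sup>2 * (norm (f x))\<^sup>2 + 2 * s * t * (f x \<bullet> g x) + t\<^sup>2 * (norm (g x))\<^sup>2)"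
      unfolding power2_norm_eq_inner
      by (simp add: inner_add_left inner_add_right inner_commute power2_eq_square algebra_simps fun_eq_iff)
    also have "(\<integral>x. s\<^sup>2 * (norm (f x))\<^sup>2 + 2 * s * t * (f x \<bullet> g x) + t\<^sup>2 * (norm (g x))\<^sup>2 \<partial>M) =
        s\<^sup>2 * ?a + 2 * s * t * ?I + t\<^sup>2 * ?b"
      using int fi by (simp add: L2_norm_sq)
    finally show ?thesis .
  qed
  have "?I\<^sup>2 \<le> ?a * ?b"
  proof (cases "?b = 0")
    case True
    have "?I = 0"
    proof (rule ccontr)
      assume "?I \<noteq> 0"
      have "0 \<le> ?a + 2 * (- (?a + 1) / (2 * ?I)) * ?I"
        using quad[of 1 "- (?a + 1) / (2 * ?I)"] True by simp
      then show False using \<open>?I \<noteq> 0\<close> by (simp add: field_simps)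
    qed
    then show ?thesis by simp
  next
    case False
    then have b: "0 < ?b" by simp
    have "0 \<le> ?b * (?b * ?a - ?I\<^sup>2)"
      using quad[of "?b" "- ?I"] by (simp add: power2_eq_square algebra_simps)
    then show ?thesis using b by (simp add: zero_le_mult_iff mult.commute)
  qed
  then have "\<bar>?I\<bar>\<^sup>2 \<le> (L2_norm M f * L2_norm M g)\<^sup>2" by (simp add: power_mult_distrib)
  then show ?thesis by (rule power2_le_imp_le) (simp add: L2_norm_nonneg)
qed

lemma L2_norm_triangle_diff:
  assumes f: "f \<in> L2_space M" and g: "g \<in> L2_space M" and h: "h \<in> L2_space M"
  shows "L2_norm M (\<lambda>x. f x - h x) \<le> L2_norm M (\<lambda>x. f x - g x) + L2_norm M (\<lambda>x. g x - h x)"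
proof (rule power2_le_imp_le)
  let ?F = "\<lambda>x. f x - g x" and ?G = "\<lambda>x. g x - h x"
  have FG: "?F \<in> L2_space M" "?G \<in> L2_space M" by (intro L2_diff f g h)+
  have "(L2_norm M (\<lambda>x. f x - h x))\<^sup>2 = (\<integral>x. (norm (?F x))\<^sup>2 + 2 * (?F x \<bullet> ?G x) + (norm (?G x))\<^sup>2 \<partial>M)"
    unfolding L2_norm_sq
    by (intro Bochner_Integration.integral_cong refl)
      (simp add: power2_norm_eq_inner inner_diff_left inner_diff_right inner_commute algebra_simps)
  also have "\<dots> = (L2_norm M ?F)\<^sup>2 + 2 * (\<integral>x. ?F x \<bullet> ?G x \<partial>M) + (L2_norm M ?G)\<^sup>2"
    using FG L2_inner_integrable[OF FG] by (simp add: L2_norm_sq L2_space_def)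
  also have "\<dots> \<le> (L2_norm M ?F + L2_norm M ?G)\<^sup>2"
    using L2_Cauchy_Schwarz[OF FG] by (simp add: power2_sum)
  finally show "(L2_norm M (\<lambda>x. f x - h x))\<^sup>2 \<le> (L2_norm M ?F + L2_norm M ?G)\<^sup>2" .
qed (simp add: L2_norm_nonneg)

lemma L2_norm_minus_commute: "L2_norm M (\<lambda>x. f x - g x) = L2_norm M (\<lambda>x. g x - f x)"
  by (simp add: L2_norm_def norm_minus_commute)

lemma L2_AE_cong:
  assumes "f \<in> borel_measurable M" "g \<in> L2_space M" "AE x in M. f x = g x"
  shows "f \<in> L2_space M" "L2_norm M f = L2_norm M g"
proof -
  have AE: "AE x in M. (norm (f x))\<^sup>2 = (norm (g x))\<^sup>2" using assms(3) by eventually_elim simp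
  have "integrable M (\<lambda>x. (norm (f x))\<^sup>2) \<longleftrightarrow> integrable M (\<lambda>x. (norm (g x))\<^sup>2)"
    using assms AE by (intro integrable_cong_AE) (auto simp: L2_space_def)
  then show "f \<in> L2_space M" using assms by (simp add: L2_space_def)
  show "L2_norm M f = L2_norm M g"
    unfolding L2_norm_def using assms AE
    by (intro arg_cong[of _ _ sqrt] integral_cong_AE) (auto simp: L2_space_def)
qed

lemma L2_inner_limit:
  assumes f: "f \<in> L2_space M" and g: "g \<in> L2_space M" and fn: "\<And>k. fn k \<in> L2_space M"
    and lim: "(\<lambda>k. L2_norm M (\<lambda>x. fn k x - f x)) \<longlonglongrightarrow> 0"
  shows "(\<lambda>k. \<integral>x. fn k x \<bullet> g x \<partial>M) \<longlonglongrightarrow> (\<integral>x. f x \<bullet> g x \<partial>M)"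
proof -
  have "(\<lambda>k. (\<integral>x. fn k x \<bullet> g x \<partial>M) - (\<integral>x. f x \<bullet> g x \<partial>M)) \<longlonglongrightarrow> 0"
  proof (rule Lim_null_comparison)
    show "\<forall>\<^sub>F k in sequentially. norm ((\<integral>x. fn k x \<bullet> g x \<partial>M) - (\<integral>x. f x \<bullet> g x \<partial>M)) \<le>
        L2_norm M (\<lambda>x. fn k x - f x) * L2_norm M g"
    proof (rule always_eventually, rule allI)
      fix k
      have "(\<integral>x. fn k x \<bullet> g x \<partial>M) - (\<integral>x. f x \<bullet> g x \<partial>M) = (\<integral>x. (fn k x - f x) \<bullet> g x \<partial>M)"
        using L2_inner_integrable[OF fn g] L2_inner_integrable[OF f g] by (simp add: inner_diff_left)
      then show "norm ((\<integral>x. fn k x \<bullet> g x \<partial>M) - (\<integral>x. f x \<bullet> g x \<partial>M)) \<le>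
          L2_norm M (\<lambda>x. fn k x - f x) * L2_norm M g"
        using L2_Cauchy_Schwarz[OF L2_diff[OF fn f] g] by simp
    qed
    show "(\<lambda>k. L2_norm M (\<lambda>x. fn k x - f x) * L2_norm M g) \<longlonglongrightarrow> 0"
      using tendsto_mult_right[OF lim, of "L2_norm M g"] by simp
  qed
  then show ?thesis by (rule LIM_zero_cancel)
qed

section \<open>Sobolev functions\<close>

lemma continuous_L2:
  fixes f :: "'a::euclidean_space \<Rightarrow> 'b::euclidean_space"
  assumes \<Omega>: "open \<Omega>" "bounded \<Omega>" and f: "continuous_on UNIV f"
  shows "f \<in> L2_space (lebesgue_on \<Omega>)"
proof -
  have "f \<in> borel_measurable lebesgue"
    using f by (intro measurable_completion) (simp add: borel_measurable_continuous_onI)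
  then have meas: "f \<in> borel_measurable (lebesgue_on \<Omega>)" by (rule measurable_restrict_space1)
  have "compact (closure \<Omega>)" using \<Omega>(2) by (simp add: compact_closure)
  then have "(\<lambda>x. (norm (f x))\<^sup>2) absolutely_integrable_on closure \<Omega>"
    by (intro continuous_absolutely_integrable_compact continuous_intros continuous_on_subset[OF f]) auto
  then have "(\<lambda>x. (norm (f x))\<^sup>2) absolutely_integrable_on \<Omega>"
    by (rule set_integrable_subset) (use \<Omega> closure_subset in auto)
  then have "integrable (lebesgue_on \<Omega>) (\<lambda>x. (norm (f x))\<^sup>2)"
    using \<Omega>(1) by (subst integrable_restrict_space) (auto simp: set_integrable_def)
  with meas show ?thesis by (simp add: L2_space_def)
qed

text \<open>
  The selected weak gradient is an arbitrary representative; its measurability comes from a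
  measurable representative and the completeness of Lebesgue measure.
\<close>

lemma borel_measurable_lebesgue_on_AE:
  fixes f g :: "'a::euclidean_space \<Rightarrow> 'b::euclidean_space"
  assumes g: "g \<in> borel_measurable (lebesgue_on \<Omega>)" and \<Omega>: "open \<Omega>"
    and AE: "AE x in lebesgue_on \<Omega>. f x = g x"
  shows "f \<in> borel_measurable (lebesgue_on \<Omega>)"
proof -
  have "(\<lambda>x. indicator \<Omega> x *\<^sub>R g x) \<in> borel_measurable lebesgue"
    using g \<Omega> by (subst (asm) borel_measurable_restrict_space_iff) auto
  moreover have "AE x in lebesgue. indicator \<Omega> x *\<^sub>R g x = indicator \<Omega> x *\<^sub>R f x"
    using AE \<Omega> by (subst (asm) AE_restrict_space_iff) (auto elim!: eventually_mono simp: indicator_def)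
  ultimately have "(\<lambda>x. indicator \<Omega> x *\<^sub>R f x) \<in> borel_measurable lebesgue"
    by (rule borel_measurable_AE)
  then show ?thesis
    using \<Omega> by (subst borel_measurable_restrict_space_iff) auto
qed

lemma weak_gradient_H1:
  assumes \<Omega>: "open \<Omega>" and v: "v \<in> H1_space \<Omega>"
  shows "is_weak_gradient \<Omega> v (weak_gradient \<Omega> v)" "weak_gradient \<Omega> v \<in> L2_space (lebesgue_on \<Omega>)"
proof -
  obtain g where g: "is_weak_gradient \<Omega> v g" "g \<in> L2_space (lebesgue_on \<Omega>)"
    using v by (auto simp: H1_space_def)
  show "is_weak_gradient \<Omega> v (weak_gradient \<Omega> v)" by (rule is_weak_gradient_weak_gradient[OF g(1)])
  have AE: "AE x in lebesgue_on \<Omega>. weak_gradient \<Omega> v x = g x" by (rule weak_gradient_AE_eq[OF \<Omega> g(1)])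
  show "weak_gradient \<Omega> v \<in> L2_space (lebesgue_on \<Omega>)"
    using g(2) by (intro L2_AE_cong(1)[OF borel_measurable_lebesgue_on_AE[OF _ \<Omega> AE] g(2) AE])
      (simp add: L2_space_def)
qed

lemma H1_diff:
  assumes \<Omega>: "open \<Omega>" and v: "v \<in> H1_space \<Omega>" and w: "w \<in> H1_space \<Omega>"
  shows "(\<lambda>x. v x - w x) \<in> H1_space \<Omega>"
    "AE x in lebesgue_on \<Omega>. weak_gradient \<Omega> (\<lambda>x. v x - w x) x = weak_gradient \<Omega> v x - weak_gradient \<Omega> w x"
proof -
  note V = weak_gradient_H1[OF \<Omega> v] and W = weak_gradient_H1[OF \<Omega> w]
  have g: "is_weak_gradient \<Omega> (\<lambda>x. v x - w x) (\<lambda>x. weak_gradient \<Omega> v x - weak_gradient \<Omega> w x)"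
    by (rule is_weak_gradient_diff[OF \<Omega> V(1) W(1)])
  then show "(\<lambda>x. v x - w x) \<in> H1_space \<Omega>"
    using v w L2_diff[OF V(2) W(2)] by (auto simp: H1_space_def intro: L2_diff)
  show "AE x in lebesgue_on \<Omega>. weak_gradient \<Omega> (\<lambda>x. v x - w x) x = weak_gradient \<Omega> v x - weak_gradient \<Omega> w x"
    by (rule weak_gradient_AE_eq[OF \<Omega> g])
qed

lemma C1_H1:
  fixes f :: "'a::euclidean_space \<Rightarrow> real"
  assumes \<Omega>: "open \<Omega>" "bounded \<Omega>" and f: "Ck (Suc 0) f"
  shows "f \<in> H1_space \<Omega>" "AE x in lebesgue_on \<Omega>. weak_gradient \<Omega> f x = grad f x"
    "f \<in> L2_space (lebesgue_on \<Omega>)" "grad f \<in> L2_space (lebesgue_on \<Omega>)"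
proof -
  show *: "f \<in> L2_space (lebesgue_on \<Omega>)" "grad f \<in> L2_space (lebesgue_on \<Omega>)"
    by (intro continuous_L2[OF \<Omega>] Ck_imp_continuous[OF f] continuous_grad[OF f])+
  note g = is_weak_gradient_classical[OF \<Omega>(1) f]
  show "f \<in> H1_space \<Omega>" using * g by (auto simp: H1_space_def)
  show "AE x in lebesgue_on \<Omega>. weak_gradient \<Omega> f x = grad f x" by (rule weak_gradient_AE_eq[OF \<Omega>(1) g])
qed

lemma H1_norm_diff_C1:
  fixes f :: "'a::euclidean_space \<Rightarrow> real"
  assumes \<Omega>: "open \<Omega>" "bounded \<Omega>" and f: "Ck (Suc 0) f" and v: "v \<in> H1_space \<Omega>"
  shows "L2_norm (lebesgue_on \<Omega>) (\<lambda>x. f x - v x) \<le> H1_norm \<Omega> (\<lambda>x. f x - v x)"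
    "L2_norm (lebesgue_on \<Omega>) (\<lambda>x. grad f x - weak_gradient \<Omega> v x) \<le> H1_norm \<Omega> (\<lambda>x. f x - v x)"
proof -
  have AE: "AE x in lebesgue_on \<Omega>. weak_gradient \<Omega> (\<lambda>x. f x - v x) x = grad f x - weak_gradient \<Omega> v x"
    using H1_diff(2)[OF \<Omega>(1) C1_H1(1)[OF \<Omega> f] v] C1_H1(2)[OF \<Omega> f] by eventually_elim simp
  have m: "weak_gradient \<Omega> (\<lambda>x. f x - v x) \<in> borel_measurable (lebesgue_on \<Omega>)"
    using weak_gradient_H1(2)[OF \<Omega>(1) H1_diff(1)[OF \<Omega>(1) C1_H1(1)[OF \<Omega> f] v]] by (simp add: L2_space_def)
  have eq: "L2_norm (lebesgue_on \<Omega>) (\<lambda>x. grad f x - weak_gradient \<Omega> v x) =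
      L2_norm (lebesgue_on \<Omega>) (weak_gradient \<Omega> (\<lambda>x. f x - v x))"
    using L2_AE_cong(2)[OF m L2_diff[OF C1_H1(4)[OF \<Omega> f] weak_gradient_H1(2)[OF \<Omega>(1) v]] AE] by simp
  show "L2_norm (lebesgue_on \<Omega>) (\<lambda>x. f x - v x) \<le> H1_norm \<Omega> (\<lambda>x. f x - v x)"
    unfolding H1_norm_def by (rule real_le_rsqrt) simp
  show "L2_norm (lebesgue_on \<Omega>) (\<lambda>x. grad f x - weak_gradient \<Omega> v x) \<le> H1_norm \<Omega> (\<lambda>x. f x - v x)"
    unfolding H1_norm_def eq by (rule real_le_rsqrt) simp
qed

lemma nn_integral_lebesgue_on_borel:
  fixes F :: "'a::euclidean_space \<Rightarrow> ennreal"
  assumes "open \<Omega>" "F \<in> borel_measurable borel"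
  shows "(\<integral>\<^sup>+x. F x \<partial>lebesgue_on \<Omega>) = (\<integral>\<^sup>+x. F x * indicator \<Omega> x \<partial>lborel)"
  using assms by (subst nn_integral_restrict_space) (auto simp: nn_integral_completion)

section \<open>Functions with zero trace are limits of test functions\<close>

text \<open>
  The collars shrink to the empty set, so dominated convergence applies along \<open>h = 1 / (n + 1)\<close>.
\<close>

lemma collar_energy_small:
  fixes w :: "'a::euclidean_space \<Rightarrow> 'a"
  assumes \<Omega>: "open \<Omega>" "bounded \<Omega>" and w: "w \<in> L2_space (lebesgue_on \<Omega>)"
    and pos: "0 < \<Lambda>" "0 < h0" "0 < \<delta>"
  obtains h where "0 < h" "h < h0"
    "(\<integral>\<^sup>+x. ennreal ((norm (w x))\<^sup>2) * indicator (collar \<Omega> (\<Lambda> * h)) x \<partial>lebesgue_on \<Omega>) < ennreal \<delta>"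
proof -
  let ?M = "lebesgue_on \<Omega>" and ?f = "\<lambda>x. (norm (w x))\<^sup>2"
  let ?h = "\<lambda>n. inverse (real (Suc n))"
  have int: "integrable ?M ?f" and wm: "w \<in> borel_measurable ?M" using w by (auto simp: L2_space_def)
  have c: "collar \<Omega> r \<in> sets ?M" for r
    using borel_collar[OF \<Omega>(1)] \<Omega>(1) by (auto simp: sets_restrict_space_iff collar_def)
  have "(\<lambda>n. \<integral>x. ?f x * indicator (collar \<Omega> (\<Lambda> * ?h n)) x \<partial>?M) \<longlonglongrightarrow> (\<integral>x. 0 \<partial>?M)"
  proof (rule integral_dominated_convergence[where w="?f"])
    show "AE x in ?M. (\<lambda>n. ?f x * indicator (collar \<Omega> (\<Lambda> * ?h n)) x) \<longlonglongrightarrow> 0"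
    proof (rule AE_I2)
      fix x assume "x \<in> space ?M"
      then have x: "x \<in> \<Omega>" by (simp add: space_restrict_space)
      have "- \<Omega> \<noteq> {}" using \<Omega>(2) not_bounded_UNIV by (metis Compl_empty_eq double_complement)
      then have d: "0 < infdist x (- \<Omega>)"
        using \<Omega>(1) x by (intro infdist_pos_not_in_closed) (auto simp: closed_def)
      have "(\<lambda>n. \<Lambda> * ?h n) \<longlonglongrightarrow> \<Lambda> * 0" by (intro tendsto_intros LIMSEQ_inverse_real_of_nat)
      then have "\<forall>\<^sub>F n in sequentially. \<Lambda> * ?h n < infdist x (- \<Omega>)"
        using d by (simp add: order_tendsto_iff)
      then have "\<forall>\<^sub>F n in sequentially. ?f x * indicator (collar \<Omega> (\<Lambda> * ?h n)) x = 0"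
        by eventually_elim (simp add: collar_def)
      then show "(\<lambda>n. ?f x * indicator (collar \<Omega> (\<Lambda> * ?h n)) x) \<longlonglongrightarrow> 0"
        by (rule tendsto_eventually)
    qed
    show "AE x in ?M. norm (?f x * indicator (collar \<Omega> (\<Lambda> * ?h n)) x) \<le> ?f x" for n
      by (intro AE_I2) (auto simp: indicator_def)
  qed (use int wm c in \<open>auto intro!: borel_measurable_times borel_measurable_indicator\<close>)
  then have "\<forall>\<^sub>F n in sequentially. (\<integral>x. ?f x * indicator (collar \<Omega> (\<Lambda> * ?h n)) x \<partial>?M) < \<delta>"
    using pos(3) by (simp add: order_tendsto_iff)
  moreover have "\<forall>\<^sub>F n in sequentially. ?h n < h0"
    using LIMSEQ_inverse_real_of_nat pos(2) by (simp add: order_tendsto_iff)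
  ultimately have "\<forall>\<^sub>F n in sequentially. (\<integral>x. ?f x * indicator (collar \<Omega> (\<Lambda> * ?h n)) x \<partial>?M) < \<delta> \<and> ?h n < h0"
    by (rule eventually_conj)
  then obtain n where n: "(\<integral>x. ?f x * indicator (collar \<Omega> (\<Lambda> * ?h n)) x \<partial>?M) < \<delta>" "?h n < h0"
    by (auto dest!: eventually_happens)
  have "integrable ?M (\<lambda>x. ?f x * indicator (collar \<Omega> (\<Lambda> * ?h n)) x)"
    using integrable_mult_indicator[OF c int, of "\<Lambda> * ?h n"]
    by (simp only: real_scaleR_def mult.commute[of "(norm _)\<^sup>2"])
  then have "(\<integral>\<^sup>+x. ennreal (?f x * indicator (collar \<Omega> (\<Lambda> * ?h n)) x) \<partial>?M) =
      ennreal (\<integral>x. ?f x * indicator (collar \<Omega> (\<Lambda> * ?h n)) x \<partial>?M)"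
    by (rule nn_integral_eq_integral) auto
  moreover have "ennreal (?f x * indicator (collar \<Omega> (\<Lambda> * ?h n)) x) =
      ennreal (?f x) * indicator (collar \<Omega> (\<Lambda> * ?h n)) x" for x by (simp add: indicator_def)
  ultimately have "(\<integral>\<^sup>+x. ennreal (?f x) * indicator (collar \<Omega> (\<Lambda> * ?h n)) x \<partial>?M) < ennreal \<delta>"
    using n(1) pos(3) by (simp add: ennreal_lessI)
  then show thesis using that[of "?h n"] n(2) by simp
qed

text \<open>
  The trace provides smooth functions \<open>\<phi>\<^sub>k\<close> that converge to \<open>v\<close> in \<open>H\<^sup>1(\<Omega>)\<close> and to \<open>0\<close> in
  \<open>L\<^sup>2(\<partial>\<Omega>)\<close>. The width \<open>h\<close> of the cutoff is chosen first, so that the energy of \<open>v\<close> in the collar is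
  small; with \<open>h\<close> fixed, a large \<open>k\<close> makes the boundary term small in spite of its factor \<open>1/h\<close>.
\<close>

lemma zero_trace_approximation:
  fixes \<Omega> :: "'a::euclidean_space set"
  assumes \<Omega>: "bounded_lipschitz_domain \<Omega>" and v: "is_trace \<Omega> v g"
    and g0: "AE x in surface_measure \<Omega>. g x = 0" and \<epsilon>: "0 < \<epsilon>"
  shows "\<exists>\<psi>\<in>test_functions \<Omega>. L2_norm (lebesgue_on \<Omega>) (\<lambda>x. \<psi> x - v x) < \<epsilon> \<and>
    L2_norm (lebesgue_on \<Omega>) (\<lambda>x. grad \<psi> x - weak_gradient \<Omega> v x) < \<epsilon>"
proof -
  have op: "open \<Omega>" and bd: "bounded \<Omega>" using \<Omega> by (auto simp: bounded_lipschitz_domain_def)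
  let ?M = "lebesgue_on \<Omega>" and ?W = "weak_gradient \<Omega> v"
  obtain \<phi> :: "nat \<Rightarrow> 'a \<Rightarrow> real" where vH: "v \<in> H1_space \<Omega>" and \<phi>: "\<And>k. smooth (\<phi> k)"
    and H1: "(\<lambda>k. H1_norm \<Omega> (\<lambda>x. \<phi> k x - v x)) \<longlonglongrightarrow> 0"
    and S: "(\<lambda>k. \<integral>\<^sup>+x. ennreal ((\<phi> k x - g x)\<^sup>2) \<partial>surface_measure \<Omega>) \<longlonglongrightarrow> 0"
    using v by (auto simp: is_trace_def)
  have \<phi>1: "Ck (Suc 0) (\<phi> k)" for k by (rule smooth_Ck[OF \<phi>])
  have vL: "v \<in> L2_space ?M" using vH by (simp add: H1_space_def)
  note W = weak_gradient_H1[OF op vH]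
  note \<phi>L = C1_H1(3)[OF op bd \<phi>1] C1_H1(4)[OF op bd \<phi>1]
  have "(\<integral>\<^sup>+x. ennreal ((\<phi> k x - g x)\<^sup>2) \<partial>surface_measure \<Omega>) = (\<integral>\<^sup>+x. ennreal ((\<phi> k x)\<^sup>2) \<partial>surface_measure \<Omega>)" for k
    by (intro nn_integral_cong_AE) (use g0 in eventually_elim, simp)
  then have S0: "(\<lambda>k. \<integral>\<^sup>+x. ennreal ((\<phi> k x)\<^sup>2) \<partial>surface_measure \<Omega>) \<longlonglongrightarrow> 0" using S by simp
  obtain C \<Lambda> h0 where C: "0 < C" and \<Lambda>: "1 \<le> \<Lambda>" and h0: "0 < h0"
    and cut: "\<And>h. 0 < h \<Longrightarrow> h < h0 \<Longrightarrow> \<exists>\<eta>\<in>test_functions \<Omega>. \<forall>\<phi>. smooth \<phi> \<longrightarrow>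
      (\<integral>\<^sup>+x. ennreal ((\<phi> x * \<eta> x - \<phi> x)\<^sup>2) * indicator \<Omega> x \<partial>lborel) \<le>
        collar_energy \<Omega> (C / h) C (\<Lambda> * h) \<phi> \<and>
      (\<integral>\<^sup>+x. ennreal ((norm (grad (\<lambda>x. \<phi> x * \<eta> x) x - grad \<phi> x))\<^sup>2) * indicator \<Omega> x \<partial>lborel) \<le>
        collar_energy \<Omega> (C / h) C (\<Lambda> * h) \<phi>"
  proof (rule cutoff_error[OF \<Omega>], goal_cases)
    case (1 C \<Lambda> h0)
    show ?case by (rule 1(1)[OF 1(2-)])
  qed
  \<comment> \<open>The squared cutoff error will be at most \<open>2 C \<delta>\<close> (boundary) plus \<open>4 C \<delta>\<close> (collar), that is
    \<open>(\<epsilon> / 2)\<^sup>2\<close>; the other half of \<open>\<epsilon>\<close> pays for replacing \<open>v\<close> by \<open>\<phi>\<^sub>k\<close>.\<close>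
  define \<delta> where "\<delta> = \<epsilon>\<^sup>2 / (24 * C)"
  have \<delta>: "0 < \<delta>" using \<epsilon> C by (simp add: \<delta>_def)
  obtain h where h: "0 < h" "h < h0"
    and small: "(\<integral>\<^sup>+x. ennreal ((norm (?W x))\<^sup>2) * indicator (collar \<Omega> (\<Lambda> * h)) x \<partial>?M) < ennreal \<delta>"
    using collar_energy_small[OF op bd W(2) _ h0 \<delta>, of \<Lambda>] \<Lambda> by (metis less_le_trans zero_less_one)
  obtain \<eta> where \<eta>: "\<eta> \<in> test_functions \<Omega>"
    and err: "\<And>\<phi>. smooth \<phi> \<Longrightarrow>
      (\<integral>\<^sup>+x. ennreal ((\<phi> x * \<eta> x - \<phi> x)\<^sup>2) * indicator \<Omega> x \<partial>lborel) \<le>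
        collar_energy \<Omega> (C / h) C (\<Lambda> * h) \<phi> \<and>
      (\<integral>\<^sup>+x. ennreal ((norm (grad (\<lambda>x. \<phi> x * \<eta> x) x - grad \<phi> x))\<^sup>2) * indicator \<Omega> x \<partial>lborel) \<le>
        collar_energy \<Omega> (C / h) C (\<Lambda> * h) \<phi>"
    using cut[OF h] by blast
  have e1: "\<forall>\<^sub>F k in sequentially. H1_norm \<Omega> (\<lambda>x. \<phi> k x - v x) < min (\<epsilon> / 2) (sqrt \<delta>)"
    by (rule order_tendstoD(2)[OF H1]) (use \<epsilon> \<delta> in auto)
  have "(\<lambda>k. ennreal (C / h) * (\<integral>\<^sup>+x. ennreal ((\<phi> k x)\<^sup>2) \<partial>surface_measure \<Omega>)) \<longlonglongrightarrow> ennreal (C / h) * 0"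
    by (intro ennreal_tendsto_cmult S0) simp
  then have e2: "\<forall>\<^sub>F k in sequentially. ennreal (C / h) * (\<integral>\<^sup>+x. ennreal ((\<phi> k x)\<^sup>2) \<partial>surface_measure \<Omega>) < ennreal (2 * C * \<delta>)"
    using C \<delta> by (intro order_tendstoD) auto
  obtain k where k1: "H1_norm \<Omega> (\<lambda>x. \<phi> k x - v x) < min (\<epsilon> / 2) (sqrt \<delta>)"
    and k2: "ennreal (C / h) * (\<integral>\<^sup>+x. ennreal ((\<phi> k x)\<^sup>2) \<partial>surface_measure \<Omega>) < ennreal (2 * C * \<delta>)"
    using eventually_happens[OF eventually_conj[OF e1 e2]] by auto
  let ?p = "\<phi> k"
  have [measurable]: "?p \<in> borel_measurable borel" "grad ?p \<in> borel_measurable borel"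
    by (intro borel_measurable_continuous_onI Ck_imp_continuous[OF \<phi>1] continuous_grad[OF \<phi>1])+
  have n1: "L2_norm ?M (\<lambda>x. ?p x - v x) < \<epsilon> / 2"
    using H1_norm_diff_C1(1)[OF op bd \<phi>1 vH, of k] k1 by simp
  have n2: "L2_norm ?M (\<lambda>x. grad ?p x - ?W x) < \<epsilon> / 2" "L2_norm ?M (\<lambda>x. grad ?p x - ?W x) < sqrt \<delta>"
    using H1_norm_diff_C1(2)[OF op bd \<phi>1 vH, of k] k1 by auto
  let ?c = "\<lambda>x. indicator (collar \<Omega> (\<Lambda> * h)) x :: ennreal"
  have cb: "collar \<Omega> (\<Lambda> * h) \<in> sets borel" by (rule borel_collar[OF op])
  note [measurable] = cb
  have cM: "?c \<in> borel_measurable ?M"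
    using cb op by (intro borel_measurable_indicator) (auto simp: sets_restrict_space_iff collar_def)
  have WM: "?W \<in> borel_measurable ?M" "(\<lambda>x. grad ?p x - ?W x) \<in> borel_measurable ?M"
    using W(2) L2_diff[OF \<phi>L(2) W(2)] by (auto simp: L2_space_def)
  have Gle: "(\<integral>\<^sup>+x. ennreal ((norm (grad ?p x))\<^sup>2) * ?c x \<partial>lborel) \<le> ennreal (4 * \<delta>)"
  proof -
    have "(\<integral>\<^sup>+x. ennreal ((norm (grad ?p x))\<^sup>2) * ?c x \<partial>lborel) =
        (\<integral>\<^sup>+x. (ennreal ((norm (grad ?p x))\<^sup>2) * ?c x) * indicator \<Omega> x \<partial>lborel)"
      by (intro nn_integral_cong) (auto simp: indicator_def collar_def)
    also have "\<dots> = (\<integral>\<^sup>+x. ennreal ((norm (grad ?p x))\<^sup>2) * ?c x \<partial>?M)"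
      by (rule nn_integral_lebesgue_on_borel[OF op, symmetric]) measurable
    also have "\<dots> \<le> (\<integral>\<^sup>+x. ennreal 2 * (ennreal ((norm (?W x))\<^sup>2) * ?c x) +
        ennreal 2 * ennreal ((norm (grad ?p x - ?W x))\<^sup>2) \<partial>?M)"
    proof (rule nn_integral_mono)
      fix x
      have "norm (grad ?p x) \<le> norm (?W x) + norm (grad ?p x - ?W x)"
        using norm_triangle_ineq[of "?W x" "grad ?p x - ?W x"] by simp
      then have "(norm (grad ?p x))\<^sup>2 \<le> (norm (?W x) + norm (grad ?p x - ?W x))\<^sup>2"
        by (intro power_mono) auto
      also have "\<dots> \<le> 2 * (norm (?W x))\<^sup>2 + 2 * (norm (grad ?p x - ?W x))\<^sup>2"
        using sum_squares_bound[of "norm (?W x)" "norm (grad ?p x - ?W x)"] by (simp add: power2_sum)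
      finally have "ennreal ((norm (grad ?p x))\<^sup>2) \<le> ennreal (2 * (norm (?W x))\<^sup>2 + 2 * (norm (grad ?p x - ?W x))\<^sup>2)"
        by (rule ennreal_leI)
      also have "\<dots> = ennreal 2 * ennreal ((norm (?W x))\<^sup>2) + ennreal 2 * ennreal ((norm (grad ?p x - ?W x))\<^sup>2)"
        by (subst ennreal_plus) (auto simp: ennreal_mult)
      finally show "ennreal ((norm (grad ?p x))\<^sup>2) * ?c x \<le> ennreal 2 * (ennreal ((norm (?W x))\<^sup>2) * ?c x) +
        ennreal 2 * ennreal ((norm (grad ?p x - ?W x))\<^sup>2)" by (simp add: indicator_def)
    qed
    also have "\<dots> = ennreal 2 * (\<integral>\<^sup>+x. ennreal ((norm (?W x))\<^sup>2) * ?c x \<partial>?M) +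
        ennreal 2 * (\<integral>\<^sup>+x. ennreal ((norm (grad ?p x - ?W x))\<^sup>2) \<partial>?M)"
      using WM cM by (subst nn_integral_add) (auto simp: nn_integral_cmult simp del: ennreal_numeral)
    also have "(\<integral>\<^sup>+x. ennreal ((norm (grad ?p x - ?W x))\<^sup>2) \<partial>?M) = ennreal ((L2_norm ?M (\<lambda>x. grad ?p x - ?W x))\<^sup>2)"
      by (rule ennreal_L2_norm_sq[symmetric, OF L2_diff[OF \<phi>L(2) W(2)]])
    also have "\<dots> \<le> ennreal \<delta>"
      using power_mono[OF less_imp_le[OF n2(2)] L2_norm_nonneg, of 2] \<delta> by (intro ennreal_leI) simp
    also have "ennreal 2 * (\<integral>\<^sup>+x. ennreal ((norm (?W x))\<^sup>2) * ?c x \<partial>?M) + ennreal 2 * ennreal \<delta> \<le>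
        ennreal 2 * ennreal \<delta> + ennreal 2 * ennreal \<delta>"
      using small by (intro add_right_mono mult_left_mono) auto
    also have "\<dots> = ennreal (4 * \<delta>)"
      using \<delta> by (simp add: ennreal_mult[symmetric] ennreal_plus[symmetric] del: ennreal_plus ennreal_numeral)
    finally show ?thesis by (simp add: add_left_mono mult_left_mono)
  qed
  let ?\<psi> = "\<lambda>x. ?p x * \<eta> x"
  have \<psi>s: "smooth ?\<psi>" by (intro smooth_mult \<phi> test_function_smooth[OF \<eta>])
  have \<psi>1: "Ck (Suc 0) ?\<psi>" by (rule smooth_Ck[OF \<psi>s])
  have \<psi>t: "?\<psi> \<in> test_functions \<Omega>"
  proof (rule test_functionI[OF \<psi>s])
    show "compact (closure {x. \<eta> x \<noteq> 0})" "closure {x. \<eta> x \<noteq> 0} \<subseteq> \<Omega>"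
      using \<eta> by (auto simp: test_functions_def)
    show "?\<psi> x = 0" if "x \<notin> closure {x. \<eta> x \<noteq> 0}" for x
      using eq_0_outside_support[OF that] by simp
  qed
  note \<psi>L = C1_H1(3)[OF op bd \<psi>1] C1_H1(4)[OF op bd \<psi>1]
  have [measurable]: "\<eta> \<in> borel_measurable borel" "?\<psi> \<in> borel_measurable borel" "grad ?\<psi> \<in> borel_measurable borel"
    using test_function_smooth[OF \<eta>]
    by (intro borel_measurable_continuous_onI Ck_imp_continuous[of 0] continuous_grad \<psi>1 smooth_Ck \<psi>s; simp)+
  have E: "collar_energy \<Omega> (C / h) C (\<Lambda> * h) ?p \<le> ennreal ((\<epsilon> / 2)\<^sup>2)"
  proof -
    have "collar_energy \<Omega> (C / h) C (\<Lambda> * h) ?p \<le> ennreal (2 * C * \<delta>) + ennreal C * ennreal (4 * \<delta>)"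
      unfolding collar_energy_def using k2 by (intro add_mono mult_left_mono Gle) auto
    also have "\<dots> = ennreal (6 * C * \<delta>)"
      using C \<delta> by (simp add: ennreal_mult[symmetric] ennreal_plus[symmetric] del: ennreal_plus)
    also have "6 * C * \<delta> = (\<epsilon> / 2)\<^sup>2" using C by (simp add: \<delta>_def power_divide)
    finally show ?thesis .
  qed
  have le: "L2_norm ?M F \<le> \<epsilon> / 2" if F: "F \<in> L2_space ?M" "F \<in> borel_measurable borel"
    and b: "(\<integral>\<^sup>+x. ennreal ((norm (F x))\<^sup>2) * indicator \<Omega> x \<partial>lborel) \<le> ennreal ((\<epsilon> / 2)\<^sup>2)"
    for F :: "'a \<Rightarrow> 'b::euclidean_space"
  proof (rule power2_le_imp_le)
    have "ennreal ((L2_norm ?M F)\<^sup>2) = (\<integral>\<^sup>+x. ennreal ((norm (F x))\<^sup>2) * indicator \<Omega> x \<partial>lborel)"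
      using F by (simp add: ennreal_L2_norm_sq nn_integral_lebesgue_on_borel[OF op])
    also note b
    finally show "(L2_norm ?M F)\<^sup>2 \<le> (\<epsilon> / 2)\<^sup>2" by (simp add: ennreal_le_iff)
  qed (use \<epsilon> in simp)
  have "L2_norm ?M (\<lambda>x. ?\<psi> x - ?p x) \<le> \<epsilon> / 2"
    using err[OF \<phi>, of k] E by (intro le L2_diff \<psi>L \<phi>L) (auto intro: order_trans)
  then have a: "L2_norm ?M (\<lambda>x. ?\<psi> x - v x) < \<epsilon>"
    using L2_norm_triangle_diff[OF \<psi>L(1) \<phi>L(1)[of k] vL] n1 by simp
  have "L2_norm ?M (\<lambda>x. grad ?\<psi> x - grad ?p x) \<le> \<epsilon> / 2"
    using err[OF \<phi>, of k] E by (intro le L2_diff \<psi>L \<phi>L) (auto intro: order_trans)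
  then have b: "L2_norm ?M (\<lambda>x. grad ?\<psi> x - ?W x) < \<epsilon>"
    using L2_norm_triangle_diff[OF \<psi>L(2) \<phi>L(2)[of k] W(2)] n2 by simp
  show ?thesis by (intro bexI[OF _ \<psi>t] conjI a b)
qed

section \<open>Integration by parts against functions with zero trace\<close>

text \<open>
  The closure of the test functions in \<open>H\<^sup>1(\<Omega>)\<close>, in terms of approximating sequences.
\<close>

definition H10_space :: "'a::euclidean_space set \<Rightarrow> ('a \<Rightarrow> real) set" where
  "H10_space \<Omega> = {v \<in> H1_space \<Omega>. \<exists>\<psi>. (\<forall>k. \<psi> k \<in> test_functions \<Omega>) \<and>
     (\<lambda>k. L2_norm (lebesgue_on \<Omega>) (\<lambda>x. \<psi> k x - v x)) \<longlonglongrightarrow> 0 \<and>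
     (\<lambda>k. L2_norm (lebesgue_on \<Omega>) (\<lambda>x. grad (\<psi> k) x - weak_gradient \<Omega> v x)) \<longlonglongrightarrow> 0}"

lemma zero_trace_H10:
  assumes \<Omega>: "bounded_lipschitz_domain \<Omega>" and v: "is_trace \<Omega> v g"
    and g0: "AE x in surface_measure \<Omega>. g x = 0"
  shows "v \<in> H10_space \<Omega>"
proof -
  let ?M = "lebesgue_on \<Omega>"
  have "\<exists>\<psi>\<in>test_functions \<Omega>. L2_norm ?M (\<lambda>x. \<psi> x - v x) < inverse (real (Suc k)) \<and>
    L2_norm ?M (\<lambda>x. grad \<psi> x - weak_gradient \<Omega> v x) < inverse (real (Suc k))" for k
    by (rule zero_trace_approximation[OF \<Omega> v g0]) simp
  then obtain \<psi> where \<psi>: "\<And>k. \<psi> k \<in> test_functions \<Omega>"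
    "\<And>k. L2_norm ?M (\<lambda>x. \<psi> k x - v x) < inverse (real (Suc k))"
    "\<And>k. L2_norm ?M (\<lambda>x. grad (\<psi> k) x - weak_gradient \<Omega> v x) < inverse (real (Suc k))"
    by metis
  have "(\<lambda>k. L2_norm ?M (\<lambda>x. \<psi> k x - v x)) \<longlonglongrightarrow> 0"
    by (rule tendsto_sandwich[OF _ _ tendsto_const LIMSEQ_inverse_real_of_nat])
      (auto simp: L2_norm_nonneg less_imp_le[OF \<psi>(2)] simp del: of_nat_Suc)
  moreover have "(\<lambda>k. L2_norm ?M (\<lambda>x. grad (\<psi> k) x - weak_gradient \<Omega> v x)) \<longlonglongrightarrow> 0"
    by (rule tendsto_sandwich[OF _ _ tendsto_const LIMSEQ_inverse_real_of_nat])
      (auto simp: L2_norm_nonneg less_imp_le[OF \<psi>(3)] simp del: of_nat_Suc)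
  ultimately show ?thesis using \<psi>(1) v by (auto simp: H10_space_def is_trace_def)
qed

lemma H10_limit:
  assumes "v \<in> H10_space \<Omega>"
  obtains \<psi> where "\<And>k. \<psi> k \<in> test_functions \<Omega>"
    "(\<lambda>k. L2_norm (lebesgue_on \<Omega>) (\<lambda>x. \<psi> k x - v x)) \<longlonglongrightarrow> 0"
    "(\<lambda>k. L2_norm (lebesgue_on \<Omega>) (\<lambda>x. grad (\<psi> k) x - weak_gradient \<Omega> v x)) \<longlonglongrightarrow> 0"
  using assms by (auto simp: H10_space_def)

lemma test_function_L2:
  assumes "open \<Omega>" "bounded \<Omega>" "\<psi> \<in> test_functions \<Omega>"
  shows "\<psi> \<in> L2_space (lebesgue_on \<Omega>)" "grad \<psi> \<in> L2_space (lebesgue_on \<Omega>)"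
  using C1_H1(3,4)[OF assms(1,2) smooth_Ck[OF test_function_smooth[OF assms(3)]]] by auto

lemma test_function_diff:
  assumes "\<psi> \<in> test_functions \<Omega>" "\<theta> \<in> test_functions \<Omega>"
  shows "(\<lambda>x. \<psi> x - \<theta> x) \<in> test_functions \<Omega>"
proof -
  let ?K = "closure {x. \<psi> x \<noteq> 0} \<union> closure {x. \<theta> x \<noteq> 0}"
  have K: "compact ?K" "?K \<subseteq> \<Omega>" using assms by (auto simp: test_functions_def)
  show ?thesis
  proof (rule test_functionI[OF smooth_diff[OF assms[THEN test_function_smooth]] K])
    fix x assume "x \<notin> ?K"
    then show "\<psi> x - \<theta> x = 0"
      using eq_0_outside_support[of x \<psi>] eq_0_outside_support[of x \<theta>] by simp
  qed
qed

lemma test_function_square: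
  assumes "\<psi> \<in> test_functions \<Omega>"
  shows "(\<lambda>x. \<psi> x * \<psi> x) \<in> test_functions \<Omega>"
proof -
  have "{x. \<psi> x * \<psi> x \<noteq> 0} = {x. \<psi> x \<noteq> 0}" by auto
  then show ?thesis using assms smooth_mult by (auto simp: test_functions_def)
qed

lemma L2_norm_diff_diff_le:
  assumes "f \<in> L2_space M" "f' \<in> L2_space M" "g \<in> L2_space M" "g' \<in> L2_space M"
  shows "L2_norm M (\<lambda>x. (f x - g x) - (f' x - g' x)) \<le>
    L2_norm M (\<lambda>x. f x - f' x) + L2_norm M (\<lambda>x. g x - g' x)"
proof -
  have "L2_norm M (\<lambda>x. (f x - f' x) - (g x - g' x)) \<le>
      L2_norm M (\<lambda>x. (f x - f' x) - 0) + L2_norm M (\<lambda>x. 0 - (g x - g' x))"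
    by (intro L2_norm_triangle_diff L2_diff assms) (simp add: L2_space_def)
  then show ?thesis
    using L2_norm_minus_commute[of M g' g] by (simp add: algebra_simps)
qed

lemma H10_diff:
  assumes \<Omega>: "open \<Omega>" "bounded \<Omega>" and v: "v \<in> H10_space \<Omega>" and w: "w \<in> H10_space \<Omega>"
  shows "(\<lambda>x. v x - w x) \<in> H10_space \<Omega>"
proof -
  let ?M = "lebesgue_on \<Omega>"
  obtain \<psi> where \<psi>: "\<And>k. \<psi> k \<in> test_functions \<Omega>"
    "(\<lambda>k. L2_norm ?M (\<lambda>x. \<psi> k x - v x)) \<longlonglongrightarrow> 0"
    "(\<lambda>k. L2_norm ?M (\<lambda>x. grad (\<psi> k) x - weak_gradient \<Omega> v x)) \<longlonglongrightarrow> 0"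
    using H10_limit[OF v] by blast
  obtain \<theta> where \<theta>: "\<And>k. \<theta> k \<in> test_functions \<Omega>"
    "(\<lambda>k. L2_norm ?M (\<lambda>x. \<theta> k x - w x)) \<longlonglongrightarrow> 0"
    "(\<lambda>k. L2_norm ?M (\<lambda>x. grad (\<theta> k) x - weak_gradient \<Omega> w x)) \<longlonglongrightarrow> 0"
    using H10_limit[OF w] by blast
  have vw: "v \<in> H1_space \<Omega>" "w \<in> H1_space \<Omega>" using v w by (auto simp: H10_space_def)
  then have L: "v \<in> L2_space ?M" "w \<in> L2_space ?M" by (auto simp: H1_space_def)
  note W = weak_gradient_H1(2)[OF \<Omega>(1) vw(1)] weak_gradient_H1(2)[OF \<Omega>(1) vw(2)]
  note T = test_function_L2[OF \<Omega> \<psi>(1)] test_function_L2[OF \<Omega> \<theta>(1)]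
  note D = H1_diff[OF \<Omega>(1) vw]
  have 1: "(\<lambda>k. L2_norm ?M (\<lambda>x. (\<psi> k x - \<theta> k x) - (v x - w x))) \<longlonglongrightarrow> 0"
  proof (rule tendsto_sandwich[OF _ _ tendsto_const])
    show "(\<lambda>k. L2_norm ?M (\<lambda>x. \<psi> k x - v x) + L2_norm ?M (\<lambda>x. \<theta> k x - w x)) \<longlonglongrightarrow> 0"
      using tendsto_add[OF \<psi>(2) \<theta>(2)] by simp
  qed (intro always_eventually allI L2_norm_nonneg L2_norm_diff_diff_le T L)+
  have eq: "L2_norm ?M (\<lambda>x. grad (\<lambda>x. \<psi> k x - \<theta> k x) x - weak_gradient \<Omega> (\<lambda>x. v x - w x) x) =
      L2_norm ?M (\<lambda>x. (grad (\<psi> k) x - grad (\<theta> k) x) - (weak_gradient \<Omega> v x - weak_gradient \<Omega> w x))" for k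
  proof (rule L2_AE_cong(2))
    have td: "(\<lambda>x. \<psi> k x - \<theta> k x) \<in> test_functions \<Omega>" by (intro test_function_diff \<psi> \<theta>)
    have "(\<lambda>x. grad (\<lambda>x. \<psi> k x - \<theta> k x) x - weak_gradient \<Omega> (\<lambda>x. v x - w x) x) \<in> L2_space ?M"
      by (intro L2_diff weak_gradient_H1(2)[OF \<Omega>(1) D(1)] test_function_L2(2)[OF \<Omega> td])
    then show "(\<lambda>x. grad (\<lambda>x. \<psi> k x - \<theta> k x) x - weak_gradient \<Omega> (\<lambda>x. v x - w x) x) \<in> borel_measurable ?M"
      by (simp add: L2_space_def)
    show "(\<lambda>x. (grad (\<psi> k) x - grad (\<theta> k) x) - (weak_gradient \<Omega> v x - weak_gradient \<Omega> w x)) \<in> L2_space ?M"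
      by (intro L2_diff T W)
    have g: "grad (\<lambda>x. \<psi> k x - \<theta> k x) x = grad (\<psi> k) x - grad (\<theta> k) x" for x
      by (intro grad_diff smooth_Ck test_function_smooth[OF \<psi>(1)] test_function_smooth[OF \<theta>(1)])
    show "AE x in ?M. grad (\<lambda>x. \<psi> k x - \<theta> k x) x - weak_gradient \<Omega> (\<lambda>x. v x - w x) x =
        (grad (\<psi> k) x - grad (\<theta> k) x) - (weak_gradient \<Omega> v x - weak_gradient \<Omega> w x)"
      using D(2) by eventually_elim (simp add: g)
  qed
  have 2: "(\<lambda>k. L2_norm ?M (\<lambda>x. grad (\<lambda>x. \<psi> k x - \<theta> k x) x - weak_gradient \<Omega> (\<lambda>x. v x - w x) x)) \<longlonglongrightarrow> 0"
    unfolding eq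
  proof (rule tendsto_sandwich[OF _ _ tendsto_const])
    show "(\<lambda>k. L2_norm ?M (\<lambda>x. grad (\<psi> k) x - weak_gradient \<Omega> v x) +
        L2_norm ?M (\<lambda>x. grad (\<theta> k) x - weak_gradient \<Omega> w x)) \<longlonglongrightarrow> 0"
      using tendsto_add[OF \<psi>(3) \<theta>(3)] by simp
  qed (intro always_eventually allI L2_norm_nonneg L2_norm_diff_diff_le T W)+
  show ?thesis
    unfolding H10_space_def using D(1) 1 2 test_function_diff[OF \<psi>(1) \<theta>(1)]
    by (auto intro!: exI[of _ "\<lambda>k x. \<psi> k x - \<theta> k x"])
qed

lemma L2_inner_component:
  assumes "f \<in> L2_space M"
  shows "(\<lambda>x. f x \<bullet> b) \<in> L2_space M"
proof (rule L2_spaceI_AE_bound)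
  show "integrable M (\<lambda>x. (norm (f x))\<^sup>2 * (norm b)\<^sup>2)" using assms by (simp add: L2_space_def)
  show "AE x in M. (norm (f x \<bullet> b))\<^sup>2 \<le> (norm (f x))\<^sup>2 * (norm b)\<^sup>2"
  proof (rule AE_I2)
    fix x
    have "\<bar>f x \<bullet> b\<bar>\<^sup>2 \<le> (norm (f x) * norm b)\<^sup>2" by (intro power_mono Cauchy_Schwarz_ineq2) auto
    then show "(norm (f x \<bullet> b))\<^sup>2 \<le> (norm (f x))\<^sup>2 * (norm b)\<^sup>2" by (simp add: power_mult_distrib)
  qed
qed (use assms in \<open>auto simp: L2_space_def intro!: borel_measurable_inner\<close>)

text \<open>
  For test functions this is the definition of the weak gradient of \<open>G\<close>, and both sides are
  continuous in \<open>v\<close> with respect to the norm of \<open>H\<^sup>1(\<Omega>)\<close>.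
\<close>

lemma H10_integration_by_parts:
  fixes \<Omega> :: "'a::euclidean_space set"
  assumes \<Omega>: "open \<Omega>" "bounded \<Omega>" and v: "v \<in> H10_space \<Omega>" and G: "G \<in> H1_space \<Omega>" and b: "b \<in> Basis"
  shows "(\<integral>x. G x * (weak_gradient \<Omega> v x \<bullet> b) \<partial>lebesgue_on \<Omega>) =
    - (\<integral>x. (weak_gradient \<Omega> G x \<bullet> b) * v x \<partial>lebesgue_on \<Omega>)"
proof -
  let ?M = "lebesgue_on \<Omega>"
  obtain \<psi> where \<psi>: "\<And>k. \<psi> k \<in> test_functions \<Omega>"
    "(\<lambda>k. L2_norm ?M (\<lambda>x. \<psi> k x - v x)) \<longlonglongrightarrow> 0"
    "(\<lambda>k. L2_norm ?M (\<lambda>x. grad (\<psi> k) x - weak_gradient \<Omega> v x)) \<longlonglongrightarrow> 0"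
    using H10_limit[OF v] by blast
  have vH: "v \<in> H1_space \<Omega>" using v by (simp add: H10_space_def)
  have GL: "G \<in> L2_space ?M" and vL: "v \<in> L2_space ?M" using G vH by (auto simp: H1_space_def)
  note W = weak_gradient_H1[OF \<Omega>(1) G] weak_gradient_H1[OF \<Omega>(1) vH]
  note T = test_function_L2[OF \<Omega> \<psi>(1)]
  have Gb: "(\<lambda>x. G x *\<^sub>R b) \<in> L2_space ?M"
    using GL b by (auto simp: L2_space_def)
  have l1: "(\<lambda>k. \<integral>x. grad (\<psi> k) x \<bullet> (G x *\<^sub>R b) \<partial>?M) \<longlonglongrightarrow> (\<integral>x. weak_gradient \<Omega> v x \<bullet> (G x *\<^sub>R b) \<partial>?M)"
    by (rule L2_inner_limit[OF W(4) Gb T(2) \<psi>(3)])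
  have l2: "(\<lambda>k. \<integral>x. \<psi> k x \<bullet> (weak_gradient \<Omega> G x \<bullet> b) \<partial>?M) \<longlonglongrightarrow> (\<integral>x. v x \<bullet> (weak_gradient \<Omega> G x \<bullet> b) \<partial>?M)"
    by (rule L2_inner_limit[OF vL L2_inner_component[OF W(2)] T(1) \<psi>(2)])
  have eq: "(\<integral>x. grad (\<psi> k) x \<bullet> (G x *\<^sub>R b) \<partial>?M) = - (\<integral>x. \<psi> k x \<bullet> (weak_gradient \<Omega> G x \<bullet> b) \<partial>?M)" for k
  proof -
    have "(\<integral>x. G x * frechet_derivative (\<psi> k) (at x) b \<partial>?M) = - (\<integral>x. (weak_gradient \<Omega> G x \<bullet> b) * \<psi> k x \<partial>?M)"
      using W(1) \<psi>(1) b by (simp add: is_weak_gradient_def)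
    then show ?thesis by (simp add: grad_inner_Basis[OF b] mult.commute)
  qed
  have "(\<integral>x. weak_gradient \<Omega> v x \<bullet> (G x *\<^sub>R b) \<partial>?M) = - (\<integral>x. v x \<bullet> (weak_gradient \<Omega> G x \<bullet> b) \<partial>?M)"
    using LIMSEQ_unique[OF l1 tendsto_minus[OF l2, folded eq]] .
  then show ?thesis by (simp add: mult.commute)
qed

section \<open>Bounded coefficients\<close>

lemma L2_dominated:
  fixes F :: "'a \<Rightarrow> 'b::euclidean_space" and f :: "'a \<Rightarrow> 'c::euclidean_space"
  assumes F: "F \<in> borel_measurable M" and f: "f \<in> L2_space M" and K: "0 \<le> K"
    and le: "AE x in M. norm (F x) \<le> K * norm (f x)"
  shows "F \<in> L2_space M" "L2_norm M F \<le> K * L2_norm M f"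
proof -
  have sq: "AE x in M. (norm (F x))\<^sup>2 \<le> K\<^sup>2 * (norm (f x))\<^sup>2"
    using le
  proof eventually_elim
    case (elim x)
    then have "(norm (F x))\<^sup>2 \<le> (K * norm (f x))\<^sup>2" by (intro power_mono) auto
    then show ?case by (simp add: power_mult_distrib)
  qed
  have int: "integrable M (\<lambda>x. K\<^sup>2 * (norm (f x))\<^sup>2)" using f by (simp add: L2_space_def)
  show FL: "F \<in> L2_space M" by (rule L2_spaceI_AE_bound[OF F int sq])
  show "L2_norm M F \<le> K * L2_norm M f"
  proof (rule power2_le_imp_le)
    have "(L2_norm M F)\<^sup>2 \<le> (\<integral>x. K\<^sup>2 * (norm (f x))\<^sup>2 \<partial>M)"
      unfolding L2_norm_sq using FL int sq by (intro integral_mono_AE) (auto simp: L2_space_def)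
    then show "(L2_norm M F)\<^sup>2 \<le> (K * L2_norm M f)\<^sup>2"
      by (simp add: power_mult_distrib L2_norm_sq)
  qed (simp add: K L2_norm_nonneg)
qed

lemma L2_inner_limit2:
  assumes f: "f \<in> L2_space M" and g: "g \<in> L2_space M"
    and fn: "\<And>k. fn k \<in> L2_space M" and gn: "\<And>k. gn k \<in> L2_space M"
    and flim: "(\<lambda>k. L2_norm M (\<lambda>x. fn k x - f x)) \<longlonglongrightarrow> 0"
    and glim: "(\<lambda>k. L2_norm M (\<lambda>x. gn k x - g x)) \<longlonglongrightarrow> 0"
  shows "(\<lambda>k. \<integral>x. fn k x \<bullet> gn k x \<partial>M) \<longlonglongrightarrow> (\<integral>x. f x \<bullet> g x \<partial>M)"
proof -
  have 1: "(\<lambda>k. \<integral>x. (fn k x - f x) \<bullet> (gn k x - g x) \<partial>M) \<longlonglongrightarrow> 0"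
  proof (rule Lim_null_comparison)
    show "\<forall>\<^sub>F k in sequentially. norm (\<integral>x. (fn k x - f x) \<bullet> (gn k x - g x) \<partial>M) \<le>
        L2_norm M (\<lambda>x. fn k x - f x) * L2_norm M (\<lambda>x. gn k x - g x)"
      unfolding real_norm_def by (intro always_eventually allI L2_Cauchy_Schwarz L2_diff fn gn f g)
    show "(\<lambda>k. L2_norm M (\<lambda>x. fn k x - f x) * L2_norm M (\<lambda>x. gn k x - g x)) \<longlonglongrightarrow> 0"
      using tendsto_mult[OF flim glim] by simp
  qed
  have 2: "(\<lambda>k. \<integral>x. fn k x \<bullet> g x \<partial>M) \<longlonglongrightarrow> (\<integral>x. f x \<bullet> g x \<partial>M)"
    by (rule L2_inner_limit[OF f g fn flim])
  have 3: "(\<lambda>k. \<integral>x. f x \<bullet> gn k x \<partial>M) \<longlonglongrightarrow> (\<integral>x. f x \<bullet> g x \<partial>M)"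
    using L2_inner_limit[OF g f gn glim] by (simp add: inner_commute)
  have eq: "(\<integral>x. fn k x \<bullet> gn k x \<partial>M) = (\<integral>x. (fn k x - f x) \<bullet> (gn k x - g x) \<partial>M) +
      (\<integral>x. fn k x \<bullet> g x \<partial>M) + (\<integral>x. f x \<bullet> gn k x \<partial>M) - (\<integral>x. f x \<bullet> g x \<partial>M)" for k
  proof -
    have i: "integrable M (\<lambda>x. fn k x \<bullet> g x)" "integrable M (\<lambda>x. f x \<bullet> gn k x)" "integrable M (\<lambda>x. f x \<bullet> g x)"
      "integrable M (\<lambda>x. fn k x \<bullet> gn k x)"
      by (intro L2_inner_integrable fn gn f g)+
    show ?thesis using i by (simp add: inner_diff_left inner_diff_right)
  qed
  have "(\<lambda>k. \<integral>x. fn k x \<bullet> gn k x \<partial>M) \<longlonglongrightarrow> 0 + (\<integral>x. f x \<bullet> g x \<partial>M) + (\<integral>x. f x \<bullet> g x \<partial>M) - (\<integral>x. f x \<bullet> g x \<partial>M)"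
    unfolding eq by (intro tendsto_intros 1 2 3)
  then show ?thesis by simp
qed

lemma Linf_vector:
  fixes \<beta> :: "'a \<Rightarrow> 'b::euclidean_space"
  assumes "\<And>b. b \<in> Basis \<Longrightarrow> (\<lambda>x. \<beta> x \<bullet> b) \<in> Linf_space M"
  shows "\<beta> \<in> Linf_space M"
proof -
  have "\<forall>b\<in>Basis. \<exists>K. AE x in M. \<bar>\<beta> x \<bullet> b\<bar> \<le> K"
    using assms by (simp add: Linf_space_def)
  then obtain K where "\<And>b. b \<in> Basis \<Longrightarrow> AE x in M. \<bar>\<beta> x \<bullet> b\<bar> \<le> K b"
    unfolding bchoice_iff by blast
  then have "AE x in M. \<forall>b\<in>Basis. \<bar>\<beta> x \<bullet> b\<bar> \<le> K b"
    by (subst AE_ball_countable) (auto intro: countable_finite)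
  then have "AE x in M. norm (\<beta> x) \<le> (\<Sum>b\<in>Basis. K b)"
  proof eventually_elim
    case (elim x)
    have "norm (\<beta> x) \<le> (\<Sum>b\<in>Basis. \<bar>\<beta> x \<bullet> b\<bar>)" by (rule norm_le_l1)
    also have "\<dots> \<le> (\<Sum>b\<in>Basis. K b)" using elim by (intro sum_mono) auto
    finally show ?case .
  qed
  moreover have "\<beta> \<in> borel_measurable M"
    using assms by (subst borel_measurable_euclidean_space) (auto simp: Linf_space_def)
  ultimately show ?thesis by (auto simp: Linf_space_def)
qed

lemma Linf_bound:
  assumes "m \<in> Linf_space M"
  obtains K where "0 \<le> K" "AE x in M. norm (m x) \<le> K"
proof -
  obtain K where "AE x in M. norm (m x) \<le> K" using assms by (auto simp: Linf_space_def)
  then have "AE x in M. norm (m x) \<le> max 0 K" by eventually_elim simp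
  then show thesis by (intro that[of "max 0 K"]) auto
qed

lemma Linf_inner_L2:
  assumes m: "m \<in> Linf_space M" and f: "f \<in> L2_space M"
  shows "(\<lambda>x. m x \<bullet> f x) \<in> L2_space M"
proof -
  obtain K where K: "0 \<le> K" "AE x in M. norm (m x) \<le> K" using Linf_bound[OF m] .
  have "AE x in M. norm (m x \<bullet> f x) \<le> K * norm (f x)"
    using K(2)
  proof eventually_elim
    case (elim x)
    show ?case
      using Cauchy_Schwarz_ineq2[of "m x" "f x"] mult_right_mono[OF elim norm_ge_zero[of "f x"]] by simp
  qed
  moreover have "(\<lambda>x. m x \<bullet> f x) \<in> borel_measurable M"
    using m f by (auto simp: Linf_space_def L2_space_def intro!: borel_measurable_inner)
  ultimately show ?thesis by (intro L2_dominated(1)[OF _ f K(1)])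
qed

lemma Linf_inner_L2_limit:
  assumes m: "m \<in> Linf_space M" and f: "f \<in> L2_space M" and fn: "\<And>k. fn k \<in> L2_space M"
    and lim: "(\<lambda>k. L2_norm M (\<lambda>x. fn k x - f x)) \<longlonglongrightarrow> 0"
  shows "(\<lambda>k. L2_norm M (\<lambda>x. m x \<bullet> fn k x - m x \<bullet> f x)) \<longlonglongrightarrow> 0"
proof -
  obtain K where K: "0 \<le> K" "AE x in M. norm (m x) \<le> K" using Linf_bound[OF m] .
  have le: "L2_norm M (\<lambda>x. m x \<bullet> fn k x - m x \<bullet> f x) \<le> K * L2_norm M (\<lambda>x. fn k x - f x)" for k
  proof (rule L2_dominated(2)[OF _ L2_diff[OF fn f] K(1)])
    show "(\<lambda>x. m x \<bullet> fn k x - m x \<bullet> f x) \<in> borel_measurable M"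
      using L2_diff[OF Linf_inner_L2[OF m fn] Linf_inner_L2[OF m f]] by (simp add: L2_space_def)
    show "AE x in M. norm (m x \<bullet> fn k x - m x \<bullet> f x) \<le> K * norm (fn k x - f x)"
      using K(2)
    proof eventually_elim
      case (elim x)
      show ?case
        using Cauchy_Schwarz_ineq2[of "m x" "fn k x - f x"]
          mult_right_mono[OF elim norm_ge_zero[of "fn k x - f x"]] by (simp add: inner_diff_right)
    qed
  qed
  show ?thesis
    by (rule tendsto_sandwich[OF _ _ tendsto_const, of _ _ _ "\<lambda>k. K * L2_norm M (\<lambda>x. fn k x - f x)"])
      (use le tendsto_mult_left[OF lim, of K] in \<open>auto simp: L2_norm_nonneg\<close>)
qed

lemma W1inf_weak_gradient:
  assumes \<Omega>: "open \<Omega>" and v: "v \<in> W1inf_space \<Omega>"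
  shows "is_weak_gradient \<Omega> v (weak_gradient \<Omega> v)" "weak_gradient \<Omega> v \<in> Linf_space (lebesgue_on \<Omega>)"
proof -
  obtain g where g: "is_weak_gradient \<Omega> v g" "g \<in> Linf_space (lebesgue_on \<Omega>)"
    using v by (auto simp: W1inf_space_def)
  show "is_weak_gradient \<Omega> v (weak_gradient \<Omega> v)" by (rule is_weak_gradient_weak_gradient[OF g(1)])
  have AE: "AE x in lebesgue_on \<Omega>. weak_gradient \<Omega> v x = g x" by (rule weak_gradient_AE_eq[OF \<Omega> g(1)])
  have gm: "g \<in> borel_measurable (lebesgue_on \<Omega>)" using g(2) by (simp add: Linf_space_def)
  obtain K where "AE x in lebesgue_on \<Omega>. norm (g x) \<le> K" using g(2) by (auto simp: Linf_space_def)
  then have "AE x in lebesgue_on \<Omega>. norm (weak_gradient \<Omega> v x) \<le> K" using AE by eventually_elim simp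
  then show "weak_gradient \<Omega> v \<in> Linf_space (lebesgue_on \<Omega>)"
    using borel_measurable_lebesgue_on_AE[OF gm \<Omega> AE] by (auto simp: Linf_space_def)
qed

lemma weak_divergence_Linf:
  fixes \<Omega> :: "'a::euclidean_space set"
  assumes \<Omega>: "open \<Omega>" and \<beta>: "\<And>b. b \<in> Basis \<Longrightarrow> (\<lambda>x. \<beta> x \<bullet> b) \<in> W1inf_space \<Omega>"
  shows "weak_divergence \<Omega> \<beta> \<in> Linf_space (lebesgue_on \<Omega>)"
proof -
  let ?M = "lebesgue_on \<Omega>" and ?W = "\<lambda>b. weak_gradient \<Omega> (\<lambda>y. \<beta> y \<bullet> b)"
  have W: "?W b \<in> Linf_space ?M" if "b \<in> Basis" for b using W1inf_weak_gradient(2)[OF \<Omega> \<beta>[OF that]] .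
  have meas: "weak_divergence \<Omega> \<beta> \<in> borel_measurable ?M"
    unfolding weak_divergence_def using W
    by (intro borel_measurable_sum borel_measurable_inner) (auto simp: Linf_space_def)
  have "\<forall>b\<in>Basis. \<exists>K. AE x in ?M. norm (?W b x) \<le> K" using W by (auto simp: Linf_space_def)
  then obtain K where "\<And>b. b \<in> Basis \<Longrightarrow> AE x in ?M. norm (?W b x) \<le> K b"
    unfolding bchoice_iff by blast
  then have "AE x in ?M. \<forall>b\<in>Basis. norm (?W b x) \<le> K b"
    by (subst AE_ball_countable) (auto intro: countable_finite)
  then have "AE x in ?M. norm (weak_divergence \<Omega> \<beta> x) \<le> (\<Sum>b\<in>Basis. K b)"
  proof eventually_elim
    case (elim x)
    have "norm (weak_divergence \<Omega> \<beta> x) \<le> (\<Sum>b\<in>Basis. norm (?W b x \<bullet> b))"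
      unfolding weak_divergence_def by (rule norm_sum)
    also have "\<dots> \<le> (\<Sum>b\<in>Basis. K b)"
    proof (rule sum_mono)
      fix b :: 'a assume b: "b \<in> Basis"
      then show "norm (?W b x \<bullet> b) \<le> K b" using Basis_le_norm[OF b, of "?W b x"] elim by force
    qed
    finally show ?case .
  qed
  then show ?thesis using meas by (auto simp: Linf_space_def)
qed

section \<open>The error estimate\<close>

text \<open>
  The advective term is skew-symmetric up to the divergence. For a test function \<open>\<phi>\<close>, testing the weak
  gradients of the components of \<open>\<beta>\<close> with \<open>\<phi>\<^sup>2\<close> gives the identity, because
  \<open>\<nabla>(\<phi>\<^sup>2) = 2 \<phi> \<nabla>\<phi>\<close>; it passes to limits since \<open>\<beta>\<close> and its divergence are bounded.
\<close>

lemma advection_identity: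
  fixes \<Omega> :: "'a::euclidean_space set"
  assumes \<Omega>: "open \<Omega>" "bounded \<Omega>" and \<beta>: "\<And>b. b \<in> Basis \<Longrightarrow> (\<lambda>x. \<beta> x \<bullet> b) \<in> W1inf_space \<Omega>"
    and v: "v \<in> H10_space \<Omega>"
  shows "2 * (\<integral>x. v x * (\<beta> x \<bullet> weak_gradient \<Omega> v x) \<partial>lebesgue_on \<Omega>) =
    - (\<integral>x. v x * (weak_divergence \<Omega> \<beta> x * v x) \<partial>lebesgue_on \<Omega>)"
proof -
  let ?M = "lebesgue_on \<Omega>" and ?W = "\<lambda>b. weak_gradient \<Omega> (\<lambda>y. \<beta> y \<bullet> b)"
  obtain \<psi> where \<psi>: "\<And>k. \<psi> k \<in> test_functions \<Omega>"
    "(\<lambda>k. L2_norm ?M (\<lambda>x. \<psi> k x - v x)) \<longlonglongrightarrow> 0"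
    "(\<lambda>k. L2_norm ?M (\<lambda>x. grad (\<psi> k) x - weak_gradient \<Omega> v x)) \<longlonglongrightarrow> 0"
    using H10_limit[OF v] by blast
  have vH: "v \<in> H1_space \<Omega>" using v by (simp add: H10_space_def)
  then have vL: "v \<in> L2_space ?M" by (simp add: H1_space_def)
  note V = weak_gradient_H1(2)[OF \<Omega>(1) vH]
  note T = test_function_L2[OF \<Omega> \<psi>(1)]
  have \<beta>inf: "\<beta> \<in> Linf_space ?M" by (rule Linf_vector) (use \<beta> in \<open>simp add: W1inf_space_def\<close>)
  note div = weak_divergence_Linf[OF \<Omega>(1) \<beta>]
  have test: "2 * (\<integral>x. \<phi> x * (\<beta> x \<bullet> grad \<phi> x) \<partial>?M) = - (\<integral>x. \<phi> x * (weak_divergence \<Omega> \<beta> x * \<phi> x) \<partial>?M)"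
    if \<phi>: "\<phi> \<in> test_functions \<Omega>" for \<phi>
  proof -
    have \<phi>1: "Ck (Suc 0) \<phi>" by (intro smooth_Ck test_function_smooth[OF \<phi>])
    let ?q = "\<lambda>x. \<phi> x * \<phi> x"
    have q: "?q \<in> test_functions \<Omega>" by (rule test_function_square[OF \<phi>])
    have w: "is_weak_gradient \<Omega> (\<lambda>y. \<beta> y \<bullet> b) (?W b)" if "b \<in> Basis" for b
      using W1inf_weak_gradient(1)[OF \<Omega>(1) \<beta>[OF that]] .
    have loc: "locally_integrable \<Omega> (\<lambda>y. \<beta> y \<bullet> b)" "locally_integrable \<Omega> (\<lambda>x. ?W b x \<bullet> b)" if "b \<in> Basis" for b
      using w[OF that] by (auto simp: is_weak_gradient_def intro: locally_integrable_inner)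
    have "(\<Sum>b\<in>Basis. \<integral>x. (\<beta> x \<bullet> b) * frechet_derivative ?q (at x) b \<partial>?M) =
        (\<Sum>b\<in>Basis. - (\<integral>x. (?W b x \<bullet> b) * ?q x \<partial>?M))"
      using w q by (intro sum.cong refl) (simp add: is_weak_gradient_def)
    moreover have "(\<Sum>b\<in>Basis. \<integral>x. (\<beta> x \<bullet> b) * frechet_derivative ?q (at x) b \<partial>?M) =
        (\<integral>x. (\<Sum>b\<in>Basis. (\<beta> x \<bullet> b) * frechet_derivative ?q (at x) b) \<partial>?M)"
      by (intro Bochner_Integration.integral_sum[symmetric] locally_integrable_mult_test_function(2)[OF \<Omega>(1) loc(1) q])
    moreover have "(\<Sum>b\<in>Basis. (\<beta> x \<bullet> b) * frechet_derivative ?q (at x) b) = 2 * (\<phi> x * (\<beta> x \<bullet> grad \<phi> x))" for x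
    proof -
      have "(\<Sum>b\<in>Basis. (\<beta> x \<bullet> b) * frechet_derivative ?q (at x) b) = \<beta> x \<bullet> grad ?q x"
        by (subst euclidean_inner) (simp add: grad_inner_Basis)
      also have "\<dots> = 2 * (\<phi> x * (\<beta> x \<bullet> grad \<phi> x))"
        by (simp add: grad_mult[OF \<phi>1 \<phi>1] inner_add_right)
      finally show ?thesis .
    qed
    moreover have "(\<Sum>b\<in>Basis. - (\<integral>x. (?W b x \<bullet> b) * ?q x \<partial>?M)) = - (\<integral>x. (\<Sum>b\<in>Basis. (?W b x \<bullet> b) * ?q x) \<partial>?M)"
      unfolding sum_negf
      by (intro arg_cong[where f=uminus] Bochner_Integration.integral_sum[symmetric]
          locally_integrable_mult_test_function(1)[OF \<Omega>(1) loc(2) q])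
    moreover have "(\<Sum>b\<in>Basis. (?W b x \<bullet> b) * ?q x) = \<phi> x * (weak_divergence \<Omega> \<beta> x * \<phi> x)" for x
      by (simp add: weak_divergence_def sum_distrib_right sum_distrib_left mult_ac)
    ultimately show ?thesis by simp
  qed
  have l1: "(\<lambda>k. \<integral>x. \<psi> k x \<bullet> (\<beta> x \<bullet> grad (\<psi> k) x) \<partial>?M) \<longlonglongrightarrow> (\<integral>x. v x \<bullet> (\<beta> x \<bullet> weak_gradient \<Omega> v x) \<partial>?M)"
    by (intro L2_inner_limit2 vL T Linf_inner_L2[OF \<beta>inf] V \<psi> Linf_inner_L2_limit[OF \<beta>inf])
  have l2: "(\<lambda>k. \<integral>x. \<psi> k x \<bullet> (weak_divergence \<Omega> \<beta> x \<bullet> \<psi> k x) \<partial>?M) \<longlonglongrightarrow>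
      (\<integral>x. v x \<bullet> (weak_divergence \<Omega> \<beta> x \<bullet> v x) \<partial>?M)"
    by (intro L2_inner_limit2 vL T Linf_inner_L2[OF div] \<psi> Linf_inner_L2_limit[OF div])
  have eq: "2 * (\<integral>x. \<psi> k x \<bullet> (\<beta> x \<bullet> grad (\<psi> k) x) \<partial>?M) = - (\<integral>x. \<psi> k x \<bullet> (weak_divergence \<Omega> \<beta> x \<bullet> \<psi> k x) \<partial>?M)" for k
    using test[OF \<psi>(1)] by simp
  have "2 * (\<integral>x. v x \<bullet> (\<beta> x \<bullet> weak_gradient \<Omega> v x) \<partial>?M) =
      - (\<integral>x. v x \<bullet> (weak_divergence \<Omega> \<beta> x \<bullet> v x) \<partial>?M)"
    using LIMSEQ_unique[OF tendsto_mult_left[OF l1, of 2, unfolded eq] tendsto_minus[OF l2]] .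
  then show ?thesis by simp
qed

text \<open>
  Integration by parts moves the derivatives from \<open>e\<close> to \<open>\<nabla>u\<close>, so that the pairing is bounded by
  \<open>\<parallel>e\<parallel>\<close> instead of \<open>\<parallel>\<nabla>e\<parallel>\<close>. This is where the \<open>H\<^sup>2\<close> regularity enters and where the full rate \<open>\<epsilon>\<close>
  is gained; the boundary term vanishes because \<open>e\<close> has zero trace on the whole boundary. The
  factor \<open>DIM('a)\<close> comes from summing over coordinates.
\<close>

lemma dirichlet_pairing_bound:
  fixes \<Omega> :: "'a::euclidean_space set"
  assumes \<Omega>: "open \<Omega>" "bounded \<Omega>" and u: "u \<in> H2_space \<Omega>" and e: "e \<in> H10_space \<Omega>"
  shows "\<bar>\<integral>x. weak_gradient \<Omega> u x \<bullet> weak_gradient \<Omega> e x \<partial>lebesgue_on \<Omega>\<bar> \<le>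
    DIM('a) * H2_norm \<Omega> u * L2_norm (lebesgue_on \<Omega>) e"
proof -
  let ?M = "lebesgue_on \<Omega>" and ?U = "weak_gradient \<Omega> u" and ?E = "weak_gradient \<Omega> e"
  let ?H = "\<lambda>b. weak_gradient \<Omega> (\<lambda>x. ?U x \<bullet> b)"
  have uH: "u \<in> H1_space \<Omega>" and UH: "\<And>b. b \<in> Basis \<Longrightarrow> (\<lambda>x. ?U x \<bullet> b) \<in> H1_space \<Omega>"
    using u by (auto simp: H2_space_def)
  have eH: "e \<in> H1_space \<Omega>" using e by (simp add: H10_space_def)
  then have eL: "e \<in> L2_space ?M" by (simp add: H1_space_def)
  note W = weak_gradient_H1(2)[OF \<Omega>(1) uH] weak_gradient_H1(2)[OF \<Omega>(1) eH]
  have HL: "?H b \<in> L2_space ?M" if "b \<in> Basis" for b by (rule weak_gradient_H1(2)[OF \<Omega>(1) UH[OF that]])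
  have "(\<integral>x. ?U x \<bullet> ?E x \<partial>?M) = (\<integral>x. (\<Sum>b\<in>Basis. (?U x \<bullet> b) * (?E x \<bullet> b)) \<partial>?M)"
    by (subst euclidean_inner) simp
  also have "\<dots> = (\<Sum>b\<in>Basis. \<integral>x. (?U x \<bullet> b) * (?E x \<bullet> b) \<partial>?M)"
    using L2_inner_integrable[OF L2_inner_component[OF W(1)] L2_inner_component[OF W(2)]]
    by (intro Bochner_Integration.integral_sum) simp
  also have "\<dots> = (\<Sum>b\<in>Basis. - (\<integral>x. (?H b x \<bullet> b) * e x \<partial>?M))"
    by (intro sum.cong refl H10_integration_by_parts[OF \<Omega> e UH])
  finally have "\<bar>\<integral>x. ?U x \<bullet> ?E x \<partial>?M\<bar> = \<bar>\<Sum>b\<in>Basis. - (\<integral>x. (?H b x \<bullet> b) * e x \<partial>?M)\<bar>" by simp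
  also have "\<dots> \<le> (\<Sum>b\<in>(Basis :: 'a set). H2_norm \<Omega> u * L2_norm ?M e)"
  proof (rule order_trans[OF sum_abs sum_mono])
    fix b :: 'a assume b: "b \<in> Basis"
    have 1: "\<bar>\<integral>x. (?H b x \<bullet> b) * e x \<partial>?M\<bar> \<le> L2_norm ?M (\<lambda>x. ?H b x \<bullet> b) * L2_norm ?M e"
      using L2_Cauchy_Schwarz[OF L2_inner_component[OF HL[OF b], of b] eL] by simp
    have 2: "L2_norm ?M (\<lambda>x. ?H b x \<bullet> b) \<le> 1 * L2_norm ?M (?H b)"
    proof (rule L2_dominated(2)[OF _ HL[OF b]])
      show "(\<lambda>x. ?H b x \<bullet> b) \<in> borel_measurable ?M"
        using L2_inner_component[OF HL[OF b], of b] by (simp add: L2_space_def)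
    qed (use Basis_le_norm[OF b] in auto)
    have 3: "1 * L2_norm ?M (?H b) \<le> H2_norm \<Omega> u"
    proof -
      have "(L2_norm ?M (?H b))\<^sup>2 \<le> (\<Sum>b\<in>Basis. (L2_norm ?M (?H b))\<^sup>2)"
        using b by (intro member_le_sum) auto
      then show ?thesis unfolding H2_norm_def by (intro real_le_rsqrt) (simp add: add_increasing)
    qed
    show "\<bar>- (\<integral>x. (?H b x \<bullet> b) * e x \<partial>?M)\<bar> \<le> H2_norm \<Omega> u * L2_norm ?M e"
      unfolding abs_minus_cancel
      by (rule order_trans[OF 1 mult_right_mono[OF order_trans[OF 2 3] L2_norm_nonneg]])
  qed
  finally show ?thesis by simp
qed

lemma surface_null_AE:
  assumes "surface_null \<Omega> \<Gamma>"
  shows "AE x in surface_measure \<Omega>. x \<notin> \<Gamma>"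
proof -
  obtain N where "N \<in> null_sets (surface_measure \<Omega>)" "\<Gamma> \<subseteq> N"
    using assms by (auto simp: surface_null_def null_sets_completion_iff2)
  then show ?thesis by (intro AE_I'[of N]) auto
qed

text \<open>
  The three parts cover the boundary, so up to a null set all of it is inflow boundary.
\<close>

lemma inflow_trace_zero_H10:
  assumes \<Omega>: "bounded_lipschitz_domain \<Omega>"
    and null: "surface_null \<Omega> (outflow_boundary \<Omega> \<beta>)" "surface_null \<Omega> (characteristic_boundary \<Omega> \<beta>)"
    and v: "trace_vanishes_on \<Omega> (inflow_boundary \<Omega> \<beta>) v"
  shows "v \<in> H10_space \<Omega>"
proof -
  obtain g where g: "is_trace \<Omega> v g"
    and 0: "AE x in surface_measure \<Omega>. x \<in> inflow_boundary \<Omega> \<beta> \<longrightarrow> g x = 0"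
    using v by (auto simp: trace_vanishes_on_def)
  have "AE x in surface_measure \<Omega>. x \<in> frontier \<Omega>"
    by (rule AE_I2) (simp add: space_surface_measure)
  then have "AE x in surface_measure \<Omega>. g x = 0"
    using 0 null[THEN surface_null_AE]
  proof eventually_elim
    case (elim x)
    then show ?case
      unfolding inflow_boundary_def outflow_boundary_def characteristic_boundary_def by force
  qed
  then show ?thesis by (rule zero_trace_H10[OF \<Omega> g])
qed

lemma essinf_pos_bound:
  assumes "0 < essinf M (\<lambda>x. ereal (F x))"
  obtains c :: real where "0 < c" "AE x in M. c \<le> F x"
proof -
  obtain c where c: "0 < ereal c" "ereal c < essinf M (\<lambda>x. ereal (F x))"
    using ereal_dense2[OF assms] by auto
  have "AE x in M. - ereal (F x) \<le> esssup M (\<lambda>x. - ereal (F x))" by (rule esssup_AE)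
  then have "AE x in M. c \<le> F x"
  proof eventually_elim
    case (elim x)
    then have "essinf M (\<lambda>x. ereal (F x)) \<le> ereal (F x)"
      unfolding essinf_def by (metis ereal_minus_le_minus ereal_uminus_uminus)
    then have "ereal c < ereal (F x)" using c(2) by (rule less_le_trans[rotated])
    then show ?case by simp
  qed
  then show thesis using that c(1) by simp
qed

lemma energy_bound_imp_rates:
  fixes E N H c n \<epsilon> :: real
  assumes c: "0 < c" and \<epsilon>: "0 < \<epsilon>" and nn: "0 \<le> E" "0 \<le> N" "0 \<le> H" "0 \<le> n"
    and energy: "\<epsilon> * N\<^sup>2 + c * E\<^sup>2 \<le> \<epsilon> * (n * H * E)"
  shows "E \<le> n / c * H * \<epsilon>" "N \<le> n / sqrt c * H * sqrt \<epsilon>"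
proof -
  show E: "E \<le> n / c * H * \<epsilon>"
  proof (cases "E = 0")
    case False
    have "c * E\<^sup>2 \<le> \<epsilon> * (n * H * E)" using energy \<epsilon> by (smt (verit) mult_nonneg_nonneg zero_le_power2)
    then have "(c * E) * E \<le> (\<epsilon> * n * H) * E" by (simp add: power2_eq_square mult_ac)
    then have "c * E \<le> \<epsilon> * n * H" using False nn(1) by (simp add: mult_le_cancel_right)
    then show ?thesis using c by (simp add: field_simps)
  qed (use nn c \<epsilon> in simp)
  have "\<epsilon> * N\<^sup>2 \<le> \<epsilon> * (n * H * E)" using energy c by (smt (verit) mult_nonneg_nonneg zero_le_power2)
  then have "N\<^sup>2 \<le> n * H * E" using \<epsilon> by simp
  also have "\<dots> \<le> n * H * (n / c * H * \<epsilon>)" using E nn by (intro mult_left_mono) auto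
  also have "\<dots> = (n / sqrt c * H * sqrt \<epsilon>)\<^sup>2" using c \<epsilon> by (simp add: power_mult_distrib power_divide power2_eq_square[of n] power2_eq_square[of H])
  finally show "N \<le> n / sqrt c * H * sqrt \<epsilon>" by (rule power2_le_imp_le) (use c \<epsilon> nn in simp)
qed

text \<open>
  The regularized problem is tested with \<open>u\<close> and with \<open>w\<close>, and the results are subtracted, which
  amounts to testing with the error \<open>e = u - w\<close>. The transport equation replaces \<open>f\<close>,
  which leaves \<open>\<epsilon> \<integral> \<nabla>u \<bullet> \<nabla>e - \<epsilon> \<parallel>\<nabla>e\<parallel>\<^sup>2 = \<integral> (\<beta> \<bullet> \<nabla>e + \<mu> e) e\<close>. The right-hand side is coercive by
  the advection identity.
\<close>

lemma energy_estimate: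
  fixes \<Omega> :: "'a::euclidean_space set"
  assumes \<Omega>: "open \<Omega>" "bounded \<Omega>"
    and \<beta>: "\<And>b. b \<in> Basis \<Longrightarrow> (\<lambda>x. \<beta> x \<bullet> b) \<in> W1inf_space \<Omega>"
    and \<mu>: "\<mu> \<in> Linf_space (lebesgue_on \<Omega>)"
    and c: "AE x in lebesgue_on \<Omega>. c \<le> \<mu> x - weak_divergence \<Omega> \<beta> x / 2"
    and f: "f \<in> L2_space (lebesgue_on \<Omega>)"
    and u: "u \<in> H2_space \<Omega>" "u \<in> H10_space \<Omega>" "u \<in> H1_inflow_space \<Omega> \<beta>" "solves_transport \<Omega> \<beta> \<mu> f u"
    and w: "w \<in> H10_space \<Omega>" "solves_regularized \<Omega> \<beta> \<mu> \<epsilon> f w" and \<epsilon>: "0 < \<epsilon>"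
  shows "\<epsilon> * (L2_norm (lebesgue_on \<Omega>) (weak_gradient \<Omega> (\<lambda>x. u x - w x)))\<^sup>2 +
      c * (L2_norm (lebesgue_on \<Omega>) (\<lambda>x. u x - w x))\<^sup>2 \<le>
    \<epsilon> * (DIM('a) * H2_norm \<Omega> u * L2_norm (lebesgue_on \<Omega>) (\<lambda>x. u x - w x))"
proof -
  let ?M = "lebesgue_on \<Omega>"
  define e where "e = (\<lambda>x. u x - w x)"
  let ?U = "weak_gradient \<Omega> u" and ?W = "weak_gradient \<Omega> w" and ?E = "weak_gradient \<Omega> e"
  have H: "u \<in> H1_space \<Omega>" "w \<in> H1_space \<Omega>" using u(2) w(1) by (auto simp: H10_space_def)
  then have L: "u \<in> L2_space ?M" "w \<in> L2_space ?M" by (auto simp: H1_space_def)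
  note G = weak_gradient_H1(2)[OF \<Omega>(1) H(1)] weak_gradient_H1(2)[OF \<Omega>(1) H(2)]
  have e10: "e \<in> H10_space \<Omega>" unfolding e_def by (rule H10_diff[OF \<Omega> u(2) w(1)])
  have eH: "e \<in> H1_space \<Omega>" and Eeq: "AE x in ?M. ?E x = ?U x - ?W x"
    unfolding e_def by (rule H1_diff[OF \<Omega>(1) H])+
  have eL: "e \<in> L2_space ?M" using eH by (simp add: H1_space_def)
  note GE = weak_gradient_H1(2)[OF \<Omega>(1) eH]
  have \<beta>inf: "\<beta> \<in> Linf_space ?M" by (rule Linf_vector) (use \<beta> in \<open>simp add: W1inf_space_def\<close>)
  note div = weak_divergence_Linf[OF \<Omega>(1) \<beta>]
  have inf_L2: "(\<lambda>x. \<mu> x * z x) \<in> L2_space ?M" "(\<lambda>x. weak_divergence \<Omega> \<beta> x * z x) \<in> L2_space ?M"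
    if "z \<in> L2_space ?M" for z
    using Linf_inner_L2[OF \<mu> that] Linf_inner_L2[OF div that] by simp_all
  note \<beta>L = Linf_inner_L2[OF \<beta>inf]
  have prod: "integrable ?M (\<lambda>x. p x * q x)" if "p \<in> L2_space ?M" "q \<in> L2_space ?M" for p q :: "'a \<Rightarrow> real"
    using L2_inner_integrable[OF that] by simp
  let ?R = "\<lambda>x. \<beta> x \<bullet> ?W x + \<mu> x * w x"
  have RL: "integrable ?M (\<lambda>x. ?R x * z x)" if "z \<in> L2_space ?M" for z
    using prod[OF \<beta>L[OF G(2)] that] prod[OF inf_L2(1)[OF L(2)] that] by (simp add: distrib_right)
  have reg: "\<epsilon> * (\<integral>x. ?W x \<bullet> weak_gradient \<Omega> v x \<partial>?M) + (\<integral>x. ?R x * v x \<partial>?M) = (\<integral>x. f x * v x \<partial>?M)"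
    if "v \<in> H1_inflow_space \<Omega> \<beta>" for v
    using w(2) that by (simp add: solves_regularized_def)
  have wI: "w \<in> H1_inflow_space \<Omega> \<beta>" using w(2) by (simp add: solves_regularized_def)
  have i: "integrable ?M (\<lambda>x. ?W x \<bullet> ?U x)" "integrable ?M (\<lambda>x. ?W x \<bullet> ?W x)" "integrable ?M (\<lambda>x. ?U x \<bullet> ?E x)"
    "integrable ?M (\<lambda>x. ?E x \<bullet> ?E x)"
    by (intro L2_inner_integrable G GE)+
  have split: "(\<integral>x. ?R x * e x \<partial>?M) = (\<integral>x. ?R x * u x \<partial>?M) - (\<integral>x. ?R x * w x \<partial>?M)"
    "(\<integral>x. f x * e x \<partial>?M) = (\<integral>x. f x * u x \<partial>?M) - (\<integral>x. f x * w x \<partial>?M)"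
    using RL[OF L(1)] RL[OF L(2)] prod[OF f L(1)] prod[OF f L(2)] by (simp_all add: e_def right_diff_distrib)
  have WE: "(\<integral>x. ?W x \<bullet> ?U x \<partial>?M) - (\<integral>x. ?W x \<bullet> ?W x \<partial>?M) =
      (\<integral>x. ?U x \<bullet> ?E x \<partial>?M) - (\<integral>x. ?E x \<bullet> ?E x \<partial>?M)"
  proof -
    have "(\<integral>x. ?W x \<bullet> ?U x - ?W x \<bullet> ?W x \<partial>?M) = (\<integral>x. ?U x \<bullet> ?E x - ?E x \<bullet> ?E x \<partial>?M)"
    proof (rule integral_cong_AE)
      show "AE x in ?M. ?W x \<bullet> ?U x - ?W x \<bullet> ?W x = ?U x \<bullet> ?E x - ?E x \<bullet> ?E x"
        using Eeq by eventually_elim (simp add: inner_diff_left inner_diff_right inner_commute)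
    qed (use i in \<open>auto intro: borel_measurable_diff borel_measurable_integrable\<close>)
    then show ?thesis using i by simp
  qed
  have eq1: "\<epsilon> * ((\<integral>x. ?U x \<bullet> ?E x \<partial>?M) - (\<integral>x. ?E x \<bullet> ?E x \<partial>?M)) = (\<integral>x. f x * e x \<partial>?M) - (\<integral>x. ?R x * e x \<partial>?M)"
    using reg[OF u(3)] reg[OF wI] unfolding split WE[symmetric] by (simp add: right_diff_distrib)
  have eq2: "(\<integral>x. f x * e x \<partial>?M) - (\<integral>x. ?R x * e x \<partial>?M) =
      (\<integral>x. e x * (\<beta> x \<bullet> ?E x) \<partial>?M) + (\<integral>x. e x * (\<mu> x * e x) \<partial>?M)"
  proof -
    have j: "integrable ?M (\<lambda>x. e x * (\<beta> x \<bullet> ?E x))" "integrable ?M (\<lambda>x. e x * (\<mu> x * e x))"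
      by (intro prod eL \<beta>L[OF GE] inf_L2)+
    have "(\<integral>x. f x * e x - ?R x * e x \<partial>?M) = (\<integral>x. e x * (\<beta> x \<bullet> ?E x) + e x * (\<mu> x * e x) \<partial>?M)"
    proof (rule integral_cong_AE)
      have "AE x in ?M. \<beta> x \<bullet> ?U x + \<mu> x * u x = f x" using u(4) by (simp add: solves_transport_def)
      then show "AE x in ?M. f x * e x - ?R x * e x = e x * (\<beta> x \<bullet> ?E x) + e x * (\<mu> x * e x)"
        using Eeq
      proof eventually_elim
        case (elim x)
        then show ?case
          unfolding elim(1)[symmetric] elim(2) by (simp add: e_def inner_diff_right algebra_simps)
      qed
    qed (use j prod[OF f eL] RL[OF eL] in \<open>auto intro: borel_measurable_diff borel_measurable_add borel_measurable_integrable\<close>)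
    then show ?thesis using j prod[OF f eL] RL[OF eL] by simp
  qed
  have k: "integrable ?M (\<lambda>x. e x * (weak_divergence \<Omega> \<beta> x * e x))" "integrable ?M (\<lambda>x. e x * (\<mu> x * e x))"
    by (intro prod eL inf_L2)+
  have eint: "integrable ?M (\<lambda>x. (e x)\<^sup>2)" using eL by (simp add: L2_space_def)
  have "c * (L2_norm ?M e)\<^sup>2 = (\<integral>x. c * (e x)\<^sup>2 \<partial>?M)" by (simp add: L2_norm_sq)
  also have "\<dots> \<le> (\<integral>x. e x * (\<mu> x * e x) - e x * (weak_divergence \<Omega> \<beta> x * e x) / 2 \<partial>?M)"
  proof (rule integral_mono_AE)
    show "AE x in ?M. c * (e x)\<^sup>2 \<le> e x * (\<mu> x * e x) - e x * (weak_divergence \<Omega> \<beta> x * e x) / 2"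
      using c
    proof eventually_elim
      case (elim x)
      then have "c * (e x)\<^sup>2 \<le> (\<mu> x - weak_divergence \<Omega> \<beta> x / 2) * (e x)\<^sup>2" by (rule mult_right_mono) simp
      then show ?case by (simp add: power2_eq_square algebra_simps)
    qed
  qed (use eint k in simp_all)
  also have "\<dots> = (\<integral>x. e x * (\<mu> x * e x) \<partial>?M) - (\<integral>x. e x * (weak_divergence \<Omega> \<beta> x * e x) \<partial>?M) / 2"
    using k by simp
  also have "\<dots> = (\<integral>x. e x * (\<mu> x * e x) \<partial>?M) + (\<integral>x. e x * (\<beta> x \<bullet> ?E x) \<partial>?M)"
    using advection_identity[OF \<Omega> \<beta> e10] by simp
  also have "\<dots> = \<epsilon> * ((\<integral>x. ?U x \<bullet> ?E x \<partial>?M) - (\<integral>x. ?E x \<bullet> ?E x \<partial>?M))" using eq1 eq2 by simp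
  finally have "c * (L2_norm ?M e)\<^sup>2 \<le> \<epsilon> * (\<integral>x. ?U x \<bullet> ?E x \<partial>?M) - \<epsilon> * (L2_norm ?M ?E)\<^sup>2"
    by (simp add: L2_norm_sq power2_norm_eq_inner right_diff_distrib)
  moreover have "\<epsilon> * (\<integral>x. ?U x \<bullet> ?E x \<partial>?M) \<le> \<epsilon> * (DIM('a) * H2_norm \<Omega> u * L2_norm ?M e)"
    using dirichlet_pairing_bound[OF \<Omega> u(1) e10] \<epsilon> by (intro mult_left_mono) auto
  ultimately show ?thesis unfolding e_def[symmetric] by linarith
qed

theorem theorem5p3:
  fixes \<Omega> :: "'a::euclidean_space set" and \<beta> :: "'a \<Rightarrow> 'a" and \<mu> :: "'a \<Rightarrow> real"
  assumes "bounded_lipschitz_domain \<Omega>"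
    and "\<And>b. b \<in> Basis \<Longrightarrow> (\<lambda>x. \<beta> x \<bullet> b) \<in> W1inf_space \<Omega>"
    and "\<exists>L. L-lipschitz_on (closure \<Omega>) \<beta>"
    and "\<mu> \<in> Linf_space (lebesgue_on \<Omega>)"
    and "essinf (lebesgue_on \<Omega>) (\<lambda>x. ereal (\<mu> x - weak_divergence \<Omega> \<beta> x / 2)) > 0"
    and "surface_null \<Omega> (outflow_boundary \<Omega> \<beta>)"
    and "surface_null \<Omega> (characteristic_boundary \<Omega> \<beta>)"
  shows "\<exists>C>0. \<forall>f u. f \<in> L2_space (lebesgue_on \<Omega>) \<longrightarrow>
    solves_transport \<Omega> \<beta> \<mu> f u \<longrightarrow>
    u \<in> H2_space \<Omega> \<inter> H_beta_inflow_space \<Omega> \<beta> \<longrightarrow>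
    (\<forall>\<epsilon>>0. \<forall>u\<^sub>\<epsilon>. solves_regularized \<Omega> \<beta> \<mu> \<epsilon> f u\<^sub>\<epsilon> \<longrightarrow>
       L2_norm (lebesgue_on \<Omega>) (\<lambda>x. u x - u\<^sub>\<epsilon> x) \<le> C * H2_norm \<Omega> u * \<epsilon> \<and>
       L2_norm (lebesgue_on \<Omega>) (weak_gradient \<Omega> (\<lambda>x. u x - u\<^sub>\<epsilon> x))
         \<le> C * H2_norm \<Omega> u * sqrt \<epsilon>)"
proof -
  have \<Omega>: "open \<Omega>" "bounded \<Omega>" using assms(1) by (auto simp: bounded_lipschitz_domain_def)
  obtain c where c: "0 < c" "AE x in lebesgue_on \<Omega>. c \<le> \<mu> x - weak_divergence \<Omega> \<beta> x / 2"
    using essinf_pos_bound[OF assms(5)] .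
  note H10 = inflow_trace_zero_H10[OF assms(1,6,7)]
  let ?n = "real DIM('a)"
  let ?C = "?n / c + ?n / sqrt c"
  have n: "0 < ?n" by simp
  show ?thesis
  proof (intro exI[of _ ?C] conjI allI impI)
    show "0 < ?C" using c n by (intro add_pos_pos divide_pos_pos) auto
    fix f u \<epsilon> w
    assume f: "f \<in> L2_space (lebesgue_on \<Omega>)" and tr: "solves_transport \<Omega> \<beta> \<mu> f u"
      and u: "u \<in> H2_space \<Omega> \<inter> H_beta_inflow_space \<Omega> \<beta>" and \<epsilon>: "(0::real) < \<epsilon>"
      and w: "solves_regularized \<Omega> \<beta> \<mu> \<epsilon> f w"
    have u0: "trace_vanishes_on \<Omega> (inflow_boundary \<Omega> \<beta>) u" and u2: "u \<in> H2_space \<Omega>"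
      using u by (auto simp: H_beta_inflow_space_def)
    have w0: "trace_vanishes_on \<Omega> (inflow_boundary \<Omega> \<beta>) w"
      using w by (simp add: solves_regularized_def H1_inflow_space_def)
    have uI: "u \<in> H1_inflow_space \<Omega> \<beta>" using u0 u2 by (simp add: H1_inflow_space_def H2_space_def)
    have H0: "0 \<le> H2_norm \<Omega> u" by (simp add: H2_norm_def sum_nonneg)
    note rates = energy_bound_imp_rates[OF c(1) \<epsilon> L2_norm_nonneg L2_norm_nonneg H0 less_imp_le[OF n]
        energy_estimate[OF \<Omega> assms(2,4) c(2) f u2 H10[OF u0] uI tr H10[OF w0] w \<epsilon>]]
    have "?n / c * H2_norm \<Omega> u * \<epsilon> \<le> ?C * H2_norm \<Omega> u * \<epsilon>"
      using c H0 \<epsilon> by (intro mult_right_mono) auto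
    then show "L2_norm (lebesgue_on \<Omega>) (\<lambda>x. u x - w x) \<le> ?C * H2_norm \<Omega> u * \<epsilon>"
      using rates(1) by linarith
    have "?n / sqrt c * H2_norm \<Omega> u * sqrt \<epsilon> \<le> ?C * H2_norm \<Omega> u * sqrt \<epsilon>"
      using c H0 \<epsilon> by (intro mult_right_mono) auto
    then show "L2_norm (lebesgue_on \<Omega>) (weak_gradient \<Omega> (\<lambda>x. u x - w x)) \<le> ?C * H2_norm \<Omega> u * sqrt \<epsilon>"
      using rates(2) by linarith
  qed
qed

end
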